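(* Let $G$ be a semi étale groupoid. Assume that $G_x=\{x\}$ for some $x\in G^0$. Then $C^*_r(G)$ is simple if and only if there are no non-trivial $G$-invariant ideals in $D_G$.
   Context: $G$ denotes a locally compact Hausdorff topological groupoid with unit space $G^0$, range map $r$ and source map $s$. A bisection is an open set $U\subseteq G$ on which both $r$ and $s$ are injective; $G$ is semi étale if its topology has a base consisting of bisections (equivalently, $r$ is locally injective; $r$ need not be open). For $x\in G^0$ the isotropy group is $G_x=\{\gamma\in G: r(\gamma)=s(\gamma)=x\}$. Let $B_c(G)$ be the $*$-algebra of bounded compactly supported (not necessarily continuous) functions $f:G\to\mathbb C$ with product $(f\star g)(\gamma)=\sum_{\gamma_1\gamma_2=\gamma}f(\gamma_1)g(\gamma_2)$ and involution $f^*(\gamma)=\overline{f(\gamma^{-1})}$. For $x\in G^0$ let $\pi_x$ be the $*$-representation of $B_c(G)$ on $l^2(s^{-1}(x))$ given by $(\pi_x(f)\psi)(\gamma)=\sum_{\gamma_1\gamma_2=\gamma}f(\gamma_1)\psi(\gamma_2)$. $B^*_r(G)$ is the completion of $B_c(G)$ in the norm $\|f\|=\sup_{x\in G^0}\|\pi_x(f)\|$. $C_c(G)\subseteq B_c(G)$ is the subspace of continuous compactly supported functions, $\mathrm{alg}^*G$ is the $*$-subalgebra of $B_c(G)$ generated by $C_c(G)$, and $C^*_r(G)$ is the closure of $\mathrm{alg}^*G$ in $B^*_r(G)$. $B_0(G^0)$ is the $C^*$-algebra of bounded functions on $G^0$ vanishing at infinity (not necessarily continuous). Extension by zero, $B_c(G^0)\subseteq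 B_c(G)$, extends to an isometric embedding $B_0(G^0)\subseteq B^*_r(G)$, and $D_G=C^*_r(G)\cap B_0(G^0)$. Let $N_0(D_G)$ be the set of functions in $\mathrm{alg}^*G$ that are supported in a bisection. A closed ideal $J\subseteq D_G$ is $G$-invariant if $n^*Jn\subseteq J$ for all $n\in N_0(D_G)$. An ideal of a $C^*$-algebra is non-trivial if it is neither $\{0\}$ nor the whole algebra; ideals are closed and two-sided. *)

theory Defs
  imports "HOL-Analysis.Analysis"
begin

section \<open>The Hilbert space of square summable functions\<close>

typedef 'a ell2 = "{f :: 'a \<Rightarrow> complex. (\<lambda>x. (cmod (f x))\<^sup>2) summable_on UNIV}"
  morphisms ell2_fun Ell2
  by (rule exI[of _ "\<lambda>_. 0"]) simp

setup_lifting type_definition_ell2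

lemma ell2_eqI: "(\<And>x. ell2_fun f x = ell2_fun g x) \<Longrightarrow> f = g"
  by transfer auto

lemma ell2_summable: "(\<lambda>x. (cmod (ell2_fun f x))\<^sup>2) summable_on S"
proof -
  have "(\<lambda>x. (cmod (ell2_fun f x))\<^sup>2) summable_on UNIV"
    using ell2_fun[of f] by simp
  then show ?thesis
    by (rule summable_on_subset_banach) simp
qed

lemma sq_summable_add:
  fixes f g :: "'a \<Rightarrow> complex"
  assumes "(\<lambda>x. (cmod (f x))\<^sup>2) summable_on S" "(\<lambda>x. (cmod (g x))\<^sup>2) summable_on S"
  shows "(\<lambda>x. (cmod (f x + g x))\<^sup>2) summable_on S"
proof (rule summable_on_comparison_test)
  show "(\<lambda>x. 2 * (cmod (f x))\<^sup>2 + 2 * (cmod (g x))\<^sup>2) summable_on S"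
    by (intro summable_on_add summable_on_cmult_right assms)
  fix x
  have "(cmod (f x + g x))\<^sup>2 \<le> (cmod (f x) + cmod (g x))\<^sup>2"
    by (intro power_mono norm_triangle_ineq) auto
  also have "\<dots> \<le> 2 * (cmod (f x))\<^sup>2 + 2 * (cmod (g x))\<^sup>2"
    using sum_squares_bound[of "cmod (f x)" "cmod (g x)"] by (simp add: power2_sum)
  finally show "(cmod (f x + g x))\<^sup>2 \<le> 2 * (cmod (f x))\<^sup>2 + 2 * (cmod (g x))\<^sup>2" .
qed auto

lemma sq_summable_cmult:
  fixes f :: "'a \<Rightarrow> complex"
  assumes "(\<lambda>x. (cmod (f x))\<^sup>2) summable_on S"
  shows "(\<lambda>x. (cmod (c * f x))\<^sup>2) summable_on S"
  using summable_on_cmult_right[OF assms, of "(cmod c)\<^sup>2"]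
  by (simp add: norm_mult power_mult_distrib)

instantiation ell2 :: (type) real_vector
begin

lift_definition zero_ell2 :: "'a ell2" is "\<lambda>_. 0" by simp
lift_definition plus_ell2 :: "'a ell2 \<Rightarrow> 'a ell2 \<Rightarrow> 'a ell2" is "\<lambda>f g x. f x + g x"
  by (rule sq_summable_add)
lift_definition uminus_ell2 :: "'a ell2 \<Rightarrow> 'a ell2" is "\<lambda>f x. - f x" by simp
lift_definition minus_ell2 :: "'a ell2 \<Rightarrow> 'a ell2 \<Rightarrow> 'a ell2" is "\<lambda>f g x. f x - g x"
proof -
  fix f g :: "'a \<Rightarrow> complex"
  assume "(\<lambda>x. (cmod (f x))\<^sup>2) summable_on UNIV" "(\<lambda>x. (cmod (g x))\<^sup>2) summable_on UNIV"
  then show "(\<lambda>x. (cmod (f x - g x))\<^sup>2) summable_on UNIV"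
    using sq_summable_add[of f UNIV "\<lambda>x. - g x"] by simp
qed
lift_definition scaleR_ell2 :: "real \<Rightarrow> 'a ell2 \<Rightarrow> 'a ell2" is "\<lambda>c f x. complex_of_real c * f x"
  by (rule sq_summable_cmult)

instance
  by standard (transfer; simp add: algebra_simps fun_eq_iff)+

end

lemmas ell2_fun_simps [simp] =
  zero_ell2.rep_eq plus_ell2.rep_eq uminus_ell2.rep_eq minus_ell2.rep_eq scaleR_ell2.rep_eq

lift_definition ell2_scaleC :: "complex \<Rightarrow> 'a ell2 \<Rightarrow> 'a ell2" is "\<lambda>c f x. c * f x"
  by (rule sq_summable_cmult)

text \<open>Only the real part of the complex inner product is needed to obtain the norm; hence the
  library's class of real inner product spaces is used.\<close>

instantiation ell2 :: (type) real_inner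
begin

definition inner_ell2 :: "'a ell2 \<Rightarrow> 'a ell2 \<Rightarrow> real"
  where "inner_ell2 f g = (\<Sum>\<^sub>\<infinity>x. Re (ell2_fun f x * cnj (ell2_fun g x)))"
definition norm_ell2 :: "'a ell2 \<Rightarrow> real"
  where "norm_ell2 f = sqrt (\<Sum>\<^sub>\<infinity>x. (cmod (ell2_fun f x))\<^sup>2)"
definition sgn_ell2 :: "'a ell2 \<Rightarrow> 'a ell2"
  where "sgn_ell2 f = f /\<^sub>R norm f"
definition dist_ell2 :: "'a ell2 \<Rightarrow> 'a ell2 \<Rightarrow> real"
  where "dist_ell2 f g = norm (f - g)"
definition uniformity_ell2 :: "('a ell2 \<times> 'a ell2) filter"
  where "uniformity_ell2 = (INF e\<in>{0 <..}. principal {(x, y). dist x y < e})"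
definition open_ell2 :: "'a ell2 set \<Rightarrow> bool"
  where "open_ell2 S = (\<forall>x\<in>S. \<forall>\<^sub>F (x', y) in uniformity. x' = x \<longrightarrow> y \<in> S)"

lemma ell2_inner_summable:
  "(\<lambda>x. Re (ell2_fun f x * cnj (ell2_fun g x))) summable_on S"
proof -
  have "(\<lambda>x. (cmod (ell2_fun f x))\<^sup>2 + (cmod (ell2_fun g x))\<^sup>2) summable_on S"
    by (intro summable_on_add ell2_summable)
  moreover have "norm (Re (ell2_fun f x * cnj (ell2_fun g x)))
      \<le> (cmod (ell2_fun f x))\<^sup>2 + (cmod (ell2_fun g x))\<^sup>2" for x
  proof -
    have "\<bar>Re (ell2_fun f x * cnj (ell2_fun g x))\<bar> \<le> cmod (ell2_fun f x) * cmod (ell2_fun g x)"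
      using abs_Re_le_cmod[of "ell2_fun f x * cnj (ell2_fun g x)"] by (simp add: norm_mult)
    also have "\<dots> \<le> (cmod (ell2_fun f x))\<^sup>2 + (cmod (ell2_fun g x))\<^sup>2"
      using sum_squares_bound[of "cmod (ell2_fun f x)" "cmod (ell2_fun g x)"]
        mult_nonneg_nonneg[OF norm_ge_zero norm_ge_zero, of "ell2_fun f x" "ell2_fun g x"]
      by linarith
    finally show ?thesis by simp
  qed
  ultimately have "(\<lambda>x. norm (Re (ell2_fun f x * cnj (ell2_fun g x)))) summable_on S"
    by (rule summable_on_comparison_test) auto
  then show ?thesis
    by (rule abs_summable_summable)
qed

instance
proof
  fix x y z :: "'a ell2" and r :: real
  show "dist x y = norm (x - y)" by (rule dist_ell2_def)
  show "sgn x = x /\<^sub>R norm x" by (rule sgn_ell2_def)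
  show "uniformity = (INF e\<in>{0 <..}. principal {(x, y). dist x y < (e::real)} :: ('a ell2 \<times> _) filter)"
    by (rule uniformity_ell2_def)
  show "open U \<longleftrightarrow> (\<forall>x\<in>U. \<forall>\<^sub>F (x', y) in uniformity. x' = x \<longrightarrow> y \<in> U)" for U :: "'a ell2 set"
    by (rule open_ell2_def)
  show "inner x y = inner y x"
    unfolding inner_ell2_def by (simp add: mult.commute)
  show "inner (x + y) z = inner x z + inner y z"
    unfolding inner_ell2_def
    by (subst infsum_add[symmetric, OF ell2_inner_summable ell2_inner_summable])
       (simp add: algebra_simps)
  show "inner (r *\<^sub>R x) y = r * inner x y"
    unfolding inner_ell2_def
    by (subst infsum_cmult_right'[symmetric]) (simp add: algebra_simps)
  have sq: "Re (ell2_fun x u * cnj (ell2_fun x u)) = (cmod (ell2_fun x u))\<^sup>2" for u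
    by (simp add: complex_mult_cnj cmod_power2)
  show "0 \<le> inner x x"
    unfolding inner_ell2_def sq by (intro infsum_nonneg) simp
  show "inner x x = 0 \<longleftrightarrow> x = 0"
  proof
    assume 0: "inner x x = 0"
    show "x = 0"
    proof (rule ell2_eqI)
      fix u
      have "(cmod (ell2_fun x u))\<^sup>2 = 0"
        using 0 unfolding inner_ell2_def sq
        by (intro nonneg_infsum_le_0D[where A = UNIV] ell2_summable) auto
      then show "ell2_fun x u = ell2_fun 0 u" by simp
    qed
  qed (simp add: inner_ell2_def)
  show "norm x = sqrt (inner x x)"
    unfolding inner_ell2_def norm_ell2_def sq ..
qed

end

lemma norm_ell2_sq: "(norm f)\<^sup>2 = (\<Sum>\<^sub>\<infinity>x. (cmod (ell2_fun f x))\<^sup>2)"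
  unfolding norm_ell2_def by (simp add: infsum_nonneg)

lemma sum_le_norm_ell2:
  assumes "finite F"
  shows "(\<Sum>x\<in>F. (cmod (ell2_fun f x))\<^sup>2) \<le> (norm f)\<^sup>2"
  unfolding norm_ell2_sq
  by (rule finite_sum_le_infsum[OF ell2_summable assms]) auto

lemma cmod_le_norm_ell2: "cmod (ell2_fun f x) \<le> norm f"
  by (rule power2_le_imp_le) (use sum_le_norm_ell2[of "{x}" f] in simp_all)

lemma sq_summable_bounded_sums:
  fixes f :: "'a \<Rightarrow> complex"
  assumes "\<And>F. finite F \<Longrightarrow> (\<Sum>x\<in>F. (cmod (f x))\<^sup>2) \<le> C"
  shows "(\<lambda>x. (cmod (f x))\<^sup>2) summable_on UNIV" "(\<Sum>\<^sub>\<infinity>x. (cmod (f x))\<^sup>2) \<le> C"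
proof -
  show *: "(\<lambda>x. (cmod (f x))\<^sup>2) summable_on UNIV"
  proof (rule nonneg_bdd_above_summable_on)
    show "bdd_above (sum (\<lambda>x. (cmod (f x))\<^sup>2) ` {F. F \<subseteq> UNIV \<and> finite F})"
      by (rule bdd_aboveI2[where M = C]) (use assms in blast)
  qed simp
  show "(\<Sum>\<^sub>\<infinity>x. (cmod (f x))\<^sup>2) \<le> C"
    by (rule infsum_le_finite_sums[OF *]) (rule assms)
qed

instance ell2 :: (type) banach
proof
  fix X :: "nat \<Rightarrow> 'a ell2"
  assume X: "Cauchy X"
  have "Cauchy (\<lambda>n. ell2_fun (X n) x)" for x
  proof (rule metric_CauchyI)
    fix e :: real assume "0 < e"
    from metric_CauchyD[OF X this] obtain M
      where M: "\<And>m n. m \<ge> M \<Longrightarrow> n \<ge> M \<Longrightarrow> dist (X m) (X n) < e" by blast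
    have "dist (ell2_fun (X m) x) (ell2_fun (X n) x) < e" if "m \<ge> M" "n \<ge> M" for m n
      using cmod_le_norm_ell2[of "X m - X n" x] M[OF that] by (simp add: dist_norm)
    then show "\<exists>M. \<forall>m\<ge>M. \<forall>n\<ge>M. dist (ell2_fun (X m) x) (ell2_fun (X n) x) < e" by blast
  qed
  then have "\<exists>l. (\<lambda>n. ell2_fun (X n) x) \<longlonglongrightarrow> l" for x
    by (simp add: Cauchy_convergent_iff convergent_def)
  then obtain L where L: "\<And>x. (\<lambda>n. ell2_fun (X n) x) \<longlonglongrightarrow> L x" by metis
  have tail: "\<exists>M. \<forall>n\<ge>M. \<forall>F. finite F \<longrightarrow> (\<Sum>x\<in>F. (cmod (ell2_fun (X n) x - L x))\<^sup>2) \<le> e\<^sup>2"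
    if "0 < e" for e
  proof -
    from metric_CauchyD[OF X that] obtain M
      where M: "\<And>m n. m \<ge> M \<Longrightarrow> n \<ge> M \<Longrightarrow> dist (X m) (X n) < e" by blast
    have "(\<Sum>x\<in>F. (cmod (ell2_fun (X n) x - L x))\<^sup>2) \<le> e\<^sup>2" if "n \<ge> M" "finite F" for n F
    proof (rule LIMSEQ_le_const2)
      show "(\<lambda>m. \<Sum>x\<in>F. (cmod (ell2_fun (X n) x - ell2_fun (X m) x))\<^sup>2)
          \<longlonglongrightarrow> (\<Sum>x\<in>F. (cmod (ell2_fun (X n) x - L x))\<^sup>2)"
        by (intro tendsto_sum tendsto_power tendsto_norm tendsto_diff tendsto_const L)
      have "(\<Sum>x\<in>F. (cmod (ell2_fun (X n) x - ell2_fun (X m) x))\<^sup>2) \<le> e\<^sup>2" if "m \<ge> M" for m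
      proof -
        have "(\<Sum>x\<in>F. (cmod (ell2_fun (X n) x - ell2_fun (X m) x))\<^sup>2) \<le> (norm (X n - X m))\<^sup>2"
          using sum_le_norm_ell2[OF \<open>finite F\<close>, of "X n - X m"] by simp
        also have "\<dots> \<le> e\<^sup>2"
          using M[OF \<open>n \<ge> M\<close> that] by (intro power_mono) (auto simp: dist_norm)
        finally show ?thesis .
      qed
      then show "\<exists>N. \<forall>m\<ge>N. (\<Sum>x\<in>F. (cmod (ell2_fun (X n) x - ell2_fun (X m) x))\<^sup>2) \<le> e\<^sup>2"
        by blast
    qed
    then show ?thesis by blast
  qed
  obtain M1 where M1: "\<And>F. finite F \<Longrightarrow> (\<Sum>x\<in>F. (cmod (ell2_fun (X M1) x - L x))\<^sup>2) \<le> 1\<^sup>2"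
    using tail[OF zero_less_one] by (meson order_refl)
  have "(\<lambda>x. (cmod (ell2_fun (X M1) x + - 1 * (ell2_fun (X M1) x - L x)))\<^sup>2) summable_on UNIV"
    by (intro sq_summable_add sq_summable_cmult ell2_summable sq_summable_bounded_sums(1)[OF M1])
  moreover have "ell2_fun (X M1) x + - 1 * (ell2_fun (X M1) x - L x) = L x" for x
    by simp
  ultimately have "(\<lambda>x. (cmod (L x))\<^sup>2) summable_on UNIV"
    by (simp only:)
  then have Lfun: "ell2_fun (Ell2 L) = L"
    by (intro Ell2_inverse CollectI)
  have "X \<longlonglongrightarrow> Ell2 L"
  proof (rule metric_LIMSEQ_I)
    fix e :: real assume "0 < e"
    then obtain M where M: "\<And>n F. n \<ge> M \<Longrightarrow> finite F \<Longrightarrow>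
        (\<Sum>x\<in>F. (cmod (ell2_fun (X n) x - L x))\<^sup>2) \<le> (e / 2)\<^sup>2"
      using tail[OF half_gt_zero[OF \<open>0 < e\<close>]] by blast
    have "dist (X n) (Ell2 L) < e" if "n \<ge> M" for n
    proof -
      have "(norm (X n - Ell2 L))\<^sup>2 \<le> (e / 2)\<^sup>2"
        unfolding norm_ell2_sq minus_ell2.rep_eq Lfun
        by (rule sq_summable_bounded_sums(2)) (rule M[OF that])
      then have "norm (X n - Ell2 L) \<le> e / 2"
        by (rule power2_le_imp_le) (use \<open>0 < e\<close> in simp)
      then show ?thesis using \<open>0 < e\<close> by (simp add: dist_norm)
    qed
    then show "\<exists>no. \<forall>n\<ge>no. dist (X n) (Ell2 L) < e" by blast
  qed
  then show "convergent X" by (rule convergentI)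
qed

lemma norm_ell2_scaleC: "norm (ell2_scaleC c f) = cmod c * norm f"
proof -
  have "(norm (ell2_scaleC c f))\<^sup>2 = (cmod c * norm f)\<^sup>2"
    unfolding power_mult_distrib norm_ell2_sq ell2_scaleC.rep_eq norm_mult
    by (rule infsum_cmult_right')
  then show ?thesis
    by (rule power2_eq_imp_eq) simp_all
qed

text \<open>Bounded operators on \<^typ>\<open>'a ell2\<close> are elements of \<^typ>\<open>'a ell2 \<Rightarrow>\<^sub>L 'a ell2\<close>. These are a
  priori only real linear; all operators occurring below are complex linear, and complex linearity
  passes to norm limits. The operator norm is the same.\<close>

type_synonym 'a ell2_op = "'a ell2 \<Rightarrow>\<^sub>L 'a ell2"

definition op_scaleC :: "complex \<Rightarrow> 'a ell2_op \<Rightarrow> 'a ell2_op" where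
  "op_scaleC c T = Blinfun (ell2_scaleC c) o\<^sub>L T"

lemma bounded_linear_ell2_scaleC: "bounded_linear (ell2_scaleC c)"
  by (rule bounded_linear_intro[where K = "cmod c"])
     (auto intro!: ell2_eqI simp: ell2_scaleC.rep_eq algebra_simps norm_ell2_scaleC)

lemma op_scaleC_apply: "op_scaleC c T f = ell2_scaleC c (T f)"
  unfolding op_scaleC_def by (simp add: bounded_linear_Blinfun_apply bounded_linear_ell2_scaleC)


section \<open>Closed ideals in algebras of operators\<close>

definition closed_ideal :: "'a ell2_op set \<Rightarrow> 'a ell2_op set \<Rightarrow> bool" where
  "closed_ideal A J \<longleftrightarrow>
     J \<subseteq> A \<and> closed J \<and> 0 \<in> J \<and>
     (\<forall>S\<in>J. \<forall>T\<in>J. S + T \<in> J) \<and>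
     (\<forall>c. \<forall>T\<in>J. op_scaleC c T \<in> J) \<and>
     (\<forall>S\<in>A. \<forall>T\<in>J. S o\<^sub>L T \<in> J \<and> T o\<^sub>L S \<in> J)"

definition nontrivial_ideal :: "'a ell2_op set \<Rightarrow> 'a ell2_op set \<Rightarrow> bool" where
  "nontrivial_ideal A J \<longleftrightarrow> closed_ideal A J \<and> J \<noteq> {0} \<and> J \<noteq> A"

definition simple_algebra :: "'a ell2_op set \<Rightarrow> bool" where
  "simple_algebra A \<longleftrightarrow> (\<nexists>J. nontrivial_ideal A J)"


section \<open>Semi-etale groupoids\<close>

text \<open>All elements of the type are arrows; \<open>gmul a b\<close> is meaningful only for composable
  pairs, that is, if \<open>gsrc a = grng b\<close>.\<close>

record 'g groupoid =
  gunits :: "'g set"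
  gsrc :: "'g \<Rightarrow> 'g"
  grng :: "'g \<Rightarrow> 'g"
  gmul :: "'g \<Rightarrow> 'g \<Rightarrow> 'g"
  ginv :: "'g \<Rightarrow> 'g"

locale groupoid =
  fixes G :: "'g groupoid"
  assumes src_unit: "gsrc G a \<in> gunits G"
    and rng_unit: "grng G a \<in> gunits G"
    and unit_src: "x \<in> gunits G \<Longrightarrow> gsrc G x = x"
    and unit_rng: "x \<in> gunits G \<Longrightarrow> grng G x = x"
    and src_mul: "gsrc G a = grng G b \<Longrightarrow> gsrc G (gmul G a b) = gsrc G b"
    and rng_mul: "gsrc G a = grng G b \<Longrightarrow> grng G (gmul G a b) = grng G a"
    and mul_assoc: "gsrc G a = grng G b \<Longrightarrow> gsrc G b = grng G c \<Longrightarrow>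
          gmul G (gmul G a b) c = gmul G a (gmul G b c)"
    and rng_mul_left: "gmul G (grng G a) a = a"
    and mul_src_right: "gmul G a (gsrc G a) = a"
    and src_inv: "gsrc G (ginv G a) = grng G a"
    and rng_inv: "grng G (ginv G a) = gsrc G a"
    and mul_inv_right: "gmul G a (ginv G a) = grng G a"
    and mul_inv_left: "gmul G (ginv G a) a = gsrc G a"

locale locally_compact_groupoid = groupoid G for G :: "('g :: t2_space) groupoid" +
  assumes continuous_mul:
      "continuous_on {(a, b). gsrc G a = grng G b} (\<lambda>(a, b). gmul G a b)"
    and continuous_inv: "continuous_on UNIV (ginv G)"
    and locally_compact: "locally compact (UNIV :: 'g set)"

definition bisection :: "('g :: topological_space) groupoid \<Rightarrow> 'g set \<Rightarrow> bool" where
  "bisection G U \<longleftrightarrow> open U \<and> inj_on (grng G) U \<and> inj_on (gsrc G) U"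

locale semi_etale_groupoid = locally_compact_groupoid G for G :: "('g :: t2_space) groupoid" +
  assumes bisection_basis: "\<exists>\<B>. topological_basis \<B> \<and> (\<forall>U\<in>\<B>. bisection G U)"

definition isotropy :: "'g groupoid \<Rightarrow> 'g \<Rightarrow> 'g set" where
  "isotropy G x = {a. grng G a = x \<and> gsrc G a = x}"


section \<open>Convolution algebras\<close>

definition factorizations :: "'g groupoid \<Rightarrow> 'g \<Rightarrow> ('g \<times> 'g) set" where
  "factorizations G c = {(a, b). gsrc G a = grng G b \<and> gmul G a b = c}"

text \<open>For \<open>f \<in> Bc G\<close> (and for \<open>f \<in> B0 G\<close>) only finitely many terms are non-zero.\<close>

definition conv :: "'g groupoid \<Rightarrow> ('g \<Rightarrow> complex) \<Rightarrow> ('g \<Rightarrow> complex) \<Rightarrow> 'g \<Rightarrow> complex" where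
  "conv G f g c = (\<Sum>\<^sub>\<infinity>(a, b)\<in>factorizations G c. f a * g b)"

definition invol :: "'g groupoid \<Rightarrow> ('g \<Rightarrow> complex) \<Rightarrow> 'g \<Rightarrow> complex" where
  "invol G f a = cnj (f (ginv G a))"

definition supp :: "('g :: topological_space \<Rightarrow> complex) \<Rightarrow> 'g set" where
  "supp f = closure {a. f a \<noteq> 0}"

definition Bc :: "('g :: topological_space) groupoid \<Rightarrow> ('g \<Rightarrow> complex) set" where
  "Bc G = {f. bounded (range f) \<and> compact (supp f)}"

definition Cc :: "('g :: topological_space) groupoid \<Rightarrow> ('g \<Rightarrow> complex) set" where
  "Cc G = {f \<in> Bc G. continuous_on UNIV f}"

inductive_set alg_star :: "('g :: topological_space) groupoid \<Rightarrow> ('g \<Rightarrow> complex) set"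
  for G :: "'g groupoid" where
  base: "f \<in> Cc G \<Longrightarrow> f \<in> alg_star G"
| add: "f \<in> alg_star G \<Longrightarrow> g \<in> alg_star G \<Longrightarrow> (\<lambda>a. f a + g a) \<in> alg_star G"
| scale: "f \<in> alg_star G \<Longrightarrow> (\<lambda>a. c * f a) \<in> alg_star G"
| conv: "f \<in> alg_star G \<Longrightarrow> g \<in> alg_star G \<Longrightarrow> conv G f g \<in> alg_star G"
| invol: "f \<in> alg_star G \<Longrightarrow> invol G f \<in> alg_star G"

text \<open>Bounded functions on the unit space vanishing at infinity, extended by zero.\<close>

definition B0 :: "('g :: topological_space) groupoid \<Rightarrow> ('g \<Rightarrow> complex) set" where
  "B0 G = {h. bounded (range h) \<and> (\<forall>a. a \<notin> gunits G \<longrightarrow> h a = 0) \<and>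
     (\<forall>e>0. \<exists>K. compact K \<and> K \<subseteq> gunits G \<and> (\<forall>x\<in>gunits G - K. cmod (h x) < e))}"

definition N0 :: "('g :: topological_space) groupoid \<Rightarrow> ('g \<Rightarrow> complex) set" where
  "N0 G = {n \<in> alg_star G. \<exists>U. bisection G U \<and> supp n \<subseteq> U}"


section \<open>The reduced C*-algebra\<close>

text \<open>The space \<open>l\<^sup>2(s\<^sup>-\<^sup>1(x))\<close> is identified with the subspace of those \<open>\<psi>\<close> in \<^typ>\<open>'g ell2\<close> that vanish
  off \<open>s\<^sup>-\<^sup>1(x)\<close>, and the operator \<open>\<pi>\<^sub>x(f)\<close> is extended by zero to the orthogonal complement. This does
  not change its norm.\<close>

definition pi_rep :: "'g groupoid \<Rightarrow> 'g \<Rightarrow> ('g \<Rightarrow> complex) \<Rightarrow> 'g ell2_op" where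
  "pi_rep G x f = Blinfun (\<lambda>\<psi>. Ell2 (\<lambda>c. if gsrc G c = x then conv G f (ell2_fun \<psi>) c else 0))"

definition reduced_norm :: "'g groupoid \<Rightarrow> ('g \<Rightarrow> complex) \<Rightarrow> real" where
  "reduced_norm G f = (SUP x\<in>gunits G. norm (pi_rep G x f))"

text \<open>Since \<^typ>\<open>'g\<close> is the disjoint union of the sets \<open>s\<^sup>-\<^sup>1(x)\<close>, \<^typ>\<open>'g ell2\<close> is the orthogonal sum of the
  spaces \<open>l\<^sup>2(s\<^sup>-\<^sup>1(x))\<close>. The following is the direct sum of the representations \<open>\<pi>\<^sub>x\<close>; it is
  an isometry from \<^term>\<open>Bc G\<close> with the reduced norm into the Banach space \<^typ>\<open>'g ell2_op\<close>
  (\<open>reg_eq_pi_rep\<close> and \<open>norm_reg\<close> below) and an injective *-homomorphism (\<open>reg_conv\<close>, \<open>reg_invol\<close>,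
  \<open>reg_inj\<close>). Therefore the closure of its range is the completion of \<^term>\<open>Bc G\<close> in the reduced
  norm.\<close>

definition reg :: "'g groupoid \<Rightarrow> ('g \<Rightarrow> complex) \<Rightarrow> 'g ell2_op" where
  "reg G f = Blinfun (\<lambda>\<psi>. Ell2 (conv G f (ell2_fun \<psi>)))"

definition Bstar_red :: "('g :: topological_space) groupoid \<Rightarrow> 'g ell2_op set" where
  "Bstar_red G = closure (reg G ` Bc G)"

definition Cstar_red :: "('g :: topological_space) groupoid \<Rightarrow> 'g ell2_op set" where
  "Cstar_red G = closure (reg G ` alg_star G)"

text \<open>The formula for the regular representation also makes sense on \<^term>\<open>B0 G\<close>, where it gives the
  isometric extension of the embedding of the compactly supported functions on the unit space
  (\<open>norm_reg_B0\<close> and \<open>reg_B0_eq\<close> below).\<close>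

definition D_alg :: "('g :: topological_space) groupoid \<Rightarrow> 'g ell2_op set" where
  "D_alg G = Cstar_red G \<inter> reg G ` B0 G"

definition G_invariant :: "('g :: topological_space) groupoid \<Rightarrow> 'g ell2_op set \<Rightarrow> bool" where
  "G_invariant G J \<longleftrightarrow> (\<forall>n\<in>N0 G. \<forall>T\<in>J. reg G (invol G n) o\<^sub>L T o\<^sub>L reg G n \<in> J)"


section \<open>Properties of the regular representation\<close>

text \<open>In particular, the operators \<^term>\<open>pi_rep G x f\<close> and \<^term>\<open>reg G f\<close> are well defined and bounded
  for \<open>f \<in> Bc G\<close> (\<open>conv_bounded_Bc\<close>, \<open>pi_rep_apply_Bc\<close>, \<open>reg_apply_Bc\<close>), and
  \<^term>\<open>Bstar_red G\<close> is a completion of \<open>Bc G\<close>.\<close>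

context groupoid
begin

lemma mul_inv_cancel: "grng G a = grng G c \<Longrightarrow> gmul G a (gmul G (ginv G a) c) = c"
  by (metis mul_assoc mul_inv_right rng_inv rng_mul_left src_inv)

lemma inv_mul_cancel: "gsrc G a = grng G c \<Longrightarrow> gmul G (ginv G a) (gmul G a c) = c"
  by (metis mul_assoc mul_inv_left rng_mul_left src_inv)

lemma inv_inv [simp]: "ginv G (ginv G a) = a"
  by (metis inv_mul_cancel mul_inv_left mul_src_right rng_inv src_inv)

lemma inv_mul_mul:
  assumes "gsrc G a = grng G d" "grng G a = grng G c"
  shows "gmul G (ginv G (gmul G a d)) c = gmul G (ginv G d) (gmul G (ginv G a) c)"
proof -
  let ?e = "gmul G (ginv G d) (gmul G (ginv G a) c)"
  have 1: "grng G (gmul G (ginv G a) c) = gsrc G a"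
    using assms by (simp add: rng_mul src_inv rng_inv)
  have 2: "grng G ?e = gsrc G d"
    using assms 1 by (simp add: rng_mul src_inv rng_inv)
  have "gmul G (gmul G a d) ?e = gmul G a (gmul G d ?e)"
    using assms 2 by (intro mul_assoc) auto
  also have "\<dots> = c"
    using assms 1 by (simp add: mul_inv_cancel)
  finally have "c = gmul G (gmul G a d) ?e" ..
  then show ?thesis
    using inv_mul_cancel[of "gmul G a d" ?e] 2 assms by (simp add: src_mul)
qed

lemma factorizations_eq:
  "factorizations G c = (\<lambda>a. (a, gmul G (ginv G a) c)) ` {a. grng G a = grng G c}"
proof -
  have "(a, b) \<in> (\<lambda>a. (a, gmul G (ginv G a) c)) ` {a. grng G a = grng G c}"
    if "gsrc G a = grng G b" "gmul G a b = c" for a b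
    using that inv_mul_cancel[of a b] rng_mul[of a b] by (auto intro!: image_eqI)
  moreover have "gsrc G a = grng G (gmul G (ginv G a) c) \<and> gmul G a (gmul G (ginv G a) c) = c"
    if "grng G a = grng G c" for a
    using that by (simp add: mul_inv_cancel rng_mul src_inv rng_inv)
  ultimately show ?thesis
    unfolding factorizations_def by blast
qed

lemma conv_alt:
  "conv G f g c = (\<Sum>\<^sub>\<infinity>a\<in>{a. grng G a = grng G c}. f a * g (gmul G (ginv G a) c))"
proof -
  have "inj_on (\<lambda>a. (a, gmul G (ginv G a) c)) {a. grng G a = grng G c}"
    by (rule inj_onI) simp
  then show ?thesis
    unfolding conv_def factorizations_eq by (subst infsum_reindex) (auto simp: o_def)
qed

text \<open>Functions for which the convolution product is a finite sum.\<close>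

definition fin_fibres :: "('g \<Rightarrow> complex) \<Rightarrow> bool" where
  "fin_fibres f \<longleftrightarrow> (\<forall>y. finite {a. f a \<noteq> 0 \<and> grng G a = y})"

lemma conv_sum:
  assumes "finite A" "{a. f a \<noteq> 0 \<and> grng G a = grng G c} \<subseteq> A" "A \<subseteq> {a. grng G a = grng G c}"
  shows "conv G f g c = (\<Sum>a\<in>A. f a * g (gmul G (ginv G a) c))"
proof -
  have "conv G f g c = (\<Sum>\<^sub>\<infinity>a\<in>A. f a * g (gmul G (ginv G a) c))"
    unfolding conv_alt using assms by (intro infsum_cong_neutral) auto
  then show ?thesis
    using assms(1) by simp
qed

lemma conv_sum':
  assumes "fin_fibres f"
  shows "conv G f g c = (\<Sum>a\<in>{a. f a \<noteq> 0 \<and> grng G a = grng G c}. f a * g (gmul G (ginv G a) c))"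
  using assms by (intro conv_sum) (auto simp: fin_fibres_def)

lemma conv_single:
  assumes "inj_on (grng G) U" "\<And>a. a \<notin> U \<Longrightarrow> f a = 0" "a \<in> U" "grng G a = grng G c"
  shows "conv G f g c = f a * g (gmul G (ginv G a) c)"
proof -
  have "b = a" if "f b \<noteq> 0" "grng G b = grng G c" for b
  proof (rule inj_onD[OF assms(1)])
    show "grng G b = grng G a" using that(2) assms(4) by simp
    show "b \<in> U" using assms(2) that(1) by blast
  qed (rule assms(3))
  then have "{b. f b \<noteq> 0 \<and> grng G b = grng G c} \<subseteq> {a}"
    by blast
  then show ?thesis
    using conv_sum[of "{a}" f c g] assms(4) by simp
qed

lemma conv_none:
  assumes "\<And>a. a \<notin> U \<Longrightarrow> f a = 0" "\<And>a. a \<in> U \<Longrightarrow> grng G a \<noteq> grng G c"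
  shows "conv G f g c = 0"
proof -
  have "{b. f b \<noteq> 0 \<and> grng G b = grng G c} \<subseteq> {}"
    using assms by auto
  then show ?thesis
    using conv_sum[of "{}" f c g] by simp
qed

lemma fin_fibres_add:
  assumes "fin_fibres f" "fin_fibres g"
  shows "fin_fibres (\<lambda>a. f a + g a)"
proof -
  have "finite ({a. f a \<noteq> 0 \<and> grng G a = y} \<union> {a. g a \<noteq> 0 \<and> grng G a = y})" for y
    using assms unfolding fin_fibres_def by blast
  moreover have "{a. f a + g a \<noteq> 0 \<and> grng G a = y}
      \<subseteq> {a. f a \<noteq> 0 \<and> grng G a = y} \<union> {a. g a \<noteq> 0 \<and> grng G a = y}" for y
    by auto
  ultimately show ?thesis
    unfolding fin_fibres_def using finite_subset by blast
qed

lemma fin_fibres_subset: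
  assumes "fin_fibres f" "\<And>a. g a \<noteq> 0 \<Longrightarrow> f a \<noteq> 0"
  shows "fin_fibres g"
proof -
  have "{a. g a \<noteq> 0 \<and> grng G a = y} \<subseteq> {a. f a \<noteq> 0 \<and> grng G a = y}" for y
    using assms(2) by auto
  then show ?thesis
    using assms(1) unfolding fin_fibres_def using finite_subset by blast
qed

lemma conv_add_left:
  assumes "fin_fibres f" "fin_fibres g"
  shows "conv G (\<lambda>a. f a + g a) h c = conv G f h c + conv G g h c"
proof -
  let ?A = "{a. f a \<noteq> 0 \<and> grng G a = grng G c} \<union> {a. g a \<noteq> 0 \<and> grng G a = grng G c}"
  have fin: "finite ?A"
    using assms unfolding fin_fibres_def by auto
  show ?thesis
    by (subst (1 2 3) conv_sum[OF fin]) (auto simp: sum.distrib algebra_simps)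
qed

lemma conv_scale_left:
  assumes "fin_fibres f"
  shows "conv G (\<lambda>a. k * f a) h c = k * conv G f h c"
proof -
  let ?A = "{a. f a \<noteq> 0 \<and> grng G a = grng G c}"
  have fin: "finite ?A"
    using assms unfolding fin_fibres_def by auto
  show ?thesis
    by (subst (1 2) conv_sum[OF fin]) (auto simp: sum_distrib_left algebra_simps)
qed

lemma conv_zero_left: "conv G (\<lambda>a. 0) h c = 0"
  unfolding conv_alt by simp

lemma conv_add_right:
  "fin_fibres f \<Longrightarrow> conv G f (\<lambda>a. g a + h a) c = conv G f g c + conv G f h c"
  by (simp add: conv_sum' sum.distrib algebra_simps)

lemma conv_scale_right:
  "fin_fibres f \<Longrightarrow> conv G f (\<lambda>a. k * g a) c = k * conv G f g c"
  by (simp add: conv_sum' sum_distrib_left algebra_simps)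

text \<open>Functions acting on the square summable functions by a convolution operator of norm at
  most \<open>C\<close>.\<close>

definition conv_bounded :: "('g \<Rightarrow> complex) \<Rightarrow> real \<Rightarrow> bool" where
  "conv_bounded f C \<longleftrightarrow> fin_fibres f \<and> 0 \<le> C \<and>
     (\<forall>\<psi> F. finite F \<longrightarrow> (\<Sum>c\<in>F. (cmod (conv G f (ell2_fun \<psi>) c))\<^sup>2) \<le> (C * norm \<psi>)\<^sup>2)"

lemma conv_bounded_summable:
  assumes "conv_bounded f C"
  shows "(\<lambda>c. (cmod (conv G f (ell2_fun \<psi>) c))\<^sup>2) summable_on UNIV"
    and "(\<Sum>\<^sub>\<infinity>c. (cmod (conv G f (ell2_fun \<psi>) c))\<^sup>2) \<le> (C * norm \<psi>)\<^sup>2"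
proof -
  have "(\<Sum>c\<in>F. (cmod (conv G f (ell2_fun \<psi>) c))\<^sup>2) \<le> (C * norm \<psi>)\<^sup>2" if "finite F" for F
    using assms that unfolding conv_bounded_def by blast
  note le = this
  show "(\<lambda>c. (cmod (conv G f (ell2_fun \<psi>) c))\<^sup>2) summable_on UNIV"
    using le by (rule sq_summable_bounded_sums(1))
  show "(\<Sum>\<^sub>\<infinity>c. (cmod (conv G f (ell2_fun \<psi>) c))\<^sup>2) \<le> (C * norm \<psi>)\<^sup>2"
    using le by (rule sq_summable_bounded_sums(2))
qed

lemma reg_aux:
  assumes "conv_bounded f C"
  shows "bounded_linear (\<lambda>\<psi>. Ell2 (\<lambda>c. if c \<in> S then conv G f (ell2_fun \<psi>) c else 0))" (is "bounded_linear ?T")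
    and "ell2_fun (Ell2 (\<lambda>c. if c \<in> S then conv G f (ell2_fun \<psi>) c else 0))
      = (\<lambda>c. if c \<in> S then conv G f (ell2_fun \<psi>) c else 0)"
    and "norm (Blinfun (\<lambda>\<psi>. Ell2 (\<lambda>c. if c \<in> S then conv G f (ell2_fun \<psi>) c else 0))) \<le> C"
proof -
  have fin: "fin_fibres f" and C: "0 \<le> C"
    using assms unfolding conv_bounded_def by auto
  have bd: "(\<Sum>c\<in>F. (cmod (if c \<in> S then conv G f (ell2_fun \<psi>) c else 0))\<^sup>2) \<le> (C * norm \<psi>)\<^sup>2"
    if "finite F" for F \<psi>
  proof -
    have "(\<Sum>c\<in>F. (cmod (if c \<in> S then conv G f (ell2_fun \<psi>) c else 0))\<^sup>2)
        \<le> (\<Sum>c\<in>F. (cmod (conv G f (ell2_fun \<psi>) c))\<^sup>2)"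
      by (intro sum_mono) auto
    also have "\<dots> \<le> (C * norm \<psi>)\<^sup>2"
      using assms that unfolding conv_bounded_def by blast
    finally show ?thesis .
  qed
  have ev: "ell2_fun (?T \<psi>) = (\<lambda>c. if c \<in> S then conv G f (ell2_fun \<psi>) c else 0)" for \<psi>
    by (intro Ell2_inverse CollectI) (rule sq_summable_bounded_sums(1)[OF bd])
  show "ell2_fun (?T \<psi>) = (\<lambda>c. if c \<in> S then conv G f (ell2_fun \<psi>) c else 0)"
    by (rule ev)
  have nrm: "norm (?T \<psi>) \<le> norm \<psi> * C" for \<psi>
  proof -
    have "(norm (?T \<psi>))\<^sup>2 \<le> (C * norm \<psi>)\<^sup>2"
      unfolding norm_ell2_sq ev by (rule sq_summable_bounded_sums(2)[OF bd])
    then have "norm (?T \<psi>) \<le> C * norm \<psi>"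
      by (rule power2_le_imp_le) (simp add: C)
    then show ?thesis
      by (simp add: mult.commute)
  qed
  show lin: "bounded_linear ?T"
  proof (rule bounded_linear_intro[OF _ _ nrm])
    show "?T (\<phi> + \<psi>) = ?T \<phi> + ?T \<psi>" for \<phi> \<psi>
      by (rule ell2_eqI)
        (simp add: ev ev[of "\<phi> + \<psi>", unfolded plus_ell2.rep_eq], simp add: conv_add_right[OF fin])
    show "?T (k *\<^sub>R \<psi>) = k *\<^sub>R ?T \<psi>" for k \<psi>
      by (rule ell2_eqI)
        (simp add: ev ev[of "k *\<^sub>R \<psi>", unfolded scaleR_ell2.rep_eq], simp add: conv_scale_right[OF fin])
  qed
  show "norm (Blinfun ?T) \<le> C"
    using nrm C by (intro norm_blinfun_bound) (simp_all add: bounded_linear_Blinfun_apply[OF lin] mult.commute)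
qed

lemma reg_apply:
  assumes "conv_bounded f C"
  shows "ell2_fun (reg G f \<psi>) = conv G f (ell2_fun \<psi>)"
  using reg_aux(1,2)[OF assms, of UNIV] by (simp add: reg_def bounded_linear_Blinfun_apply)

lemma norm_reg_le:
  assumes "conv_bounded f C"
  shows "norm (reg G f) \<le> C"
  using reg_aux(3)[OF assms, of UNIV] by (simp add: reg_def)

lemma pi_rep_apply:
  assumes "conv_bounded f C"
  shows "ell2_fun (pi_rep G x f \<psi>) = (\<lambda>c. if gsrc G c = x then conv G f (ell2_fun \<psi>) c else 0)"
  using reg_aux(1,2)[OF assms, of "{c. gsrc G c = x}"]
  by (simp add: pi_rep_def bounded_linear_Blinfun_apply)

lemma reg_eq_pi_rep':
  assumes "conv_bounded f C"
  shows "ell2_fun (reg G f \<psi>) c = ell2_fun (pi_rep G (gsrc G c) f \<psi>) c"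
  using assms by (simp add: reg_apply pi_rep_apply)

lemma norm_pi_rep_le:
  assumes "conv_bounded f C"
  shows "norm (pi_rep G x f) \<le> norm (reg G f)"
proof (rule norm_blinfun_bound)
  fix \<psi>
  have "(norm (pi_rep G x f \<psi>))\<^sup>2 \<le> (norm (reg G f \<psi>))\<^sup>2"
    unfolding norm_ell2_sq
    by (intro infsum_mono ell2_summable) (auto simp: reg_apply[OF assms] pi_rep_apply[OF assms])
  then have "norm (pi_rep G x f \<psi>) \<le> norm (reg G f \<psi>)"
    by (rule power2_le_imp_le) simp
  also have "\<dots> \<le> norm (reg G f) * norm \<psi>"
    by (rule norm_blinfun)
  finally show "norm (pi_rep G x f \<psi>) \<le> norm (reg G f) * norm \<psi>" .
qed simp

lemma pi_rep_restrict:
  assumes "conv_bounded f C" "ell2_fun \<phi> = (\<lambda>c. if gsrc G c = x then ell2_fun \<psi> c else 0)"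
  shows "pi_rep G x f \<phi> = pi_rep G x f \<psi>"
proof (rule ell2_eqI)
  fix c
  have "conv G f (ell2_fun \<phi>) c = conv G f (ell2_fun \<psi>) c" if "gsrc G c = x"
    unfolding conv_alt using that by (intro infsum_cong) (auto simp: assms(2) src_mul src_inv)
  then show "ell2_fun (pi_rep G x f \<phi>) c = ell2_fun (pi_rep G x f \<psi>) c"
    by (simp add: pi_rep_apply[OF assms(1)])
qed

lemma norm_reg':
  assumes f: "conv_bounded f C"
  shows "norm (reg G f) = reduced_norm G f"
proof (rule antisym)
  let ?S = "reduced_norm G f"
  have bdd: "bdd_above ((\<lambda>x. norm (pi_rep G x f)) ` gunits G)"
    using norm_pi_rep_le[OF f] by (intro bdd_aboveI2) auto
  have le: "norm (pi_rep G x f) \<le> ?S" if "x \<in> gunits G" for x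
    unfolding reduced_norm_def by (rule cSUP_upper[OF that bdd])
  have S0: "0 \<le> ?S"
    using le[OF src_unit] norm_ge_zero by (rule order_trans[rotated])
  show "?S \<le> norm (reg G f)"
    unfolding reduced_norm_def using src_unit by (intro cSUP_least norm_pi_rep_le[OF f]) auto
  show "norm (reg G f) \<le> ?S"
  proof (rule norm_blinfun_bound[OF S0])
    fix \<psi> :: "'g ell2"
    let ?r = "\<lambda>x. Ell2 (\<lambda>c. if gsrc G c = x then ell2_fun \<psi> c else 0)"
    have r: "ell2_fun (?r x) = (\<lambda>c. if gsrc G c = x then ell2_fun \<psi> c else 0)" for x
    proof (intro Ell2_inverse CollectI)
      show "(\<lambda>c. (cmod (if gsrc G c = x then ell2_fun \<psi> c else 0))\<^sup>2) summable_on UNIV"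
        by (rule summable_on_comparison_test[OF ell2_summable[of \<psi>]]) auto
    qed
    have nr: "(norm (?r x))\<^sup>2 = (\<Sum>\<^sub>\<infinity>c\<in>{c. gsrc G c = x}. (cmod (ell2_fun \<psi> c))\<^sup>2)" for x
      unfolding norm_ell2_sq r by (intro infsum_cong_neutral) auto
    have "(\<Sum>c\<in>F. (cmod (ell2_fun (reg G f \<psi>) c))\<^sup>2) \<le> (?S * norm \<psi>)\<^sup>2" if F: "finite F" for F
    proof -
      have "(\<Sum>c\<in>F. (cmod (ell2_fun (reg G f \<psi>) c))\<^sup>2)
          = (\<Sum>x\<in>gsrc G ` F. \<Sum>c\<in>{c \<in> F. gsrc G c = x}. (cmod (ell2_fun (reg G f \<psi>) c))\<^sup>2)"
        by (rule sum.image_gen[OF F])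
      also have "\<dots> \<le> (\<Sum>x\<in>gsrc G ` F. (?S * norm (?r x))\<^sup>2)"
      proof (rule sum_mono)
        fix x assume "x \<in> gsrc G ` F"
        then have x: "x \<in> gunits G" using src_unit by auto
        have "(\<Sum>c\<in>{c \<in> F. gsrc G c = x}. (cmod (ell2_fun (reg G f \<psi>) c))\<^sup>2)
            = (\<Sum>c\<in>{c \<in> F. gsrc G c = x}. (cmod (ell2_fun (pi_rep G x f (?r x)) c))\<^sup>2)"
          by (intro sum.cong) (auto simp: reg_eq_pi_rep'[OF f] pi_rep_restrict[OF f r])
        also have "\<dots> \<le> (norm (pi_rep G x f (?r x)))\<^sup>2"
          using F by (intro sum_le_norm_ell2) auto
        also have "\<dots> \<le> (?S * norm (?r x))\<^sup>2"
          by (intro power_mono order_trans[OF norm_blinfun] mult_right_mono le[OF x]) auto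
        finally show "(\<Sum>c\<in>{c \<in> F. gsrc G c = x}. (cmod (ell2_fun (reg G f \<psi>) c))\<^sup>2)
            \<le> (?S * norm (?r x))\<^sup>2" .
      qed
      also have "\<dots> = ?S\<^sup>2 * (\<Sum>x\<in>gsrc G ` F. \<Sum>\<^sub>\<infinity>c\<in>{c. gsrc G c = x}. (cmod (ell2_fun \<psi> c))\<^sup>2)"
        by (simp add: power_mult_distrib sum_distrib_left nr)
      also have "(\<Sum>x\<in>gsrc G ` F. \<Sum>\<^sub>\<infinity>c\<in>{c. gsrc G c = x}. (cmod (ell2_fun \<psi> c))\<^sup>2)
          = (\<Sum>\<^sub>\<infinity>c\<in>(\<Union>x\<in>gsrc G ` F. {c. gsrc G c = x}). (cmod (ell2_fun \<psi> c))\<^sup>2)"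
        using F by (intro sum_infsum ell2_summable) auto
      also have "\<dots> \<le> (norm \<psi>)\<^sup>2"
        unfolding norm_ell2_sq by (intro infsum_mono_neutral ell2_summable) auto
      finally show ?thesis
        by (simp add: power_mult_distrib mult_left_mono)
    qed
    then have "(norm (reg G f \<psi>))\<^sup>2 \<le> (?S * norm \<psi>)\<^sup>2"
      unfolding norm_ell2_sq by (rule sq_summable_bounded_sums(2))
    then show "norm (reg G f \<psi>) \<le> ?S * norm \<psi>"
      by (rule power2_le_imp_le) (simp add: S0)
  qed
qed

lemma conv_bounded_zero: "conv_bounded (\<lambda>_. 0) 0"
  unfolding conv_bounded_def fin_fibres_def by (simp add: conv_zero_left)

lemma conv_bounded_add:
  assumes "conv_bounded f C" "conv_bounded g D"
  shows "conv_bounded (\<lambda>a. f a + g a) (C + D)"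
  unfolding conv_bounded_def
proof (intro conjI allI impI)
  have fin: "fin_fibres f" "fin_fibres g" and "0 \<le> C" "0 \<le> D"
    using assms unfolding conv_bounded_def by auto
  then show "fin_fibres (\<lambda>a. f a + g a)" "0 \<le> C + D"
    by (auto intro: fin_fibres_add)
  fix \<psi> and F :: "'g set"
  assume F: "finite F"
  have *: "conv G (\<lambda>a. f a + g a) (ell2_fun \<psi>) c = ell2_fun (reg G f \<psi> + reg G g \<psi>) c" for c
    by (simp add: reg_apply[OF assms(1)] reg_apply[OF assms(2)] conv_add_left fin)
  have "norm (reg G f \<psi> + reg G g \<psi>) \<le> norm (reg G f) * norm \<psi> + norm (reg G g) * norm \<psi>"
    by (intro norm_triangle_le add_mono norm_blinfun)
  also have "\<dots> \<le> C * norm \<psi> + D * norm \<psi>"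
    by (intro add_mono mult_right_mono norm_reg_le assms) auto
  also have "\<dots> = (C + D) * norm \<psi>"
    by (simp add: algebra_simps)
  finally have "(norm (reg G f \<psi> + reg G g \<psi>))\<^sup>2 \<le> ((C + D) * norm \<psi>)\<^sup>2"
    by (rule power_mono) simp
  moreover have "(\<Sum>c\<in>F. (cmod (conv G (\<lambda>a. f a + g a) (ell2_fun \<psi>) c))\<^sup>2)
      \<le> (norm (reg G f \<psi> + reg G g \<psi>))\<^sup>2"
    unfolding * by (rule sum_le_norm_ell2[OF F])
  ultimately show "(\<Sum>c\<in>F. (cmod (conv G (\<lambda>a. f a + g a) (ell2_fun \<psi>) c))\<^sup>2) \<le> ((C + D) * norm \<psi>)\<^sup>2"
    by linarith
qed

lemma reg_add:
  assumes "conv_bounded f C" "conv_bounded g D"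
  shows "reg G (\<lambda>a. f a + g a) = reg G f + reg G g"
  using assms conv_bounded_def[of f C] conv_bounded_def[of g D]
  by (intro blinfun_eqI ell2_eqI)
     (simp add: blinfun.add_left reg_apply[OF conv_bounded_add[OF assms]] reg_apply[OF assms(1)]
       reg_apply[OF assms(2)] conv_add_left)

lemma conv_bounded_bisection:
  assumes rng: "inj_on (grng G) U" and src: "inj_on (gsrc G) U" and U: "\<And>a. a \<notin> U \<Longrightarrow> f a = 0"
    and M: "\<And>a. cmod (f a) \<le> M"
  shows "conv_bounded f M"
  unfolding conv_bounded_def
proof (intro conjI allI impI)
  show "0 \<le> M" by (rule order_trans[OF norm_ge_zero M])
  show "fin_fibres f"
    unfolding fin_fibres_def
  proof
    fix y
    have "a = b" if "f a \<noteq> 0 \<and> grng G a = y" "f b \<noteq> 0 \<and> grng G b = y" for a b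
    proof (rule inj_onD[OF rng])
      show "grng G a = grng G b" using that by simp
      show "a \<in> U" "b \<in> U" using that U by blast+
    qed
    then have "{a. f a \<noteq> 0 \<and> grng G a = y} \<subseteq> {SOME a. f a \<noteq> 0 \<and> grng G a = y}"
      by (auto intro: someI2)
    then show "finite {a. f a \<noteq> 0 \<and> grng G a = y}"
      by (rule finite_subset) simp
  qed
  fix \<psi> :: "'g ell2" and F :: "'g set"
  assume F: "finite F"
  define F' where "F' = {c \<in> F. \<exists>a\<in>U. grng G a = grng G c}"
  have "\<exists>p. \<forall>c\<in>F'. p c \<in> U \<and> grng G (p c) = grng G c"
    unfolding F'_def by (intro bchoice) auto
  then obtain p where p: "\<And>c. c \<in> F' \<Longrightarrow> p c \<in> U" "\<And>c. c \<in> F' \<Longrightarrow> grng G (p c) = grng G c"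
    by blast
  let ?q = "\<lambda>c. gmul G (ginv G (p c)) c"
  have inj: "inj_on ?q F'"
  proof (rule inj_onI)
    fix c d assume c: "c \<in> F'" and d: "d \<in> F'" and eq: "?q c = ?q d"
    have "grng G (?q c) = gsrc G (p c)" "grng G (?q d) = gsrc G (p d)"
      using p c d by (simp_all add: rng_mul src_inv rng_inv)
    then have "gsrc G (p c) = gsrc G (p d)"
      using eq by simp
    then have "p c = p d"
      by (rule inj_onD[OF src]) (use p c d in auto)
    then have "gmul G (p c) (?q c) = gmul G (p d) (?q d)"
      using eq by simp
    then show "c = d"
      using p(2) c d by (simp add: mul_inv_cancel)
  qed
  have "(\<Sum>c\<in>F. (cmod (conv G f (ell2_fun \<psi>) c))\<^sup>2) = (\<Sum>c\<in>F'. (cmod (conv G f (ell2_fun \<psi>) c))\<^sup>2)"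
  proof (rule sum.mono_neutral_right[OF F])
    show "\<forall>c\<in>F - F'. (cmod (conv G f (ell2_fun \<psi>) c))\<^sup>2 = 0"
    proof
      fix c assume "c \<in> F - F'"
      then have "conv G f (ell2_fun \<psi>) c = 0"
        by (intro conv_none[OF U]) (auto simp: F'_def)
      then show "(cmod (conv G f (ell2_fun \<psi>) c))\<^sup>2 = 0" by simp
    qed
  qed (auto simp: F'_def)
  also have "\<dots> \<le> (\<Sum>c\<in>F'. M\<^sup>2 * (cmod (ell2_fun \<psi> (?q c)))\<^sup>2)"
  proof (rule sum_mono)
    fix c assume c: "c \<in> F'"
    have "conv G f (ell2_fun \<psi>) c = f (p c) * ell2_fun \<psi> (?q c)"
      by (rule conv_single[OF rng U p[OF c]])
    then show "(cmod (conv G f (ell2_fun \<psi>) c))\<^sup>2 \<le> M\<^sup>2 * (cmod (ell2_fun \<psi> (?q c)))\<^sup>2"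
      using M[of "p c"] by (simp add: norm_mult power_mult_distrib mult_right_mono power_mono)
  qed
  also have "\<dots> = M\<^sup>2 * (\<Sum>d\<in>?q ` F'. (cmod (ell2_fun \<psi> d))\<^sup>2)"
    by (simp add: sum.reindex[OF inj] sum_distrib_left)
  also have "\<dots> \<le> M\<^sup>2 * (norm \<psi>)\<^sup>2"
    using F by (intro mult_left_mono sum_le_norm_ell2) (auto simp: F'_def)
  finally show "(\<Sum>c\<in>F. (cmod (conv G f (ell2_fun \<psi>) c))\<^sup>2) \<le> (M * norm \<psi>)\<^sup>2"
    by (simp add: power_mult_distrib)
qed

end

context groupoid
begin

text \<open>Convolution with functions on the unit space.\<close>

lemma conv_unit:
  assumes "\<And>a. a \<notin> gunits G \<Longrightarrow> h a = 0"
  shows "conv G h g c = h (grng G c) * g c"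
proof -
  have inj: "inj_on (grng G) (gunits G)"
    by (rule inj_onI) (simp add: unit_rng)
  have "conv G h g c = h (grng G c) * g (gmul G (ginv G (grng G c)) c)"
    by (rule conv_single[OF inj assms rng_unit unit_rng[OF rng_unit]])
  moreover have "gmul G (ginv G (grng G c)) c = c"
    using inv_mul_cancel[of "grng G c" c] by (simp add: unit_src rng_unit rng_mul_left)
  ultimately show ?thesis by simp
qed

lemma conv_bounded_unit:
  assumes "\<And>a. a \<notin> gunits G \<Longrightarrow> h a = 0" "\<And>a. cmod (h a) \<le> M"
  shows "conv_bounded h M"
proof (rule conv_bounded_bisection[of "gunits G"])
  show "inj_on (grng G) (gunits G)" "inj_on (gsrc G) (gunits G)"
    by (simp_all add: inj_on_def unit_rng unit_src)
qed (use assms in auto)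

definition delta :: "'g \<Rightarrow> 'g ell2" where
  "delta x = Ell2 (\<lambda>c. if c = x then 1 else 0)"

lemma delta_apply: "ell2_fun (delta x) c = (if c = x then 1 else 0)"
proof -
  have "(\<lambda>c. (cmod (if c = x then 1 else 0))\<^sup>2) summable_on UNIV"
    by (rule finite_nonzero_values_imp_summable_on) (auto intro: finite_subset[of _ "{x}"])
  then show ?thesis
    unfolding delta_def by (simp add: Ell2_inverse)
qed

lemma norm_delta: "norm (delta x) = 1"
proof -
  have "(\<Sum>\<^sub>\<infinity>c. (cmod (ell2_fun (delta x) c))\<^sup>2) = (\<Sum>\<^sub>\<infinity>c\<in>{x}. 1)"
    by (intro infsum_cong_neutral) (auto simp: delta_apply)
  then show ?thesis
    by (simp add: norm_ell2_def)
qed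

lemma unit_value_le_norm_reg:
  assumes "\<And>a. a \<notin> gunits G \<Longrightarrow> h a = 0" "\<And>a. cmod (h a) \<le> M"
  shows "cmod (h x) \<le> norm (reg G h)"
proof (cases "x \<in> gunits G")
  case True
  have "ell2_fun (reg G h (delta x)) x = h x"
    using True by (simp add: reg_apply[OF conv_bounded_unit[OF assms]] conv_unit[OF assms(1)]
        delta_apply unit_rng)
  then have "cmod (h x) \<le> norm (reg G h (delta x))"
    using cmod_le_norm_ell2[of "reg G h (delta x)" x] by simp
  also have "\<dots> \<le> norm (reg G h)"
    using norm_blinfun[of "reg G h" "delta x"] by (simp add: norm_delta)
  finally show ?thesis .
qed (simp add: assms)

end


context semi_etale_groupoid
begin

lemma bisection_at: "\<exists>U. bisection G U \<and> a \<in> U"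
proof -
  obtain \<B> where "topological_basis \<B>" "\<And>U. U \<in> \<B> \<Longrightarrow> bisection G U"
    using bisection_basis by blast
  then show ?thesis
    using topological_basisE[of \<B> UNIV a] by (metis UNIV_I open_UNIV)
qed

lemma in_Bc:
  assumes "\<And>a. cmod (f a) \<le> M" "compact K" "\<And>a. a \<notin> K \<Longrightarrow> f a = 0"
  shows "f \<in> Bc G"
proof -
  have "supp f \<subseteq> K"
    unfolding supp_def using assms(2,3) by (intro closure_minimal compact_imp_closed) auto
  then have "compact (supp f)"
    unfolding supp_def using assms(2) compact_Int_closed[of K "closure {a. f a \<noteq> 0}"]
    by (simp add: Int_absorb1)
  then show ?thesis
    using assms(1) unfolding Bc_def by (auto intro: boundedI)
qed

lemma Bc_bound: "f \<in> Bc G \<Longrightarrow> \<exists>M. \<forall>a. cmod (f a) \<le> M"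
  unfolding Bc_def by (auto simp: bounded_iff)

lemma Bc_compact: "f \<in> Bc G \<Longrightarrow> compact (supp f)"
  by (simp add: Bc_def)

lemma supp_zero: "a \<notin> supp f \<Longrightarrow> f a = 0"
  unfolding supp_def using closure_subset[of "{a. f a \<noteq> 0}"] by blast

lemma Bc_mult:
  assumes "f \<in> Bc G" "\<And>a. cmod (u a) \<le> 1"
  shows "(\<lambda>a. u a * f a) \<in> Bc G"
proof -
  obtain M where M: "\<And>a. cmod (f a) \<le> M"
    using Bc_bound[OF assms(1)] by blast
  have "cmod (u a * f a) \<le> 1 * M" for a
    unfolding norm_mult by (intro mult_mono assms M) auto
  then show ?thesis
    by (rule in_Bc[OF _ Bc_compact[OF assms(1)]]) (simp add: supp_zero)
qed

lemma Bc_add: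
  assumes "f \<in> Bc G" "g \<in> Bc G"
  shows "(\<lambda>a. f a + g a) \<in> Bc G"
proof -
  obtain M where M: "\<And>a. cmod (f a) \<le> M"
    using Bc_bound[OF assms(1)] by blast
  obtain N where N: "\<And>a. cmod (g a) \<le> N"
    using Bc_bound[OF assms(2)] by blast
  have "cmod (f a + g a) \<le> M + N" for a
    by (intro norm_triangle_le add_mono M N)
  then show ?thesis
    by (rule in_Bc[OF _ compact_Un[OF Bc_compact[OF assms(1)] Bc_compact[OF assms(2)]]])
       (simp add: supp_zero)
qed

lemma Bc_scale:
  assumes "f \<in> Bc G"
  shows "(\<lambda>a. k * f a) \<in> Bc G"
proof -
  obtain M where M: "\<And>a. cmod (f a) \<le> M"
    using Bc_bound[OF assms] by blast
  have "cmod (k * f a) \<le> cmod k * M" for a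
    unfolding norm_mult by (intro mult_left_mono M) auto
  then show ?thesis
    by (rule in_Bc[OF _ Bc_compact[OF assms]]) (simp add: supp_zero)
qed

lemma Bc_induct [consumes 1, case_names zero add]:
  assumes f: "f \<in> Bc G"
    and zero: "P (\<lambda>_. 0)"
    and add: "\<And>f g U. f \<in> Bc G \<Longrightarrow> bisection G U \<Longrightarrow> (\<And>a. a \<notin> U \<Longrightarrow> f a = 0) \<Longrightarrow>
      g \<in> Bc G \<Longrightarrow> P g \<Longrightarrow> P (\<lambda>a. f a + g a)"
  shows "P f"
proof -
  have cover: "P f" if "finite \<U>" "\<And>U. U \<in> \<U> \<Longrightarrow> bisection G U" "f \<in> Bc G"
    "\<And>a. a \<notin> \<Union>\<U> \<Longrightarrow> f a = 0" for \<U> f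
    using that
  proof (induction \<U> arbitrary: f rule: finite_induct)
    case empty
    then have "f = (\<lambda>_. 0)" by auto
    then show ?case using zero by simp
  next
    case (insert U \<U>)
    let ?f = "\<lambda>a. (if a \<in> U then 1 else 0) * f a" and ?g = "\<lambda>a. (if a \<in> U then 0 else 1) * f a"
    have f: "?f \<in> Bc G" and g: "?g \<in> Bc G"
      by (rule Bc_mult[OF insert.prems(2)]; simp)+
    have "P ?g"
      using insert.prems by (intro insert.IH[OF _ g]) auto
    then have "P (\<lambda>a. ?f a + ?g a)"
      using insert.prems(1) by (intro add[OF f _ _ g, of U]) auto
    moreover have "(\<lambda>a. ?f a + ?g a) = f" by auto
    ultimately show ?case by simp
  qed
  have "supp f \<subseteq> \<Union>{U. bisection G U}"
    using bisection_at by auto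
  moreover have "\<And>U. U \<in> {U. bisection G U} \<Longrightarrow> open U"
    by (simp add: bisection_def)
  ultimately obtain \<U> where \<U>: "\<U> \<subseteq> {U. bisection G U}" "finite \<U>" "supp f \<subseteq> \<Union>\<U>"
    using compactE[OF Bc_compact[OF f]] by metis
  have "f a = 0" if "a \<notin> \<Union>\<U>" for a
    using that \<U>(3) by (intro supp_zero) auto
  then show ?thesis
    using \<U>(1) by (intro cover[OF \<U>(2) _ f]) auto
qed

lemma conv_bounded_Bc_bisection:
  assumes "f \<in> Bc G" "bisection G U" "\<And>a. a \<notin> U \<Longrightarrow> f a = 0"
  shows "\<exists>C. conv_bounded f C"
proof -
  obtain M where M: "\<And>a. cmod (f a) \<le> M"
    using Bc_bound[OF assms(1)] by blast
  have "inj_on (grng G) U" "inj_on (gsrc G) U"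
    using assms(2) by (simp_all add: bisection_def)
  from conv_bounded_bisection[OF this assms(3) M] show ?thesis ..
qed

lemma conv_bounded_Bc: "f \<in> Bc G \<Longrightarrow> \<exists>C. conv_bounded f C"
proof (induction rule: Bc_induct)
  case zero
  then show ?case using conv_bounded_zero by blast
next
  case (add f g U)
  then show ?case using conv_bounded_Bc_bisection conv_bounded_add by blast
qed

lemma fin_fibres_Bc: "f \<in> Bc G \<Longrightarrow> fin_fibres f"
  using conv_bounded_Bc conv_bounded_def by blast

lemma reg_apply_Bc: "f \<in> Bc G \<Longrightarrow> ell2_fun (reg G f \<psi>) = conv G f (ell2_fun \<psi>)"
  using conv_bounded_Bc reg_apply by blast

lemma pi_rep_apply_Bc: "f \<in> Bc G \<Longrightarrow>
    ell2_fun (pi_rep G x f \<psi>) = (\<lambda>c. if gsrc G c = x then conv G f (ell2_fun \<psi>) c else 0)"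
  using conv_bounded_Bc pi_rep_apply by blast

lemma reg_eq_pi_rep:
  "f \<in> Bc G \<Longrightarrow> ell2_fun (reg G f \<psi>) c = ell2_fun (pi_rep G (gsrc G c) f \<psi>) c"
  using conv_bounded_Bc reg_eq_pi_rep' by blast

theorem norm_reg: "f \<in> Bc G \<Longrightarrow> norm (reg G f) = reduced_norm G f"
  using conv_bounded_Bc norm_reg' by blast

lemma reg_add_Bc: "f \<in> Bc G \<Longrightarrow> g \<in> Bc G \<Longrightarrow> reg G (\<lambda>a. f a + g a) = reg G f + reg G g"
  using conv_bounded_Bc reg_add by metis

lemma reg_scale_Bc:
  assumes "f \<in> Bc G"
  shows "reg G (\<lambda>a. k * f a) = op_scaleC k (reg G f)"
  by (intro blinfun_eqI ell2_eqI)
     (simp add: op_scaleC_apply ell2_scaleC.rep_eq reg_apply_Bc Bc_scale assms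
       conv_scale_left[OF fin_fibres_Bc[OF assms]])

lemma continuous_rng: "continuous_on UNIV (grng G)"
  and continuous_src: "continuous_on UNIV (gsrc G)"
proof -
  have "continuous_on UNIV (\<lambda>a. (\<lambda>(a, b). gmul G a b) (a, ginv G a))"
    by (rule continuous_on_compose2[OF continuous_mul])
       (auto intro!: continuous_on_Pair continuous_on_id continuous_inv simp: rng_inv)
  then show "continuous_on UNIV (grng G)"
    by (simp add: mul_inv_right)
  have "continuous_on UNIV (\<lambda>a. (\<lambda>(a, b). gmul G a b) (ginv G a, a))"
    by (rule continuous_on_compose2[OF continuous_mul])
       (auto intro!: continuous_on_Pair continuous_on_id continuous_inv simp: src_inv)
  then show "continuous_on UNIV (gsrc G)"
    by (simp add: mul_inv_left)
qed

lemma closed_units: "closed (gunits G)"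
proof -
  have "gunits G = {a. gsrc G a = a}"
    by (auto simp: unit_src) (metis src_unit)
  also have "closed \<dots>"
    using closed_Collect_eq[OF continuous_src continuous_on_id] by simp
  finally show ?thesis .
qed

lemma conv_Bc:
  assumes f: "f \<in> Bc G" and g: "g \<in> Bc G"
  shows "conv G f g \<in> Bc G"
proof -
  obtain N where N: "\<And>a. cmod (g a) \<le> N"
    using Bc_bound[OF g] by blast
  have N0: "0 \<le> N"
    by (rule order_trans[OF norm_ge_zero N])
  have "\<exists>B. \<forall>c. cmod (conv G f g c) \<le> B"
    using f
  proof (induction rule: Bc_induct)
    case zero
    show ?case by (rule exI[of _ 0]) (simp add: conv_zero_left)
  next
    case (add f h U)
    obtain M where M: "\<And>a. cmod (f a) \<le> M"
      using Bc_bound[OF add.hyps(1)] by blast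
    then have M0: "0 \<le> M"
      by (rule order_trans[OF norm_ge_zero])
    obtain B where B: "\<And>c. cmod (conv G h g c) \<le> B"
      using add.IH by blast
    have inj: "inj_on (grng G) U"
      using add.hyps(2) by (simp add: bisection_def)
    have le: "cmod (conv G f g c) \<le> M * N" for c
    proof (cases "\<exists>a\<in>U. grng G a = grng G c")
      case True
      then obtain a where a: "a \<in> U" "grng G a = grng G c" by blast
      have "conv G f g c = f a * g (gmul G (ginv G a) c)"
        by (rule conv_single[OF inj add.hyps(3) a])
      then show ?thesis
        by (simp add: norm_mult mult_mono M N M0)
    next
      case False
      then have "conv G f g c = 0"
        by (intro conv_none[OF add.hyps(3)]) auto
      then show ?thesis using M0 N0 by simp
    qed
    have "cmod (conv G (\<lambda>a. f a + h a) g c) \<le> M * N + B" for c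
      unfolding conv_add_left[OF fin_fibres_Bc[OF add.hyps(1)] fin_fibres_Bc[OF add.hyps(4)]]
      by (intro norm_triangle_le add_mono le B)
    then show ?case by blast
  qed
  then obtain B where B: "\<And>c. cmod (conv G f g c) \<le> B" by blast
  let ?S = "(supp f \<times> supp g) \<inter> {(a, b). gsrc G a = grng G b}"
  have "closed {p. gsrc G (fst p) = grng G (snd p)}"
    by (intro closed_Collect_eq
        continuous_on_compose2[OF continuous_src continuous_on_fst[OF continuous_on_id]]
        continuous_on_compose2[OF continuous_rng continuous_on_snd[OF continuous_on_id]] subset_UNIV)
  then have "closed {(a, b). gsrc G a = grng G b}"
    by (simp add: case_prod_beta')
  then have "compact ?S"
    by (intro compact_Int_closed compact_Times Bc_compact f g)
  then have "compact ((\<lambda>(a, b). gmul G a b) ` ?S)"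
    by (intro compact_continuous_image continuous_on_subset[OF continuous_mul]) auto
  moreover have "conv G f g c = 0" if "c \<notin> (\<lambda>(a, b). gmul G a b) ` ?S" for c
  proof -
    have "f a * g b = 0" if "(a, b) \<in> factorizations G c" for a b
    proof (rule ccontr)
      assume "f a * g b \<noteq> 0"
      then have "a \<in> supp f" "b \<in> supp g"
        using supp_zero[of a f] supp_zero[of b g] by auto
      then have "(a, b) \<in> ?S" "c = (\<lambda>(a, b). gmul G a b) (a, b)"
        using that by (auto simp: factorizations_def)
      with \<open>c \<notin> _\<close> show False by blast
    qed
    then show ?thesis
      unfolding conv_def by (intro infsum_0) auto
  qed
  ultimately show ?thesis
    by (rule in_Bc[OF B])
qed

lemma conv_assoc:
  assumes f: "f \<in> Bc G" and g: "g \<in> Bc G"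
  shows "conv G (conv G f g) h c = conv G f (conv G g h) c"
  using f
proof (induction rule: Bc_induct)
  case zero
  have "conv G (\<lambda>_. 0) g = (\<lambda>_. 0)" by (auto simp: conv_zero_left)
  then show ?case by (simp add: conv_zero_left)
next
  case (add f k U)
  have ff: "fin_fibres f" "fin_fibres k" "fin_fibres (conv G f g)" "fin_fibres (conv G k g)"
    using add.hyps g by (auto intro: fin_fibres_Bc conv_Bc)
  have inj: "inj_on (grng G) U"
    using add.hyps(2) by (simp add: bisection_def)
  have "conv G (conv G f g) h c = conv G f (conv G g h) c"
  proof (cases "\<exists>a\<in>U. grng G a = grng G c")
    case True
    then obtain a where a: "a \<in> U" "grng G a = grng G c" by blast
    have "conv G (conv G f g) h c
        = (\<Sum>\<^sub>\<infinity>b\<in>{b. grng G b = grng G c}. f a * (g (gmul G (ginv G a) b) * h (gmul G (ginv G b) c)))"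
      unfolding conv_alt[of "conv G f g"]
      using conv_single[OF inj add.hyps(3) a(1)] a(2) by (intro infsum_cong) (simp add: mult.assoc)
    also have "\<dots> = f a * (\<Sum>\<^sub>\<infinity>b\<in>{b. grng G b = grng G c}.
        g (gmul G (ginv G a) b) * h (gmul G (ginv G b) c))"
      by (rule infsum_cmult_right')
    also have "(\<Sum>\<^sub>\<infinity>b\<in>{b. grng G b = grng G c}. g (gmul G (ginv G a) b) * h (gmul G (ginv G b) c))
        = (\<Sum>\<^sub>\<infinity>d\<in>{d. grng G d = gsrc G a}. g d * h (gmul G (ginv G d) (gmul G (ginv G a) c)))"
      by (rule infsum_reindex_bij_witness[of _ "gmul G a" "gmul G (ginv G a)"])
         (use a in \<open>auto simp: mul_inv_cancel inv_mul_cancel rng_mul rng_inv src_inv inv_mul_mul[symmetric]\<close>)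
    also have "\<dots> = conv G g h (gmul G (ginv G a) c)"
      unfolding conv_alt[of g] using a by (simp add: rng_mul rng_inv src_inv)
    also have "f a * \<dots> = conv G f (conv G g h) c"
      by (rule conv_single[OF inj add.hyps(3) a, symmetric])
    finally show ?thesis .
  next
    case False
    then have 0: "conv G f u d = 0" if "grng G d = grng G c" for u d
      using that by (intro conv_none[OF add.hyps(3)]) auto
    have "conv G (conv G f g) h c = 0"
      unfolding conv_alt[of "conv G f g"] by (intro infsum_0) (simp add: 0)
    then show ?thesis
      by (simp add: 0)
  qed
  moreover have "conv G (\<lambda>a. f a + k a) g = (\<lambda>a. conv G f g a + conv G k g a)"
    by (rule ext) (rule conv_add_left[OF ff(1,2)])
  ultimately show ?case
    using add.IH by (simp add: conv_add_left ff)
qed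

theorem reg_conv:
  assumes "f \<in> Bc G" "g \<in> Bc G"
  shows "reg G (conv G f g) = reg G f o\<^sub>L reg G g"
  by (intro blinfun_eqI ell2_eqI) (simp add: reg_apply_Bc conv_Bc assms conv_assoc)

lemma invol_Bc:
  assumes "f \<in> Bc G"
  shows "invol G f \<in> Bc G"
proof -
  obtain M where M: "\<And>a. cmod (f a) \<le> M"
    using Bc_bound[OF assms] by blast
  have "compact (ginv G ` supp f)"
    by (intro compact_continuous_image continuous_on_subset[OF continuous_inv] Bc_compact assms subset_UNIV)
  moreover have "invol G f a = 0" if "a \<notin> ginv G ` supp f" for a
    using that supp_zero[of "ginv G a" f] unfolding invol_def by (metis complex_cnj_zero image_eqI inv_inv)
  ultimately show ?thesis
    by (intro in_Bc[of _ M]) (auto simp: invol_def M)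
qed

theorem reg_invol:
  assumes "f \<in> Bc G"
  shows "inner (reg G f \<phi>) \<psi> = inner \<phi> (reg G (invol G f) \<psi>)"
  using assms
proof (induction rule: Bc_induct)
  case zero
  have "reg G (\<lambda>_. 0) = 0"
    using norm_reg_le[OF conv_bounded_zero] by simp
  moreover have "invol G (\<lambda>_. 0) = (\<lambda>_. 0)"
    by (simp add: invol_def fun_eq_iff)
  ultimately show ?case by simp
next
  case (add f k U)
  have bis: "inj_on (grng G) U" "inj_on (gsrc G) U"
    using add.hyps(2) by (simp_all add: bisection_def)
  let ?f = "invol G f" and ?V = "ginv G ` U"
  have V: "a \<notin> ?V \<Longrightarrow> ?f a = 0" for a
    using add.hyps(3) unfolding invol_def by (metis complex_cnj_zero image_eqI inv_inv)
  have injV: "inj_on (grng G) ?V"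
    using bis(2) by (auto simp: inj_on_def rng_inv)
  let ?A = "{c. \<exists>a\<in>U. grng G a = grng G c}" and ?B = "{c. \<exists>a\<in>U. gsrc G a = grng G c}"
  have "\<exists>p. \<forall>c\<in>?A. p c \<in> U \<and> grng G (p c) = grng G c"
    by (intro bchoice) auto
  then obtain p where p: "\<And>c. c \<in> ?A \<Longrightarrow> p c \<in> U" "\<And>c. c \<in> ?A \<Longrightarrow> grng G (p c) = grng G c"
    by blast
  have "\<exists>q. \<forall>c\<in>?B. q c \<in> U \<and> gsrc G (q c) = grng G c"
    by (intro bchoice) auto
  then obtain q where q: "\<And>c. c \<in> ?B \<Longrightarrow> q c \<in> U" "\<And>c. c \<in> ?B \<Longrightarrow> gsrc G (q c) = grng G c"
    by blast
  have "inner (reg G f \<phi>) \<psi>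
      = (\<Sum>\<^sub>\<infinity>c\<in>?A. Re (f (p c) * ell2_fun \<phi> (gmul G (ginv G (p c)) c) * cnj (ell2_fun \<psi> c)))"
    unfolding inner_ell2_def reg_apply_Bc[OF add.hyps(1)]
  proof (rule infsum_cong_neutral)
    show "Re (conv G f (ell2_fun \<phi>) c * cnj (ell2_fun \<psi> c)) = 0" if "c \<in> UNIV - ?A" for c
    proof -
      have "conv G f (ell2_fun \<phi>) c = 0"
        using that by (intro conv_none[OF add.hyps(3)]) auto
      then show ?thesis by simp
    qed
    show "Re (conv G f (ell2_fun \<phi>) c * cnj (ell2_fun \<psi> c))
        = Re (f (p c) * ell2_fun \<phi> (gmul G (ginv G (p c)) c) * cnj (ell2_fun \<psi> c))"
      if "c \<in> UNIV \<inter> ?A" for c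
      using that conv_single[OF bis(1) add.hyps(3) p(1)[of c] p(2)[of c]] by simp
  qed auto
  also have "\<dots> = (\<Sum>\<^sub>\<infinity>d\<in>?B. Re (ell2_fun \<phi> d * cnj (?f (ginv G (q d)) * ell2_fun \<psi> (gmul G (q d) d))))"
  proof (rule infsum_reindex_bij_witness[of _ "\<lambda>d. gmul G (q d) d" "\<lambda>c. gmul G (ginv G (p c)) c"])
    fix c assume c: "c \<in> ?A"
    then have r: "grng G (gmul G (ginv G (p c)) c) = gsrc G (p c)"
      by (simp add: p(2) rng_mul src_inv rng_inv)
    then show B: "gmul G (ginv G (p c)) c \<in> ?B"
      using p(1)[OF c] by (auto intro!: bexI[of _ "p c"])
    have qp: "q (gmul G (ginv G (p c)) c) = p c"
      using q[OF B] r p(1)[OF c] bis(2) by (metis inj_onD)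
    then show "gmul G (q (gmul G (ginv G (p c)) c)) (gmul G (ginv G (p c)) c) = c"
      using p(2)[OF c] by (simp add: mul_inv_cancel)
    then show "Re (ell2_fun \<phi> (gmul G (ginv G (p c)) c) * cnj (?f (ginv G (q (gmul G (ginv G (p c)) c)))
          * ell2_fun \<psi> (gmul G (q (gmul G (ginv G (p c)) c)) (gmul G (ginv G (p c)) c))))
        = Re (f (p c) * ell2_fun \<phi> (gmul G (ginv G (p c)) c) * cnj (ell2_fun \<psi> c))"
      using qp by (simp add: invol_def mult_ac)
  next
    fix d assume d: "d \<in> ?B"
    then have r: "grng G (gmul G (q d) d) = grng G (q d)"
      by (simp add: q(2) rng_mul)
    then show A: "gmul G (q d) d \<in> ?A"
      using q(1)[OF d] by (auto intro!: bexI[of _ "q d"])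
    have "p (gmul G (q d) d) = q d"
      using p[OF A] r q(1)[OF d] bis(1) by (metis inj_onD)
    then show "gmul G (ginv G (p (gmul G (q d) d))) (gmul G (q d) d) = d"
      using q(2)[OF d] by (simp add: inv_mul_cancel)
  qed
  also have "\<dots> = inner \<phi> (reg G ?f \<psi>)"
    unfolding inner_ell2_def reg_apply_Bc[OF invol_Bc[OF add.hyps(1)]]
  proof (rule infsum_cong_neutral)
    show "Re (ell2_fun \<phi> d * cnj (conv G ?f (ell2_fun \<psi>) d)) = 0" if "d \<in> UNIV - ?B" for d
    proof -
      have "conv G ?f (ell2_fun \<psi>) d = 0"
        using that by (intro conv_none[OF V]) (auto simp: rng_inv)
      then show ?thesis by simp
    qed
    show "Re (ell2_fun \<phi> d * cnj (?f (ginv G (q d)) * ell2_fun \<psi> (gmul G (q d) d)))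
        = Re (ell2_fun \<phi> d * cnj (conv G ?f (ell2_fun \<psi>) d))" if "d \<in> ?B \<inter> UNIV" for d
    proof -
      have "ginv G (q d) \<in> ?V" "grng G (ginv G (q d)) = grng G d"
        using q[of d] that by (auto simp: rng_inv)
      from conv_single[OF injV V this] show ?thesis by simp
    qed
  qed auto
  finally have "inner (reg G f \<phi>) \<psi> = inner \<phi> (reg G ?f \<psi>)" .
  moreover have "invol G (\<lambda>a. f a + k a) = (\<lambda>a. ?f a + invol G k a)"
    by (simp add: invol_def fun_eq_iff)
  ultimately show ?case
    using add by (simp add: reg_add_Bc invol_Bc blinfun.add_left inner_add_left inner_add_right)
qed

lemma reg_inj:
  assumes f: "f \<in> Bc G" and "reg G f = 0"
  shows "f = (\<lambda>_. 0)"
proof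
  fix a
  have "conv G f (ell2_fun (delta (gsrc G a))) a = 0"
    using reg_apply_Bc[OF f, of "delta (gsrc G a)"] assms(2) by (metis blinfun.zero_left zero_ell2.rep_eq)
  moreover have "conv G f (ell2_fun (delta (gsrc G a))) a
      = (\<Sum>b\<in>insert a {b. f b \<noteq> 0 \<and> grng G b = grng G a}. f b * ell2_fun (delta (gsrc G a)) (gmul G (ginv G b) a))"
    using fin_fibres_Bc[OF f] by (intro conv_sum) (auto simp: fin_fibres_def)
  moreover have "\<dots> = (\<Sum>b\<in>{a}. f b * ell2_fun (delta (gsrc G a)) (gmul G (ginv G b) a))"
  proof (rule sum.mono_neutral_right)
    show "finite (insert a {b. f b \<noteq> 0 \<and> grng G b = grng G a})"
      using fin_fibres_Bc[OF f] by (simp add: fin_fibres_def)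
    have "b = a" if "grng G b = grng G a" "gmul G (ginv G b) a = gsrc G a" for b
      using that mul_inv_cancel[of b a] by (metis mul_src_right rng_inv rng_mul src_inv src_unit unit_rng)
    then show "\<forall>b\<in>insert a {b. f b \<noteq> 0 \<and> grng G b = grng G a} - {a}.
        f b * ell2_fun (delta (gsrc G a)) (gmul G (ginv G b) a) = 0"
      by (auto simp: delta_apply)
  qed auto
  ultimately show "f a = 0"
    by (simp add: delta_apply mul_inv_left)
qed

lemma alg_star_Bc: "f \<in> alg_star G \<Longrightarrow> f \<in> Bc G"
  by (induction rule: alg_star.induct) (auto simp: Cc_def Bc_add Bc_scale conv_Bc invol_Bc)

lemma Cstar_red_subset: "Cstar_red G \<subseteq> Bstar_red G"
  unfolding Cstar_red_def Bstar_red_def by (intro closure_mono) (auto dest: alg_star_Bc)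

lemma B0E:
  assumes "h \<in> B0 G"
  obtains M where "\<And>a. cmod (h a) \<le> M" "\<And>a. a \<notin> gunits G \<Longrightarrow> h a = 0"
  using assms by (auto simp: B0_def bounded_iff)

theorem norm_reg_B0:
  assumes h: "h \<in> B0 G"
  shows "norm (reg G h) = (SUP x\<in>gunits G. cmod (h x))"
proof (rule antisym)
  obtain M where M: "\<And>a. cmod (h a) \<le> M" "\<And>a. a \<notin> gunits G \<Longrightarrow> h a = 0"
    using B0E[OF h] by blast
  show "(SUP x\<in>gunits G. cmod (h x)) \<le> norm (reg G h)"
    using src_unit unit_value_le_norm_reg[OF M(2,1)] by (intro cSUP_least) auto
  have bdd: "bdd_above ((\<lambda>x. cmod (h x)) ` gunits G)"
    using M(1) by (intro bdd_aboveI2)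
  have "cmod (h a) \<le> (SUP x\<in>gunits G. cmod (h x))" for a
  proof (cases "a \<in> gunits G")
    case True
    then show ?thesis by (rule cSUP_upper[OF _ bdd])
  next
    case False
    have "0 \<le> cmod (h (gsrc G a))" by simp
    also have "\<dots> \<le> (SUP x\<in>gunits G. cmod (h x))"
      by (rule cSUP_upper[OF src_unit bdd])
    finally show ?thesis using False M(2) by simp
  qed
  then show "norm (reg G h) \<le> (SUP x\<in>gunits G. cmod (h x))"
    using M(2) by (intro norm_reg_le conv_bounded_unit)
qed

theorem reg_B0_eq: "reg G ` B0 G = closure (reg G ` {f \<in> Bc G. \<forall>a. a \<notin> gunits G \<longrightarrow> f a = 0})"
  (is "_ = closure (reg G ` ?Bu)")
proof (intro equalityI subsetI)
  fix T assume "T \<in> reg G ` B0 G"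
  then obtain h where h: "h \<in> B0 G" and T: "T = reg G h" by blast
  obtain M where M: "\<And>a. cmod (h a) \<le> M" "\<And>a. a \<notin> gunits G \<Longrightarrow> h a = 0"
    using B0E[OF h] by blast
  show "T \<in> closure (reg G ` ?Bu)"
    unfolding closure_approachable
  proof (intro allI impI)
    fix e :: real assume "0 < e"
    then have e2: "0 < e / 2" by simp
    then have "\<exists>K. compact K \<and> K \<subseteq> gunits G \<and> (\<forall>x\<in>gunits G - K. cmod (h x) < e / 2)"
      using h unfolding B0_def mem_Collect_eq by metis
    then obtain K where K: "compact K" "\<forall>x\<in>gunits G - K. cmod (h x) < e / 2"
      by blast
    let ?k = "\<lambda>a. if a \<in> K then h a else 0" and ?d = "\<lambda>a. if a \<in> K then 0 else h a"
    have M0: "0 \<le> M"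
      by (rule order_trans[OF norm_ge_zero M(1)])
    have kB: "?k \<in> Bc G"
      by (rule in_Bc[of _ M, OF _ K(1)]) (simp_all add: M(1) M0)
    then have k: "?k \<in> ?Bu"
      by (simp add: M(2))
    have d: "conv_bounded ?d (e / 2)"
    proof (rule conv_bounded_unit)
      show "cmod (?d a) \<le> e / 2" for a
        using K(2) M(2)[of a] e2 by (cases "a \<in> gunits G"; cases "a \<in> K") (auto intro: less_imp_le)
      show "?d a = 0" if "a \<notin> gunits G" for a
        using M(2)[OF that] by simp
    qed
    obtain C where C: "conv_bounded ?k C"
      using conv_bounded_Bc[OF kB] ..
    have "reg G (\<lambda>a. ?k a + ?d a) = reg G ?k + reg G ?d" "norm (reg G ?d) \<le> e / 2"
      by (rule reg_add[OF C d], rule norm_reg_le[OF d])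
    moreover have "(\<lambda>a. ?k a + ?d a) = h" by auto
    ultimately have "dist (reg G ?k) T < e"
      using e2 by (simp add: T dist_norm)
    then show "\<exists>S\<in>reg G ` ?Bu. dist S T < e"
      using k by blast
  qed
next
  fix T assume T: "T \<in> closure (reg G ` ?Bu)"
  define h where "h x = (if x \<in> gunits G then ell2_fun (T (delta x)) x else 0)" for x
  have approx: "cmod (f x - h x) \<le> norm (reg G f - T)" if f: "f \<in> ?Bu" for f x
  proof (cases "x \<in> gunits G")
    case True
    then have "f x = ell2_fun (reg G f (delta x)) x"
      using f by (simp add: reg_apply_Bc conv_unit delta_apply unit_rng)
    then have "f x - h x = ell2_fun ((reg G f - T) (delta x)) x"
      using True by (simp add: h_def blinfun.diff_left)
    then have "cmod (f x - h x) \<le> norm ((reg G f - T) (delta x))"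
      using cmod_le_norm_ell2[of "(reg G f - T) (delta x)" x] by simp
    also have "\<dots> \<le> norm (reg G f - T)"
      using norm_blinfun[of "reg G f - T" "delta x"] by (simp add: norm_delta)
    finally show ?thesis .
  qed (use f in \<open>simp add: h_def\<close>)
  have ex: "\<exists>f\<in>?Bu. norm (reg G f - T) < e" if "0 < e" for e
    using T that unfolding closure_approachable by (auto simp: dist_norm)
  have hbd: "\<exists>M. \<forall>a. cmod (h a) \<le> M"
  proof -
    obtain f where f: "f \<in> ?Bu" "norm (reg G f - T) < 1"
      using ex[of 1] by auto
    then obtain N where N: "\<And>a. cmod (f a) \<le> N"
      using Bc_bound[of f] by blast
    have "cmod (h a) \<le> N + 1" for a
      using approx[OF f(1), of a] f(2) N[of a] norm_triangle_ineq2[of "h a" "f a"]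
      by (simp add: norm_minus_commute)
    then show ?thesis by blast
  qed
  then obtain M where M: "\<And>a. cmod (h a) \<le> M" by blast
  have h0: "\<And>a. a \<notin> gunits G \<Longrightarrow> h a = 0"
    by (simp add: h_def)
  have "h \<in> B0 G"
    unfolding B0_def
  proof (intro CollectI conjI allI impI)
    show "bounded (range h)"
      using M by (auto intro: boundedI)
    show "h a = 0" if "a \<notin> gunits G" for a
      using that by (rule h0)
    fix e :: real assume "0 < e"
    then obtain f where f: "f \<in> ?Bu" "norm (reg G f - T) < e"
      using ex by blast
    have "supp f \<subseteq> gunits G"
      unfolding supp_def using f(1) by (intro closure_minimal closed_units) auto
    moreover have "cmod (h x) < e" if "x \<in> gunits G - supp f" for x
      using approx[OF f(1), of x] f(2) supp_zero[of x f] that by simp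
    ultimately show "\<exists>K. compact K \<and> K \<subseteq> gunits G \<and> (\<forall>x\<in>gunits G - K. cmod (h x) < e)"
      using Bc_compact[of f] f(1) by blast
  qed
  moreover have "reg G h = T"
  proof (rule ccontr)
    assume "reg G h \<noteq> T"
    then have e: "0 < norm (reg G h - T) / 2" by simp
    then obtain f where f: "f \<in> ?Bu" "norm (reg G f - T) < norm (reg G h - T) / 2"
      using ex by blast
    let ?d = "\<lambda>a. h a - f a"
    have d: "conv_bounded ?d (norm (reg G f - T))"
    proof (rule conv_bounded_unit)
      show "cmod (?d a) \<le> norm (reg G f - T)" for a
        using approx[OF f(1), of a] by (simp add: norm_minus_commute)
      show "?d a = 0" if "a \<notin> gunits G" for a
        using that f(1) by (simp add: h0)
    qed
    obtain C where C: "conv_bounded f C"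
      using conv_bounded_Bc[of f] f(1) by auto
    have "reg G (\<lambda>a. f a + ?d a) = reg G f + reg G ?d" "norm (reg G ?d) \<le> norm (reg G f - T)"
      by (rule reg_add[OF C d], rule norm_reg_le[OF d])
    then have "norm (reg G h - T) \<le> norm (reg G f - T) + norm (reg G f - T)"
      using norm_triangle_ineq[of "reg G f - T" "reg G ?d"] by (simp add: algebra_simps)
    with f(2) show False by simp
  qed
  ultimately show "T \<in> reg G ` B0 G" by blast
qed

end

end

theory Submission
  imports Defs
begin

text \<open>An operator \<open>T\<close> in \<open>C\<^sup>*\<^sub>r(G)\<close> has a diagonal \<open>x \<mapsto> \<langle>T \<delta>\<^sub>x, \<delta>\<^sub>x\<rangle>\<close> on the unit space, and it belongs to \<open>D\<^sub>G\<close>.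

  If \<open>J\<close> is a non-trivial invariant ideal of \<open>D\<^sub>G\<close>, the operators for which the diagonal of \<open>T\<^sup>* T\<close> lies in
  \<open>J\<close> form a non-trivial ideal of \<open>C\<^sup>*\<^sub>r(G)\<close>.

  Conversely, let \<open>J\<close> be a proper ideal of \<open>C\<^sup>*\<^sub>r(G)\<close>. Since \<open>D\<^sub>G\<close> contains an approximate unit, \<open>J \<inter> D\<^sub>G\<close> is
  a proper invariant ideal of \<open>D\<^sub>G\<close>, hence zero, and \<open>D\<^sub>G\<close> embeds isometrically into \<open>C\<^sup>*\<^sub>r(G)/J\<close>. If
  \<open>G\<^sub>x = {x}\<close> and \<open>h\<close> is supported near \<open>x\<close> with \<open>h(x) = 1\<close>, then \<open>h f h\<close> is supported in the unit space for
  \<open>f\<close> in \<open>alg\<^sup>*G\<close>; approximating \<open>T \<in> J\<close> by such \<open>f\<close> shows that the diagonal of \<open>T\<close> vanishes at \<open>x\<close>.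
  Therefore \<open>T\<close> vanishes on \<open>l\<^sup>2(s\<^sup>-\<^sup>1(x))\<close>, and the diagonal of \<open>T\<^sup>* T\<close> lies in the invariant ideal of the functions
  in \<open>D\<^sub>G\<close> vanishing on the orbit of \<open>x\<close>. This ideal is proper, hence zero, and so \<open>T = 0\<close>.\<close>

section \<open>Topology of the groupoid\<close>

context semi_etale_groupoid
begin

text \<open>Local compactness gives such a pair of sets at each point of \<open>K\<close>; finitely
  many of the open ones cover \<open>K\<close>.\<close>

lemma compact_open_nbhd:
  assumes "compact K" "open U" "K \<subseteq> U"
  shows "\<exists>W L. open W \<and> compact L \<and> K \<subseteq> W \<and> W \<subseteq> L \<and> L \<subseteq> (U :: 'g set)"
proof -
  have "\<exists>u v. open u \<and> compact v \<and> x \<in> u \<and> u \<subseteq> v \<and> v \<subseteq> U" if "x \<in> K" for x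
  proof -
    have "openin (top_of_set UNIV) U \<and> x \<in> U"
      using assms(2,3) that by auto
    then have "\<exists>u v. openin (top_of_set UNIV) u \<and> compact v \<and> x \<in> u \<and> u \<subseteq> v \<and> v \<subseteq> U"
      using locally_compact unfolding locally_def by blast
    then show ?thesis
      by simp
  qed
  then obtain u v where uv: "\<And>x. x \<in> K \<Longrightarrow> open (u x) \<and> compact (v x) \<and> x \<in> u x \<and> u x \<subseteq> v x \<and> v x \<subseteq> U"
    by metis
  then have "K \<subseteq> (\<Union>x\<in>K. u x)" by blast
  then obtain F where F: "F \<subseteq> K" "finite F" "K \<subseteq> (\<Union>x\<in>F. u x)"
    using compactE_image[OF assms(1), of K u] uv by metis
  have "compact (\<Union>x\<in>F. v x)"
    using F uv by (intro compact_UN) auto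
  moreover have "open (\<Union>x\<in>F. u x)"
    using F uv by auto
  ultimately show ?thesis
    using F(3) UN_mono[of F F u v] UN_least[of F v U] uv F(1) by (metis subset_iff)
qed

text \<open>The value 1 is taken on a whole open set \<open>V\<close> around \<open>K\<close>. Only
  then is the support of \<open>1 - h\<close> sure to miss \<open>K\<close>, as the partition
  argument in \<open>Cc_word_sums\<close> requires.\<close>

lemma locally_compact_Urysohn:
  assumes "compact K" "open U" "K \<subseteq> U"
  obtains h :: "'g \<Rightarrow> real" and V L where "continuous_on UNIV h" "\<And>a. 0 \<le> h a" "\<And>a. h a \<le> 1"
    "open V" "K \<subseteq> V" "\<And>a. a \<in> V \<Longrightarrow> h a = 1" "compact L" "L \<subseteq> U" "\<And>a. a \<notin> L \<Longrightarrow> h a = 0"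
proof -
  obtain W L where WL: "open W" "compact L" "K \<subseteq> W" "W \<subseteq> L" "L \<subseteq> U"
    using compact_open_nbhd[OF assms] by blast
  have "locally_compact_space (euclidean :: 'g topology)"
    unfolding locally_compact_space_def
  proof (clarsimp)
    fix x :: 'g
    show "\<exists>U. open U \<and> (\<exists>K. compact K \<and> x \<in> U \<and> U \<subseteq> K)"
      using compact_open_nbhd[of "{x}" UNIV] by auto
  qed
  moreover have "Hausdorff_space (euclidean :: 'g topology)"
    unfolding Hausdorff_space_def disjnt_def using hausdorff by (simp, metis)
  ultimately have reg: "completely_regular_space (euclidean :: 'g topology)"
    using completely_regular_eq_regular_space locally_compact_Hausdorff_imp_regular_space by blast
  have W: "closedin euclidean (- W)" and K: "compactin euclidean K" and dis: "disjnt K (- W)"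
    using WL assms(1) by (auto simp: disjnt_def)
  obtain f where f: "continuous_map euclidean (top_of_set {0..1::real}) f" "f ` (- W) \<subseteq> {0}" "f ` K \<subseteq> {1}"
    by (rule Urysohn_completely_regular_compact_closed[OF zero_le_one reg K W dis])
  have c: "continuous_on UNIV f" and r: "\<And>a. f a \<in> {0..1}"
    using f(1) by (auto simp: continuous_map_in_subtopology)
  show thesis
  \<comment> \<open>The Urysohn function \<open>f\<close> is only known to be 1 on \<open>K\<close>;
    capping \<open>2 * f\<close> at 1 creates a plateau on the open set where \<open>f\<close>
    exceeds 1/2.\<close>
  proof (rule that[of "\<lambda>a. min 1 (2 * f a)" "{a. f a > 1/2}" L])
    show "continuous_on UNIV (\<lambda>a. min 1 (2 * f a))"
      by (intro continuous_intros c)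
    show "open {a. f a > 1/2}"
      by (intro open_Collect_less continuous_intros c)
    show "min 1 (2 * f a) = 0" if "a \<notin> L" for a
      using f(2) that WL by (force simp: image_subset_iff)
  qed (use f r WL in \<open>auto simp: image_subset_iff\<close>)
qed

text \<open>If \<open>a\<close> and \<open>grng G a\<close> lie in the same bisection, they have the
  same range and therefore coincide.\<close>

lemma open_units: "open (gunits G)"
proof (subst open_subopen, intro ballI)
  fix x assume x: "x \<in> gunits G"
  obtain U where U: "bisection G U" "x \<in> U"
    using bisection_at by blast
  have "open (U \<inter> grng G -` U)"
    using U(1) continuous_rng by (intro open_Int open_vimage) (auto simp: bisection_def)
  moreover have "a \<in> gunits G" if "a \<in> U \<inter> grng G -` U" for a
  proof -
    have "grng G a = a"
      using that U(1) inj_onD[of "grng G" U "grng G a" a] by (auto simp: bisection_def unit_rng rng_unit)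
    then show ?thesis
      using rng_unit by metis
  qed
  ultimately show "\<exists>T. open T \<and> x \<in> T \<and> T \<subseteq> gunits G"
    using x U(2) by (intro exI[of _ "U \<inter> grng G -` U"]) (auto simp: unit_rng)
qed

lemma in_Cc:
  assumes "continuous_on UNIV f" "compact L" "\<And>a. a \<notin> L \<Longrightarrow> f a = 0"
  shows "f \<in> Cc G"
proof -
  have "compact (f ` L)"
    using assms by (intro compact_continuous_image) (auto intro: continuous_on_subset)
  then obtain M where "\<And>a. a \<in> L \<Longrightarrow> cmod (f a) \<le> M"
    by (meson bounded_iff compact_imp_bounded imageI)
  then have "cmod (f a) \<le> max M 0" for a
    using assms(3)[of a] by (cases "a \<in> L") (auto simp: le_max_iff_disj)
  then show ?thesis
    using in_Bc[of f "max M 0" L] assms by (simp add: Cc_def)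
qed

lemma bump:
  assumes "compact K" "open U" "K \<subseteq> U"
  obtains h V where "h \<in> Cc G" "\<And>a. cmod (h a) \<le> 1" "open V" "K \<subseteq> V" "\<And>a. a \<in> V \<Longrightarrow> h a = 1"
    "supp h \<subseteq> U"
proof -
  obtain h :: "'g \<Rightarrow> real" and V L where h: "continuous_on UNIV h" "\<And>a. 0 \<le> h a" "\<And>a. h a \<le> 1"
    "open V" "K \<subseteq> V" "\<And>a. a \<in> V \<Longrightarrow> h a = 1" "compact L" "L \<subseteq> U" "\<And>a. a \<notin> L \<Longrightarrow> h a = 0"
    by (rule locally_compact_Urysohn[OF assms]) blast
  show thesis
  proof
    show "(\<lambda>a. complex_of_real (h a)) \<in> Cc G"
      using h(1,7,9) by (intro in_Cc[of _ L] continuous_intros) auto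
    have "supp (\<lambda>a. complex_of_real (h a)) \<subseteq> L"
      unfolding supp_def using h(7,9) by (intro closure_minimal compact_imp_closed) auto
    then show "supp (\<lambda>a. complex_of_real (h a)) \<subseteq> U"
      using h(8) by blast
  qed (use h in auto)
qed

end

section \<open>Products of functions supported in bisections\<close>

context semi_etale_groupoid
begin

text \<open>If the second factor of a factorization of \<open>c\<close> is a unit, the first factor
  is \<open>c\<close> itself, so a single term of the sum survives.\<close>

lemma conv_unit_right:
  assumes "\<And>a. a \<notin> gunits G \<Longrightarrow> h a = 0"
  shows "conv G f h c = f c * h (gsrc G c)"
proof -
  have "f a * h (gmul G (ginv G a) c) = 0" if "grng G a = grng G c" "a \<noteq> c" for a
  proof -
    have "gmul G (ginv G a) c \<notin> gunits G"
    proof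
      assume u: "gmul G (ginv G a) c \<in> gunits G"
      have "grng G (gmul G (ginv G a) c) = gsrc G a"
        using that by (simp add: rng_mul src_inv rng_inv)
      then have "gmul G (ginv G a) c = gsrc G a"
        using unit_rng[OF u] by simp
      then have "gmul G a (gmul G (ginv G a) c) = a"
        by (simp add: mul_src_right)
      then show False
        using that by (simp add: mul_inv_cancel)
    qed
    then show ?thesis using assms by simp
  qed
  then have "conv G f h c = (\<Sum>\<^sub>\<infinity>a\<in>{c}. f a * h (gmul G (ginv G a) c))"
    unfolding conv_alt by (intro infsum_cong_neutral) auto
  then show ?thesis
    by (simp add: mul_inv_left)
qed

lemma inv_mul:
  assumes "gsrc G a = grng G b"
  shows "ginv G (gmul G a b) = gmul G (ginv G b) (ginv G a)"
proof -
  have "gmul G (ginv G (gmul G a b)) (grng G a) = gmul G (ginv G b) (gmul G (ginv G a) (grng G a))"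
    by (rule inv_mul_mul) (use assms in \<open>simp_all add: unit_rng rng_unit\<close>)
  then show ?thesis
    using assms mul_src_right[of "ginv G (gmul G a b)"] mul_src_right[of "ginv G a"]
    by (simp add: src_inv rng_mul)
qed

text \<open>Inverting and swapping the two factors maps the factorizations of
  \<open>ginv G c\<close> bijectively onto those of \<open>c\<close>.\<close>

lemma invol_conv: "invol G (conv G f g) = conv G (invol G g) (invol G f)"
proof
  fix c
  have "invol G (conv G f g) c = (\<Sum>\<^sub>\<infinity>(a, b)\<in>factorizations G (ginv G c). cnj (f a) * cnj (g b))"
    unfolding invol_def conv_def infsum_cnj[symmetric] by (simp add: case_prod_beta')
  also have "\<dots> = (\<Sum>\<^sub>\<infinity>(b, a)\<in>factorizations G c. invol G g b * invol G f a)"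
  proof (rule infsum_reindex_bij_witness[of _ "\<lambda>(b, a). (ginv G a, ginv G b)" "\<lambda>(a, b). (ginv G b, ginv G a)"])
    fix p assume "p \<in> factorizations G (ginv G c)"
    then show "(\<lambda>(a, b). (ginv G b, ginv G a)) p \<in> factorizations G c"
      using inv_mul[of "fst p" "snd p"] inv_inv[of c] by (auto simp: factorizations_def src_inv rng_inv)
  next
    fix p assume "p \<in> factorizations G c"
    then show "(\<lambda>(b, a). (ginv G a, ginv G b)) p \<in> factorizations G (ginv G c)"
      by (auto simp: factorizations_def src_inv rng_inv inv_mul)
  qed (auto simp: invol_def)
  finally show "invol G (conv G f g) c = conv G (invol G g) (invol G f) c"
    by (simp add: conv_def)
qed

lemma conv_zero_right: "conv G f (\<lambda>_. 0) = (\<lambda>_. 0)"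
  by (simp add: fun_eq_iff conv_alt)

text \<open>Products of continuous functions supported in bisections. In contrast to a product of such
  functions, a product of open bisections need not be open, so the supports of the elements
  of \<open>words\<close> are only controlled as in \<open>words_support\<close>.\<close>

inductive_set words :: "('g \<Rightarrow> complex) set" where
  base: "n \<in> Cc G \<Longrightarrow> bisection G U \<Longrightarrow> supp n \<subseteq> U \<Longrightarrow> n \<in> words"
| mult: "m \<in> words \<Longrightarrow> n \<in> words \<Longrightarrow> conv G m n \<in> words"

text \<open>The linear span of \<open>words\<close>; scalars are absorbed into a factor of a word by
  \<open>words_scale\<close>.\<close>

inductive_set word_sums :: "('g \<Rightarrow> complex) set" where
  zero: "(\<lambda>_. 0) \<in> word_sums"
| add: "n \<in> words \<Longrightarrow> f \<in> word_sums \<Longrightarrow> (\<lambda>a. n a + f a) \<in> word_sums"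

section \<open>The *-algebra spanned by the words\<close>

lemma words_alg_star: "n \<in> words \<Longrightarrow> n \<in> alg_star G"
  by (induction rule: words.induct) (auto intro: alg_star.intros)

lemma words_Bc: "n \<in> words \<Longrightarrow> n \<in> Bc G"
  by (intro alg_star_Bc words_alg_star)

lemma word_sums_Bc: "f \<in> word_sums \<Longrightarrow> f \<in> Bc G"
proof (induction rule: word_sums.induct)
  case zero
  show ?case by (rule in_Bc[of _ 0 "{}"]) auto
qed (auto intro: Bc_add words_Bc)

lemma words_scale: "n \<in> words \<Longrightarrow> (\<lambda>a. k * n a) \<in> words"
proof (induction rule: words.induct)
  case (base n U)
  have "supp (\<lambda>a. k * n a) \<subseteq> supp n"
    unfolding supp_def by (intro closure_mono) auto
  moreover have "(\<lambda>a. k * n a) \<in> Cc G"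
    using base(1) by (auto simp: Cc_def intro: Bc_scale continuous_intros)
  ultimately show ?case
    using base by (intro words.base[of _ U]) auto
next
  case (mult m n)
  have "(\<lambda>a. k * conv G m n a) = conv G (\<lambda>a. k * m a) n"
    using mult by (simp add: fun_eq_iff conv_scale_left fin_fibres_Bc words_Bc)
  then show ?case
    using mult by (simp add: words.mult)
qed

lemma bisection_inv:
  assumes "bisection G U"
  shows "bisection G (ginv G ` U)"
proof -
  have "ginv G ` U = ginv G -` U"
    by (auto simp: image_iff) (metis inv_inv)
  then have "open (ginv G ` U)"
    using assms continuous_inv by (simp add: bisection_def open_vimage)
  then show ?thesis
    using assms by (auto simp: bisection_def inj_on_def rng_inv src_inv)
qed

lemma words_invol: "n \<in> words \<Longrightarrow> invol G n \<in> words"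
proof (induction rule: words.induct)
  case (base n U)
  have "{a. invol G n a \<noteq> 0} \<subseteq> ginv G ` supp n"
    using supp_zero[of _ n] by (auto simp: invol_def image_iff) (metis inv_inv)
  moreover have "compact (ginv G ` supp n)"
    using base(1) continuous_inv
    by (intro compact_continuous_image) (auto simp: Cc_def Bc_def intro: continuous_on_subset)
  ultimately have "supp (invol G n) \<subseteq> ginv G ` supp n"
    unfolding supp_def[of "invol G n"] by (intro closure_minimal compact_imp_closed)
  moreover have "continuous_on UNIV (invol G n)"
    unfolding invol_def using base(1)
    by (intro continuous_intros continuous_on_compose2[OF _ continuous_inv]) (auto simp: Cc_def)
  ultimately show ?case
    using base by (intro words.base[OF _ bisection_inv[of U]]) (auto simp: Cc_def invol_Bc)
qed (auto simp: invol_conv intro: words.mult)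

lemma word_sums_add: "f \<in> word_sums \<Longrightarrow> g \<in> word_sums \<Longrightarrow> (\<lambda>a. f a + g a) \<in> word_sums"
  by (induction rule: word_sums.induct) (auto simp: add.assoc intro: word_sums.add)

lemma word_sums_scale: "f \<in> word_sums \<Longrightarrow> (\<lambda>a. k * f a) \<in> word_sums"
  by (induction rule: word_sums.induct) (auto simp: distrib_left intro: word_sums.intros words_scale)

lemma word_sums_invol: "f \<in> word_sums \<Longrightarrow> invol G f \<in> word_sums"
proof (induction rule: word_sums.induct)
  case zero
  have "invol G (\<lambda>_. 0) = (\<lambda>_. 0)" by (simp add: invol_def fun_eq_iff)
  then show ?case by (simp add: word_sums.zero)
next
  case (add n f)
  have "invol G (\<lambda>a. n a + f a) = (\<lambda>a. invol G n a + invol G f a)"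
    by (simp add: invol_def fun_eq_iff)
  then show ?case
    using add by (simp add: word_sums.add words_invol)
qed

lemma word_sums_conv:
  assumes "f \<in> word_sums" "g \<in> word_sums"
  shows "conv G f g \<in> word_sums"
proof -
  have right: "conv G n g \<in> word_sums" if n: "n \<in> words" for n
    using assms(2)
  proof (induction rule: word_sums.induct)
    case zero
    then show ?case by (simp add: conv_zero_right word_sums.zero)
  next
    case (add m g)
    have "conv G n (\<lambda>a. m a + g a) = (\<lambda>a. conv G n m a + conv G n g a)"
      by (simp add: fun_eq_iff conv_add_right fin_fibres_Bc words_Bc n)
    then show ?case
      using add n by (simp add: word_sums.add words.mult)
  qed
  show ?thesis
    using assms(1)
  proof (induction rule: word_sums.induct)
    case zero
    have "conv G (\<lambda>_. 0) g = (\<lambda>_. 0)" by (simp add: fun_eq_iff conv_zero_left)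
    then show ?case by (simp add: word_sums.zero)
  next
    case (add n f)
    have "conv G (\<lambda>a. n a + f a) g = (\<lambda>a. conv G n g a + conv G f g a)"
      using add by (simp add: fun_eq_iff conv_add_left fin_fibres_Bc words_Bc word_sums_Bc)
    then show ?case
      using add by (simp add: word_sums_add right)
  qed
qed

text \<open>A partition of unity, built by induction on a finite cover of the support by bisections:
  each step splits off a summand supported in one of them.\<close>

lemma Cc_word_sums:
  assumes f: "f \<in> Cc G"
  shows "f \<in> word_sums"
proof -
  have cover: "f \<in> word_sums" if "finite \<U>" "\<And>U. U \<in> \<U> \<Longrightarrow> bisection G U" "f \<in> Cc G" "supp f \<subseteq> \<Union>\<U>" for \<U> f
    using that
  proof (induction \<U> arbitrary: f rule: finite_induct)
    case empty
    then have "f = (\<lambda>_. 0)" using supp_zero[of _ f] by auto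
    then show ?case by (simp add: word_sums.zero)
  next
    case (insert U \<U>)
    have f: "f \<in> Bc G" "continuous_on UNIV f" using insert.prems by (auto simp: Cc_def)
    have op: "open (\<Union>\<U>)" "open U" using insert.prems(1) by (auto simp: bisection_def)
    \<comment> \<open>This is the part of the support that only \<open>U\<close> can cover. With
      \<open>h\<close> equal to 1 near it, \<open>(1 - h) f\<close> is supported in the union of the
      remaining bisections.\<close>
    have "compact (supp f - \<Union>\<U>)"
      using Bc_compact[OF f(1)] op(1) by (rule compact_diff)
    then obtain h V where h: "h \<in> Cc G" "\<And>a. cmod (h a) \<le> 1" "open V" "supp f - \<Union>\<U> \<subseteq> V"
      "\<And>a. a \<in> V \<Longrightarrow> h a = 1" "supp h \<subseteq> U"
      using op(2) insert.prems(3) by (rule_tac bump[of "supp f - \<Union>\<U>" U]) auto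
    have ch: "continuous_on UNIV h" using h(1) by (simp add: Cc_def)
    have "(\<lambda>a. h a * f a) \<in> Cc G"
      using Bc_compact[OF f(1)]
      by (intro in_Cc[of _ "supp f"] continuous_intros f ch) (auto simp: supp_zero)
    moreover have "supp (\<lambda>a. h a * f a) \<subseteq> supp h"
      unfolding supp_def by (intro closure_mono) auto
    ultimately have w: "(\<lambda>a. h a * f a) \<in> words"
      using h(6) insert.prems(1) by (intro words.base[of _ U]) auto
    have "(\<lambda>a. (1 - h a) * f a) \<in> Cc G"
      using Bc_compact[OF f(1)]
      by (intro in_Cc[of _ "supp f"] continuous_intros f ch) (auto simp: supp_zero)
    moreover have "supp (\<lambda>a. (1 - h a) * f a) \<subseteq> supp f \<inter> - V"
      unfolding supp_def[of "\<lambda>a. (1 - h a) * f a"]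
    proof (rule closure_minimal)
      show "{a. (1 - h a) * f a \<noteq> 0} \<subseteq> supp f \<inter> - V"
        using h(5) supp_zero[of _ f] by (simp add: subset_iff) (metis (no_types))
      show "closed (supp f \<inter> - V)"
        using h(3) by (intro closed_Int closed_Compl) (simp_all add: supp_def)
    qed
    ultimately have "(\<lambda>a. (1 - h a) * f a) \<in> word_sums"
      using h(4) insert.prems(1) by (intro insert.IH) auto
    then have "(\<lambda>a. h a * f a + (1 - h a) * f a) \<in> word_sums"
      by (rule word_sums.add[OF w])
    moreover have "(\<lambda>a. h a * f a + (1 - h a) * f a) = f"
      by (simp add: algebra_simps)
    ultimately show ?case by simp
  qed
  have "supp f \<subseteq> \<Union>{U. bisection G U}"
    using bisection_at by auto
  moreover have "\<And>U. U \<in> {U. bisection G U} \<Longrightarrow> open U"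
    by (simp add: bisection_def)
  ultimately obtain \<U> where "\<U> \<subseteq> {U. bisection G U}" "finite \<U>" "supp f \<subseteq> \<Union>\<U>"
    using compactE[OF Bc_compact] f unfolding Cc_def by (metis (no_types, lifting) mem_Collect_eq)
  then show ?thesis
    using f by (intro cover[of \<U>]) auto
qed

text \<open>Statements about alg*G that are additive in the function need therefore be checked on
  words only.\<close>

theorem alg_star_word_sums: "f \<in> alg_star G \<Longrightarrow> f \<in> word_sums"
  by (induction rule: alg_star.induct)
     (auto intro: Cc_word_sums word_sums_add word_sums_scale word_sums_conv word_sums_invol)

text \<open>The set of products of composable elements of \<open>K\<close> and \<open>L\<close>
  works. If two products \<open>ab\<close> and \<open>cd\<close> have the same range, then
  \<open>a = c\<close> by injectivity on \<open>K\<close>, so \<open>b\<close> and \<open>d\<close>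
  have the same range and agree as well. Sources are treated symmetrically.\<close>

lemma words_support:
  "n \<in> words \<Longrightarrow> \<exists>K. compact K \<and> inj_on (grng G) K \<and> inj_on (gsrc G) K \<and> (\<forall>a. a \<notin> K \<longrightarrow> n a = 0)"
proof (induction rule: words.induct)
  case (base n U)
  then show ?case
    by (intro exI[of _ "supp n"]) (auto simp: Cc_def Bc_def bisection_def supp_zero intro: inj_on_subset)
next
  case (mult m n)
  obtain K where K: "compact K" "inj_on (grng G) K" "inj_on (gsrc G) K" "\<And>a. a \<notin> K \<Longrightarrow> m a = 0"
    using mult.IH(1) by blast
  obtain L where L: "compact L" "inj_on (grng G) L" "inj_on (gsrc G) L" "\<And>a. a \<notin> L \<Longrightarrow> n a = 0"
    using mult.IH(2) by blast
  let ?S = "(K \<times> L) \<inter> {(a, b). gsrc G a = grng G b}"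
  have "closed {p. gsrc G (fst p) = grng G (snd p)}"
    by (intro closed_Collect_eq
        continuous_on_compose2[OF continuous_src continuous_on_fst[OF continuous_on_id]]
        continuous_on_compose2[OF continuous_rng continuous_on_snd[OF continuous_on_id]] subset_UNIV)
  then have "closed {(a, b). gsrc G a = grng G b}"
    by (simp add: case_prod_beta')
  then have "compact ?S"
    by (intro compact_Int_closed compact_Times K L)
  then have "compact ((\<lambda>(a, b). gmul G a b) ` ?S)"
    by (intro compact_continuous_image continuous_on_subset[OF continuous_mul]) auto
  moreover have "inj_on (grng G) ((\<lambda>(a, b). gmul G a b) ` ?S)"
  proof (rule inj_onI, clarsimp)
    fix a b c d assume *: "grng G (gmul G a b) = grng G (gmul G c d)" "a \<in> K" "c \<in> K" "b \<in> L" "d \<in> L"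
      "gsrc G a = grng G b" "gsrc G c = grng G d"
    then have "a = c" using K(2) by (simp add: rng_mul inj_onD)
    moreover from this have "b = d" using * L(2) by (metis inj_onD)
    ultimately show "gmul G a b = gmul G c d" by simp
  qed
  moreover have "inj_on (gsrc G) ((\<lambda>(a, b). gmul G a b) ` ?S)"
  proof (rule inj_onI, clarsimp)
    fix a b c d assume *: "gsrc G (gmul G a b) = gsrc G (gmul G c d)" "a \<in> K" "c \<in> K" "b \<in> L" "d \<in> L"
      "gsrc G a = grng G b" "gsrc G c = grng G d"
    then have "b = d" using L(3) by (simp add: src_mul inj_onD)
    moreover from this have "a = c" using * K(3) by (metis inj_onD)
    ultimately show "gmul G a b = gmul G c d" by simp
  qed
  moreover have "conv G m n c = 0" if "c \<notin> (\<lambda>(a, b). gmul G a b) ` ?S" for c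
  proof -
    have "m a * n b = 0" if "(a, b) \<in> factorizations G c" for a b
    proof (rule ccontr)
      assume "m a * n b \<noteq> 0"
      then have "a \<in> K" "b \<in> L"
        using K(4) L(4) by auto
      then have "(a, b) \<in> ?S" "c = (\<lambda>(a, b). gmul G a b) (a, b)"
        using that by (auto simp: factorizations_def)
      with \<open>c \<notin> _\<close> show False by blast
    qed
    then show ?thesis
      unfolding conv_def by (intro infsum_0) auto
  qed
  ultimately show ?case by blast
qed

definition unit_part :: "('g \<Rightarrow> complex) \<Rightarrow> 'g \<Rightarrow> complex" where
  "unit_part f a = (if a \<in> gunits G then f a else 0)"

text \<open>As \<open>gsrc G\<close> is injective on the set \<open>K\<close> carrying
  \<open>n\<close>, no unit in \<open>K\<close> is the source of a non-unit in \<open>K\<close>.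
  Right convolution with a function \<open>h\<close> that is 1 at these units and 0 at these sources
  turns \<open>n\<close> into its unit part.\<close>

lemma words_unit_part:
  assumes n: "n \<in> words"
  shows "unit_part n \<in> alg_star G"
proof -
  obtain K where K: "compact K" "inj_on (gsrc G) K" "\<And>a. a \<notin> K \<Longrightarrow> n a = 0"
    using words_support[OF n] by blast
  let ?U = "gunits G - gsrc G ` (K - gunits G)"
  \<comment> \<open>The unit space is open, so the non-units in \<open>K\<close> form a compact set,
    and their sources form a closed one.\<close>
  have "compact (gsrc G ` (K - gunits G))"
    by (intro compact_continuous_image continuous_on_subset[OF continuous_src] compact_diff K open_units) auto
  then have "open ?U"
    using open_units by (intro open_Diff compact_imp_closed)
  moreover have "K \<inter> gunits G \<subseteq> ?U"
    using K(2) by (auto simp: unit_src dest: inj_onD) (metis inj_onD unit_src)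
  moreover have "compact (K \<inter> gunits G)"
    using K(1) closed_units by (rule compact_Int_closed)
  ultimately obtain h V where h: "h \<in> Cc G" "open V" "K \<inter> gunits G \<subseteq> V" "\<And>a. a \<in> V \<Longrightarrow> h a = 1" "supp h \<subseteq> ?U"
    by (rule_tac bump[of "K \<inter> gunits G" ?U]) auto
  have h0: "h a = 0" if "a \<notin> ?U" for a
    using that h(5) by (intro supp_zero) auto
  have "conv G n h a = unit_part n a" for a
  proof -
    have "conv G n h a = n a * h (gsrc G a)"
      using h0 by (intro conv_unit_right) auto
    also have "\<dots> = unit_part n a"
    proof (cases "a \<in> K")
      case True
      show ?thesis
      proof (cases "a \<in> gunits G")
        case True
        then have "h a = 1" using \<open>a \<in> K\<close> h(3,4) by auto
        then show ?thesis using True by (simp add: unit_part_def unit_src)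
      next
        case False
        then have "h (gsrc G a) = 0" using \<open>a \<in> K\<close> by (intro h0) auto
        then show ?thesis using False by (simp add: unit_part_def)
      qed
    qed (simp add: K(3) unit_part_def)
    finally show ?thesis .
  qed
  then have "unit_part n = conv G n h" by auto
  then show ?thesis
    using n h(1) by (auto intro: alg_star.intros words_alg_star)
qed

lemma alg_star_zero: "(\<lambda>_. 0) \<in> alg_star G"
proof -
  have "(\<lambda>_. 0) \<in> Cc G" by (rule in_Cc[of _ "{}"]) auto
  then show ?thesis by (rule alg_star.base)
qed

text \<open>Elements of alg*G need not be continuous, so it takes an argument that restricting them
  to the unit space stays in the algebra. The restriction is additive, which reduces the claim to
  words.\<close>

theorem unit_part_alg_star:
  assumes "f \<in> alg_star G"
  shows "unit_part f \<in> alg_star G"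
  using alg_star_word_sums[OF assms]
proof (induction rule: word_sums.induct)
  case zero
  have "unit_part (\<lambda>_. 0) = (\<lambda>_. 0)" by (simp add: unit_part_def fun_eq_iff)
  then show ?case by (simp add: alg_star_zero)
next
  case (add n f)
  have "unit_part (\<lambda>a. n a + f a) = (\<lambda>a. unit_part n a + unit_part f a)"
    by (simp add: unit_part_def fun_eq_iff)
  then show ?case
    using add by (simp add: alg_star.add words_unit_part)
qed

end

section \<open>Diagonals of operators\<close>

lemma ell2_scaleC_zero [simp]: "ell2_scaleC c 0 = 0"
  by (rule ell2_eqI) (simp add: ell2_scaleC.rep_eq)

text \<open>\<open>inner\<close> is the real part of the complex inner product, and pairing a vector
  with its multiple by \<open>\<i>\<close> gives a purely imaginary number.\<close>

lemma inner_ell2_scaleC_i: "inner \<psi> (ell2_scaleC \<i> \<psi>) = 0"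
  unfolding inner_ell2_def ell2_scaleC.rep_eq by (intro infsum_0) simp

lemma op_scaleC_tendsto:
  assumes "(S \<longlongrightarrow> T) F"
  shows "((\<lambda>n. op_scaleC c (S n)) \<longlongrightarrow> op_scaleC c T) F"
  unfolding op_scaleC_def by (intro bounded_bilinear.tendsto[OF bounded_bilinear_blinfun_compose] tendsto_const assms)

context groupoid
begin

lemma inv_unit: "x \<in> gunits G \<Longrightarrow> ginv G x = x"
  using mul_src_right[of "ginv G x"] mul_inv_left[of x] by (simp add: unit_src unit_rng src_inv)

text \<open>With \<open>k = 1\<close> and \<open>k = \<i>\<close> this recovers the real and the
  imaginary part of a coordinate from the real inner product.\<close>

lemma inner_delta: "inner \<phi> (ell2_scaleC k (delta x)) = Re (ell2_fun \<phi> x * cnj k)"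
proof -
  have "inner \<phi> (ell2_scaleC k (delta x)) = (\<Sum>\<^sub>\<infinity>c\<in>{x}. Re (ell2_fun \<phi> x * cnj k))"
    unfolding inner_ell2_def ell2_scaleC.rep_eq delta_apply by (intro infsum_cong_neutral) auto
  then show ?thesis by simp
qed

text \<open>The squared norm of the remainder is a tail of the convergent series for the squared
  norm of \<open>\<psi>\<close>.\<close>

lemma delta_span_dense:
  assumes "e > 0"
  shows "\<exists>F. finite F \<and> norm (\<psi> - (\<Sum>g\<in>F. ell2_scaleC (ell2_fun \<psi> g) (delta g))) < e"
proof -
  let ?s = "\<lambda>c. (cmod (ell2_fun \<psi> c))\<^sup>2"
  have "(?s has_sum (norm \<psi>)\<^sup>2) UNIV"
    unfolding norm_ell2_sq by (rule has_sum_infsum[OF ell2_summable])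
  then have "\<forall>\<^sub>F F in finite_subsets_at_top UNIV. dist (sum ?s F) ((norm \<psi>)\<^sup>2) < e\<^sup>2"
    unfolding has_sum_def using assms by (intro tendstoD) auto
  then obtain F where F: "finite F" "dist (sum ?s F) ((norm \<psi>)\<^sup>2) < e\<^sup>2"
    by (auto simp: eventually_finite_subsets_at_top)
  let ?d = "\<psi> - (\<Sum>g\<in>F. ell2_scaleC (ell2_fun \<psi> g) (delta g))"
  have sm: "ell2_fun (sum f A) c = (\<Sum>g\<in>A. ell2_fun (f g) c)" for f :: "'g \<Rightarrow> 'g ell2" and A c
    by (induction A rule: infinite_finite_induct) auto
  have d: "ell2_fun ?d c = (if c \<in> F then 0 else ell2_fun \<psi> c)" for c
    using F(1) by (simp add: sm ell2_scaleC.rep_eq delta_apply if_distrib[of "(*) _"] sum.delta cong: if_cong)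
  have "(norm ?d)\<^sup>2 = infsum ?s (UNIV - F)"
    unfolding norm_ell2_sq d by (intro infsum_cong_neutral) auto
  also have "\<dots> = (norm \<psi>)\<^sup>2 - sum ?s F"
    unfolding norm_ell2_sq using F(1) by (subst infsum_Diff) (auto intro: ell2_summable)
  also have "\<dots> < e\<^sup>2"
    using F(2) by (simp add: dist_real_def)
  finally have "norm ?d < e"
    using assms by (auto intro: power_less_imp_less_base)
  then show ?thesis using F(1) by blast
qed

end

context semi_etale_groupoid
begin

section \<open>Algebraic operations and complex linearity in the reduced C*-algebra\<close>

lemma Cstar_seq:
  assumes "T \<in> Cstar_red G"
  obtains f where "\<And>n. f n \<in> alg_star G" "(\<lambda>n. reg G (f n)) \<longlonglongrightarrow> T"
proof -
  obtain X where X: "\<And>n. X n \<in> reg G ` alg_star G" and "X \<longlonglongrightarrow> T"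
    using assms unfolding Cstar_red_def closure_sequential by blast
  from X have "\<forall>n. \<exists>f. f \<in> alg_star G \<and> X n = reg G f"
    by blast
  then obtain f where f: "\<And>n. f n \<in> alg_star G" "\<And>n. X n = reg G (f n)"
    by metis
  have "X = (\<lambda>n. reg G (f n))" using f(2) by auto
  then show thesis
    using that[of f] f(1) \<open>X \<longlonglongrightarrow> T\<close> by simp
qed

lemma Cstar_lim: "(\<And>n. S n \<in> Cstar_red G) \<Longrightarrow> S \<longlonglongrightarrow> T \<Longrightarrow> T \<in> Cstar_red G"
  unfolding Cstar_red_def by (rule closed_sequentially[OF closed_closure])

lemma reg_Cstar: "f \<in> alg_star G \<Longrightarrow> reg G f \<in> Cstar_red G"
  unfolding Cstar_red_def by (rule subsetD[OF closure_subset imageI])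

lemma Cstar_add: "S \<in> Cstar_red G \<Longrightarrow> T \<in> Cstar_red G \<Longrightarrow> S + T \<in> Cstar_red G"
proof (elim Cstar_seq)
  fix f g assume f: "\<And>n. f n \<in> alg_star G" "(\<lambda>n. reg G (f n)) \<longlonglongrightarrow> S"
    and g: "\<And>n. g n \<in> alg_star G" "(\<lambda>n. reg G (g n)) \<longlonglongrightarrow> T"
  have "reg G (f n) + reg G (g n) \<in> Cstar_red G" for n
    using reg_Cstar[OF alg_star.add[OF f(1) g(1), of n n]] by (simp add: reg_add_Bc alg_star_Bc f g)
  then show ?thesis
    by (rule Cstar_lim) (rule tendsto_add[OF f(2) g(2)])
qed

lemma Cstar_scaleC: "T \<in> Cstar_red G \<Longrightarrow> op_scaleC k T \<in> Cstar_red G"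
proof (elim Cstar_seq)
  fix f assume f: "\<And>n. f n \<in> alg_star G" "(\<lambda>n. reg G (f n)) \<longlonglongrightarrow> T"
  have "op_scaleC k (reg G (f n)) \<in> Cstar_red G" for n
    using reg_Cstar[OF alg_star.scale[OF f(1), of k n]] by (simp add: reg_scale_Bc alg_star_Bc f)
  then show ?thesis
    by (rule Cstar_lim) (rule op_scaleC_tendsto[OF f(2)])
qed

lemma Cstar_compose: "S \<in> Cstar_red G \<Longrightarrow> T \<in> Cstar_red G \<Longrightarrow> S o\<^sub>L T \<in> Cstar_red G"
proof (elim Cstar_seq)
  fix f g assume f: "\<And>n. f n \<in> alg_star G" "(\<lambda>n. reg G (f n)) \<longlonglongrightarrow> S"
    and g: "\<And>n. g n \<in> alg_star G" "(\<lambda>n. reg G (g n)) \<longlonglongrightarrow> T"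
  have "reg G (f n) o\<^sub>L reg G (g n) \<in> Cstar_red G" for n
    using reg_Cstar[OF alg_star.conv[OF f(1) g(1), of n n]] by (simp add: reg_conv alg_star_Bc f g)
  then show ?thesis
    by (rule Cstar_lim) (rule bounded_bilinear.tendsto[OF bounded_bilinear_blinfun_compose f(2) g(2)])
qed

text \<open>The operator type guarantees only real linearity. Convolution operators are complex
  linear, and this passes to limits.\<close>

lemma Cstar_complex_linear:
  assumes "T \<in> Cstar_red G"
  shows "T (ell2_scaleC k \<psi>) = ell2_scaleC k (T \<psi>)"
proof -
  obtain f where f: "\<And>n. f n \<in> alg_star G" "(\<lambda>n. reg G (f n)) \<longlonglongrightarrow> T"
    by (rule Cstar_seq[OF assms]) blast
  have "reg G (f n) (ell2_scaleC k \<psi>) = op_scaleC k (reg G (f n)) \<psi>" for n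
    by (rule ell2_eqI)
       (simp add: op_scaleC_apply ell2_scaleC.rep_eq reg_apply_Bc conv_scale_right fin_fibres_Bc alg_star_Bc f)
  moreover have "(\<lambda>n. op_scaleC k (reg G (f n)) \<psi>) \<longlonglongrightarrow> op_scaleC k T \<psi>"
    by (intro blinfun.tendsto op_scaleC_tendsto f tendsto_const)
  moreover have "(\<lambda>n. reg G (f n) (ell2_scaleC k \<psi>)) \<longlonglongrightarrow> T (ell2_scaleC k \<psi>)"
    by (intro blinfun.tendsto f tendsto_const)
  ultimately show ?thesis
    by (simp add: op_scaleC_apply LIMSEQ_unique)
qed

lemma Cstar_eq_0I:
  assumes T: "T \<in> Cstar_red G" and "\<And>g. T (delta g) = 0"
  shows "T = 0"
proof (rule blinfun_eqI)
  fix \<psi>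
  have "norm (T \<psi>) \<le> e" if "0 < e" for e
  proof -
    have "0 < e / (norm T + 1)"
      using that by (simp add: add_nonneg_pos)
    then obtain F where F: "finite F"
      "norm (\<psi> - (\<Sum>g\<in>F. ell2_scaleC (ell2_fun \<psi> g) (delta g))) < e / (norm T + 1)"
      using delta_span_dense by blast
    have "T (\<Sum>g\<in>F. ell2_scaleC (ell2_fun \<psi> g) (delta g)) = 0"
      using assms by (simp add: blinfun.sum_right Cstar_complex_linear)
    then have "norm (T \<psi>) = norm (T (\<psi> - (\<Sum>g\<in>F. ell2_scaleC (ell2_fun \<psi> g) (delta g))))"
      by (simp add: blinfun.diff_right)
    also have "\<dots> \<le> norm T * (e / (norm T + 1))"
      by (rule order_trans[OF norm_blinfun mult_left_mono]) (use F(2) in auto)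
    also have "\<dots> \<le> e"
      using that mult_left_mono[of "norm T" "norm T + 1" e]
      by (simp add: pos_divide_le_eq add_nonneg_pos mult.commute)
    finally show ?thesis .
  qed
  then have "norm (T \<psi>) \<le> 0"
    using field_le_epsilon[of "norm (T \<psi>)" 0] by simp
  then show "blinfun_apply T \<psi> = blinfun_apply 0 \<psi>"
    by simp
qed

text \<open>The matrix entries of a convolution operator: the only \<open>a\<close> that carries
  \<open>g\<close> to \<open>c\<close> is \<open>c\<close> times the inverse of
  \<open>g\<close>.\<close>

lemma reg_delta:
  assumes "f \<in> Bc G"
  shows "ell2_fun (reg G f (delta g)) c = (if gsrc G c = gsrc G g then f (gmul G c (ginv G g)) else 0)"
proof (cases "gsrc G c = gsrc G g")
  case True
  let ?a = "gmul G c (ginv G g)"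
  have r: "grng G ?a = grng G c"
    using True by (simp add: rng_mul rng_inv)
  have ag: "gmul G (ginv G ?a) c = g"
    using True by (simp add: inv_mul rng_inv mul_assoc src_inv mul_inv_left) (metis mul_src_right)
  have "gmul G (ginv G a) c \<noteq> g" if "a \<noteq> ?a" "grng G a = grng G c" for a
  proof
    assume *: "gmul G (ginv G a) c = g"
    then have "ginv G g = gmul G (ginv G c) a"
      using that by (auto simp: inv_mul src_inv)
    then have "?a = gmul G c (gmul G (ginv G c) a)" by simp
    then show False
      using that by (simp add: mul_inv_cancel)
  qed
  then have "conv G f (ell2_fun (delta g)) c
      = (\<Sum>\<^sub>\<infinity>a\<in>{?a}. f a * ell2_fun (delta g) (gmul G (ginv G a) c))"
    unfolding conv_alt using r by (intro infsum_cong_neutral) (auto simp: delta_apply)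
  then show ?thesis
    using True by (simp add: reg_apply_Bc[OF assms] ag delta_apply)
next
  case False
  have "conv G f (ell2_fun (delta g)) c = 0"
    unfolding conv_alt using False
    by (intro infsum_0) (auto simp: delta_apply src_mul src_inv)
  then show ?thesis
    using False by (simp add: reg_apply_Bc[OF assms])
qed

text \<open>Right multiplication by \<open>g\<close> maps the arrows with source
  \<open>grng G g\<close> bijectively onto those with source \<open>gsrc G g\<close> and commutes
  with left convolution. Norms at point masses are thus determined by those at units.\<close>

lemma norm_delta_rng:
  assumes "T \<in> Cstar_red G"
  shows "norm (T (delta g)) = norm (T (delta (grng G g)))"
proof -
  have eq: "norm (reg G f (delta g)) = norm (reg G f (delta (grng G g)))" if "f \<in> Bc G" for f
  proof -
    have u: "ginv G (grng G g) = grng G g" "gsrc G (grng G g) = grng G g"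
      by (simp_all add: inv_unit rng_unit unit_src)
    have "(\<Sum>\<^sub>\<infinity>c. (cmod (ell2_fun (reg G f (delta g)) c))\<^sup>2)
        = (\<Sum>\<^sub>\<infinity>c\<in>{c. gsrc G c = gsrc G g}. (cmod (f (gmul G c (ginv G g))))\<^sup>2)"
      by (intro infsum_cong_neutral) (auto simp: reg_delta[OF that])
    also have "\<dots> = (\<Sum>\<^sub>\<infinity>c\<in>{c. gsrc G c = grng G g}. (cmod (f c))\<^sup>2)"
    proof (rule infsum_reindex_bij_witness[of _ "\<lambda>c. gmul G c g" "\<lambda>c. gmul G c (ginv G g)"])
      fix c assume "c \<in> {c. gsrc G c = gsrc G g}"
      then show "gmul G (gmul G c (ginv G g)) g = c" "gmul G c (ginv G g) \<in> {c. gsrc G c = grng G g}"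
        using mul_src_right[of c] by (auto simp: mul_assoc rng_inv src_inv mul_inv_left src_mul)
    next
      fix c assume "c \<in> {c. gsrc G c = grng G g}"
      then show "gmul G (gmul G c g) (ginv G g) = c" "gmul G c g \<in> {c. gsrc G c = gsrc G g}"
        using mul_src_right[of c] by (auto simp: mul_assoc rng_inv src_inv mul_inv_right src_mul)
    qed simp
    also have "\<dots> = (\<Sum>\<^sub>\<infinity>c. (cmod (ell2_fun (reg G f (delta (grng G g))) c))\<^sup>2)"
      by (intro infsum_cong_neutral) (auto simp: reg_delta[OF that] u, metis mul_src_right)
    finally show ?thesis by (simp add: norm_ell2_def)
  qed
  obtain f where f: "\<And>n. f n \<in> alg_star G" "(\<lambda>n. reg G (f n)) \<longlonglongrightarrow> T"
    by (rule Cstar_seq[OF assms]) blast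
  have "(\<lambda>n. norm (reg G (f n) (delta a))) \<longlonglongrightarrow> norm (T (delta a))" for a
    by (intro tendsto_norm blinfun.tendsto f tendsto_const)
  from this[of g] this[of "grng G g"] show ?thesis
    using eq[OF alg_star_Bc[OF f(1)]] by (simp add: LIMSEQ_unique)
qed

text \<open>By injectivity of the source on \<open>K\<close>, the column of the matrix at
  \<open>gsrc G g\<close> has at most one non-zero entry.\<close>

lemma delta_bisection:
  assumes "n \<in> Bc G" "inj_on (gsrc G) K" "\<And>a. a \<notin> K \<Longrightarrow> n a = 0" "g \<in> K"
  shows "reg G n (delta (gsrc G g)) = ell2_scaleC (n g) (delta g)"
proof (rule ell2_eqI)
  fix c
  have "n c = 0" if "gsrc G c = gsrc G g" "c \<noteq> g"
    using assms(2-4) that by (metis inj_onD)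
  then show "ell2_fun (reg G n (delta (gsrc G g))) c = ell2_fun (ell2_scaleC (n g) (delta g)) c"
    using mul_src_right[of c]
    by (auto simp: reg_delta assms(1) ell2_scaleC.rep_eq delta_apply unit_src src_unit inv_unit)
qed

lemma delta_bisection_none:
  assumes "n \<in> Bc G" "\<And>a. a \<notin> K \<Longrightarrow> n a = 0" "y \<in> gunits G" "y \<notin> gsrc G ` K"
  shows "reg G n (delta y) = 0"
proof (rule ell2_eqI)
  fix c
  have "n c = 0" if "gsrc G c = y"
    using assms(2,4) that by auto
  then show "ell2_fun (reg G n (delta y)) c = ell2_fun 0 c"
    using mul_src_right[of c] assms(3)
    by (auto simp: reg_delta assms(1) unit_src inv_unit)
qed

text \<open>The conditional expectation onto the diagonal algebra, with values regarded as functions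
  (\<open>diag_DF\<close>, \<open>diag_reg_DF\<close>).\<close>

definition diag :: "'g ell2_op \<Rightarrow> 'g \<Rightarrow> complex" where
  "diag T x = (if x \<in> gunits G then ell2_fun (T (delta x)) x else 0)"

text \<open>The diagonal of \<open>T^* T\<close>, written with norms so that no adjoint of
  \<open>T\<close> has to be formed.\<close>

definition sq_norms :: "'g ell2_op \<Rightarrow> 'g \<Rightarrow> complex" where
  "sq_norms T x = (if x \<in> gunits G then of_real ((norm (T (delta x)))\<^sup>2) else 0)"

lemma diag_diff: "cmod (diag S x - diag T x) \<le> norm (S - T)"
proof -
  have "cmod (ell2_fun (S (delta x)) x - ell2_fun (T (delta x)) x) \<le> norm ((S - T) (delta x))"
    using cmod_le_norm_ell2[of "(S - T) (delta x)" x] by (simp add: blinfun.diff_left)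
  also have "\<dots> \<le> norm (S - T)"
    using norm_blinfun[of "S - T" "delta x"] by (simp add: norm_delta)
  finally show ?thesis by (simp add: diag_def)
qed

lemma diag_reg_Bc: "f \<in> Bc G \<Longrightarrow> diag (reg G f) = unit_part f"
  using mul_src_right by (auto simp: diag_def unit_part_def reg_delta inv_unit fun_eq_iff) (metis unit_src)

text \<open>Being uniform in \<open>x\<close>, this bound makes \<open>sq_norms\<close> continuous
  from the operator norm to the uniform norm.\<close>

lemma sq_norms_diff: "cmod (sq_norms S x - sq_norms T x) \<le> norm (S - T) * (norm S + norm T)"
proof (cases "x \<in> gunits G")
  case True
  let ?s = "norm (S (delta x))" and ?t = "norm (T (delta x))"
  have "\<bar>?s\<^sup>2 - ?t\<^sup>2\<bar> = \<bar>?s - ?t\<bar> * (?s + ?t)"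
    by (simp add: power2_eq_square square_diff_square_factored abs_mult)
  also have "\<dots> \<le> norm (S - T) * (norm S + norm T)"
  proof (intro mult_mono add_mono)
    have "\<bar>?s - ?t\<bar> \<le> norm ((S - T) (delta x))"
      by (simp add: blinfun.diff_left norm_triangle_ineq3)
    also have "\<dots> \<le> norm (S - T)"
      using norm_blinfun[of "S - T" "delta x"] by (simp add: norm_delta)
    finally show "\<bar>?s - ?t\<bar> \<le> norm (S - T)" .
    show "?s \<le> norm S" "?t \<le> norm T"
      using norm_blinfun[of S "delta x"] norm_blinfun[of T "delta x"] by (simp_all add: norm_delta)
  qed auto
  finally show ?thesis
    using True by (simp add: sq_norms_def flip: of_real_power of_real_diff)
qed (simp add: sq_norms_def)

text \<open>The functions corresponding to the elements of \<^term>\<open>D_alg G\<close> (\<open>D_alg_eq\<close>).\<close>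

definition unit_alg :: "('g \<Rightarrow> complex) set" where
  "unit_alg = {f \<in> alg_star G. \<forall>a. a \<notin> gunits G \<longrightarrow> f a = 0}"

definition DF :: "('g \<Rightarrow> complex) set" where
  "DF = {h. \<forall>e>0. \<exists>f\<in>unit_alg. \<forall>a. cmod (h a - f a) \<le> e}"

lemma DF_approx:
  assumes "h \<in> DF" "e > 0"
  obtains f where "f \<in> unit_alg" "\<And>a. cmod (h a - f a) \<le> e"
  using assms unfolding DF_def by blast

lemma unit_alg_DF: "f \<in> unit_alg \<Longrightarrow> f \<in> DF"
  unfolding DF_def by (force intro: bexI[of _ f])

lemma DF_limit:
  assumes "\<And>e. e > 0 \<Longrightarrow> \<exists>f\<in>DF. \<forall>a. cmod (h a - f a) \<le> e"
  shows "h \<in> DF"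
  unfolding DF_def
proof (intro CollectI allI impI)
  fix e :: real assume "e > 0"
  then obtain f where f: "f \<in> DF" "\<And>a. cmod (h a - f a) \<le> e / 2"
    using assms[of "e / 2"] by auto
  then obtain k where k: "k \<in> unit_alg" "\<And>a. cmod (f a - k a) \<le> e / 2"
    using \<open>e > 0\<close> by (auto elim: DF_approx[of f "e / 2"])
  have "cmod (h a - k a) \<le> e" for a
    using norm_triangle_ineq[of "h a - f a" "f a - k a"] f(2)[of a] k(2)[of a] by simp
  with k(1) show "\<exists>f\<in>unit_alg. \<forall>a. cmod (h a - f a) \<le> e"
    by blast
qed

lemma DF_outside: "h \<in> DF \<Longrightarrow> a \<notin> gunits G \<Longrightarrow> h a = 0"
proof -
  assume h: "h \<in> DF" and a: "a \<notin> gunits G"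
  have "cmod (h a) \<le> 0 + e" if e: "e > 0" for e
  proof -
    obtain f where "f \<in> unit_alg" "cmod (h a - f a) \<le> e"
      using DF_approx[OF h e] by blast
    then show ?thesis using a by (simp add: unit_alg_def)
  qed
  then have "cmod (h a) \<le> 0" by (rule field_le_epsilon)
  then show ?thesis by simp
qed

lemma unit_alg_Bc: "f \<in> unit_alg \<Longrightarrow> f \<in> Bc G"
  by (simp add: unit_alg_def alg_star_Bc)

lemma DF_bound:
  assumes "h \<in> DF"
  obtains M where "\<And>a. cmod (h a) \<le> M"
proof -
  obtain f where f: "f \<in> unit_alg" "\<And>a. cmod (h a - f a) \<le> 1"
    using DF_approx[OF assms zero_less_one] by blast
  obtain M where M: "\<And>a. cmod (f a) \<le> M"
    using Bc_bound[OF unit_alg_Bc[OF f(1)]] by blast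
  have "cmod (h a) \<le> 1 + M" for a
    using norm_triangle_ineq[of "h a - f a" "f a"] f(2)[of a] M[of a] by simp
  then show thesis by (rule that)
qed

lemma DF_conv_bounded: "h \<in> DF \<Longrightarrow> \<exists>C. conv_bounded h C"
  by (meson DF_bound DF_outside conv_bounded_unit)

section \<open>Multiplication operators and the diagonal algebra\<close>

lemma reg_DF_apply: "h \<in> DF \<Longrightarrow> ell2_fun (reg G h \<psi>) c = h (grng G c) * ell2_fun \<psi> c"
  using DF_conv_bounded[of h] DF_outside[of h] by (auto simp: reg_apply conv_unit)

lemma norm_reg_DF_diff:
  assumes "h \<in> DF" "k \<in> DF" "\<And>a. cmod (h a - k a) \<le> e"
  shows "norm (reg G h - reg G k) \<le> e"
proof -
  have d: "conv_bounded (\<lambda>a. h a - k a) e"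
    using assms by (intro conv_bounded_unit) (auto simp: DF_outside)
  have "reg G h - reg G k = reg G (\<lambda>a. h a - k a)"
    by (intro blinfun_eqI ell2_eqI)
       (simp add: blinfun.diff_left reg_DF_apply assms reg_apply[OF d] conv_unit DF_outside algebra_simps)
  then show ?thesis
    using norm_reg_le[OF d] by simp
qed

lemma reg_DF_delta:
  assumes "h \<in> DF"
  shows "reg G h (delta g) = ell2_scaleC (h (grng G g)) (delta g)"
  by (rule ell2_eqI) (simp add: reg_DF_apply assms ell2_scaleC.rep_eq delta_apply)

lemma diag_reg_DF: "h \<in> DF \<Longrightarrow> diag (reg G h) = h"
  by (auto simp: diag_def fun_eq_iff reg_DF_apply delta_apply unit_rng DF_outside)

lemma reg_DF_Cstar:
  assumes "h \<in> DF"
  shows "reg G h \<in> Cstar_red G"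
  unfolding Cstar_red_def closure_approachable
proof (intro allI impI)
  fix e :: real assume "e > 0"
  then obtain f where f: "f \<in> unit_alg" "\<And>a. cmod (h a - f a) \<le> e / 2"
    using DF_approx[OF assms, of "e / 2"] by auto
  then have "norm (reg G h - reg G f) \<le> e / 2"
    by (intro norm_reg_DF_diff assms unit_alg_DF)
  then show "\<exists>T\<in>reg G ` alg_star G. dist T (reg G h) < e"
    using f(1) \<open>e > 0\<close> by (intro bexI[of _ "reg G f"]) (auto simp: unit_alg_def dist_norm norm_minus_commute)
qed

text \<open>The diagonal is contractive, and it takes the operator of a function in alg*G to the
  unit part of that function, which is again in alg*G.\<close>

lemma diag_DF:
  assumes "T \<in> Cstar_red G"
  shows "diag T \<in> DF"
  unfolding DF_def
proof (intro CollectI allI impI)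
  fix e :: real assume "e > 0"
  then obtain f where f: "f \<in> alg_star G" "dist (reg G f) T < e"
    using assms unfolding Cstar_red_def closure_approachable by blast
  have "cmod (diag T a - unit_part f a) \<le> e" for a
    using diag_diff[of T a "reg G f"] f(2) diag_reg_Bc[OF alg_star_Bc[OF f(1)]]
    by (simp add: dist_norm norm_minus_commute)
  moreover have "unit_part f \<in> unit_alg"
    using unit_part_alg_star[OF f(1)] by (simp add: unit_alg_def unit_part_def)
  ultimately show "\<exists>f\<in>unit_alg. \<forall>a. cmod (diag T a - f a) \<le> e" by blast
qed

lemma DF_B0:
  assumes "h \<in> DF"
  shows "h \<in> B0 G"
  unfolding B0_def
proof (intro CollectI conjI allI impI)
  obtain M where "\<And>a. cmod (h a) \<le> M" using assms by (rule DF_bound) blast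
  then show "bounded (range h)" by (auto intro: boundedI)
  show "a \<notin> gunits G \<Longrightarrow> h a = 0" for a by (rule DF_outside[OF assms])
  fix e :: real assume "e > 0"
  then obtain f where f: "f \<in> unit_alg" "\<And>a. cmod (h a - f a) \<le> e / 2"
    using DF_approx[OF assms, of "e / 2"] by auto
  have "supp f \<subseteq> gunits G"
    unfolding supp_def using f(1) by (intro closure_minimal closed_units) (auto simp: unit_alg_def)
  moreover have "cmod (h x) < e" if "x \<in> gunits G - supp f" for x
    using f(2)[of x] that \<open>e > 0\<close> supp_zero[of x f] by simp
  ultimately show "\<exists>K. compact K \<and> K \<subseteq> gunits G \<and> (\<forall>x\<in>gunits G - K. cmod (h x) < e)"
    using Bc_compact[OF unit_alg_Bc[OF f(1)]] by blast
qed

text \<open>An operator \<open>reg G h\<close> with \<open>h\<close> in \<open>B0 G\<close> has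
  diagonal \<open>h\<close>, and diagonals of elements of C*_r(G) lie in \<open>DF\<close>.\<close>

theorem D_alg_eq: "D_alg G = reg G ` DF"
proof (intro equalityI subsetI)
  fix T assume "T \<in> D_alg G"
  then obtain h where h: "h \<in> B0 G" "T = reg G h" "T \<in> Cstar_red G"
    by (auto simp: D_alg_def)
  obtain M where M: "\<And>a. cmod (h a) \<le> M" "\<And>a. a \<notin> gunits G \<Longrightarrow> h a = 0"
    using B0E[OF h(1)] by blast
  have "diag T = h"
    using M(2) unfolding h(2)
    by (auto simp: diag_def fun_eq_iff reg_apply[OF conv_bounded_unit[OF M(2,1)]] conv_unit delta_apply unit_rng)
  then show "T \<in> reg G ` DF"
    using diag_DF[OF h(3)] h(2) by blast
qed (auto simp: D_alg_def DF_B0 reg_DF_Cstar)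

lemma closed_D_alg: "closed (D_alg G)"
  unfolding D_alg_def Cstar_red_def reg_B0_eq by (intro closed_Int closed_closure)

text \<open>Here, and below for products and multiples, membership in \<open>DF\<close> is obtained
  by combining the operators in C*_r(G) and taking the diagonal of the result.\<close>

lemma DF_add: "h \<in> DF \<Longrightarrow> k \<in> DF \<Longrightarrow> (\<lambda>a. h a + k a) \<in> DF"
  and reg_DF_add: "h \<in> DF \<Longrightarrow> k \<in> DF \<Longrightarrow> reg G (\<lambda>a. h a + k a) = reg G h + reg G k"
proof -
  assume hk: "h \<in> DF" "k \<in> DF"
  have "diag (reg G h + reg G k) = (\<lambda>a. diag (reg G h) a + diag (reg G k) a)"
    by (simp add: diag_def fun_eq_iff blinfun.add_left)
  then show *: "(\<lambda>a. h a + k a) \<in> DF"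
    using diag_DF[OF Cstar_add[OF hk[THEN reg_DF_Cstar]]] hk by (simp add: diag_reg_DF)
  show "reg G (\<lambda>a. h a + k a) = reg G h + reg G k"
    by (intro blinfun_eqI ell2_eqI) (simp add: blinfun.add_left reg_DF_apply hk * algebra_simps)
qed

lemma DF_mult: "h \<in> DF \<Longrightarrow> k \<in> DF \<Longrightarrow> (\<lambda>a. h a * k a) \<in> DF"
  and reg_DF_mult: "h \<in> DF \<Longrightarrow> k \<in> DF \<Longrightarrow> reg G (\<lambda>a. h a * k a) = reg G h o\<^sub>L reg G k"
proof -
  assume hk: "h \<in> DF" "k \<in> DF"
  have "diag (reg G h o\<^sub>L reg G k) = (\<lambda>a. h a * k a)"
    using hk by (auto simp: diag_def fun_eq_iff reg_DF_apply delta_apply unit_rng DF_outside)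
  then show *: "(\<lambda>a. h a * k a) \<in> DF"
    using diag_DF[OF Cstar_compose[OF hk[THEN reg_DF_Cstar]]] by simp
  show "reg G (\<lambda>a. h a * k a) = reg G h o\<^sub>L reg G k"
    by (intro blinfun_eqI ell2_eqI) (simp add: reg_DF_apply hk * algebra_simps)
qed

lemma DF_scale: "h \<in> DF \<Longrightarrow> (\<lambda>a. c * h a) \<in> DF"
  and reg_DF_scale: "h \<in> DF \<Longrightarrow> reg G (\<lambda>a. c * h a) = op_scaleC c (reg G h)"
proof -
  assume h: "h \<in> DF"
  have "diag (op_scaleC c (reg G h)) = (\<lambda>a. c * h a)"
    using h by (auto simp: diag_def fun_eq_iff op_scaleC_apply ell2_scaleC.rep_eq reg_DF_apply delta_apply unit_rng DF_outside)
  then show *: "(\<lambda>a. c * h a) \<in> DF"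
    using diag_DF[OF Cstar_scaleC[OF reg_DF_Cstar[OF h]], of c] by simp
  show "reg G (\<lambda>a. c * h a) = op_scaleC c (reg G h)"
    by (intro blinfun_eqI ell2_eqI) (simp add: reg_DF_apply h * op_scaleC_apply ell2_scaleC.rep_eq algebra_simps)
qed

text \<open>Units are their own inverses, so on functions carried by the unit space the involution
  of alg*G is complex conjugation.\<close>

lemma DF_cnj:
  assumes h: "h \<in> DF"
  shows "(\<lambda>a. cnj (h a)) \<in> DF"
  unfolding DF_def
proof (intro CollectI allI impI)
  fix e :: real assume "e > 0"
  then obtain f where f: "f \<in> unit_alg" "\<And>a. cmod (h a - f a) \<le> e"
    using DF_approx[OF h] by blast
  have "invol G f a = cnj (f a)" for a
  proof (cases "a \<in> gunits G")
    case False
    then have "ginv G a \<notin> gunits G" by (metis inv_inv inv_unit)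
    then show ?thesis using False f(1) by (simp add: invol_def unit_alg_def)
  qed (simp add: invol_def inv_unit)
  then have inv: "invol G f = (\<lambda>a. cnj (f a))" by auto
  have "(\<lambda>a. cnj (f a)) \<in> unit_alg"
    using f(1) alg_star.invol[of f G] by (auto simp: unit_alg_def inv)
  moreover have "cmod (cnj (h a) - cnj (f a)) \<le> e" for a
    using f(2)[of a] by (metis complex_cnj_diff complex_mod_cnj)
  ultimately show "\<exists>f\<in>unit_alg. \<forall>a. cmod (cnj (h a) - f a) \<le> e"
    by (intro bexI[of _ "\<lambda>a. cnj (f a)"] allI)
qed

text \<open>For \<open>f\<close> in alg*G this is the diagonal of the operator of the convolution
  product of \<open>invol G f\<close> and \<open>f\<close>. The general case follows by uniform
  approximation.\<close>

lemma sq_norms_DF: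
  assumes T: "T \<in> Cstar_red G"
  shows "sq_norms T \<in> DF"
proof -
  have alg: "sq_norms (reg G f) \<in> DF" if f: "f \<in> alg_star G" for f
  proof -
    let ?P = "reg G (invol G f) o\<^sub>L reg G f"
    have B: "f \<in> Bc G" "invol G f \<in> Bc G" using f by (auto intro: alg_star_Bc invol_Bc)
    have ii: "invol G (invol G f) = f" by (simp add: invol_def fun_eq_iff)
    have "ell2_fun (?P (delta y)) y = (norm (reg G f (delta y)))\<^sup>2" for y
    proof (rule complex_eqI)
      have s1: "delta y = ell2_scaleC 1 (delta y)"
        by (rule ell2_eqI) (simp add: ell2_scaleC.rep_eq)
      have "Re (ell2_fun (?P (delta y)) y) = inner (?P (delta y)) (delta y)"
        using inner_delta[of "?P (delta y)" 1 y] s1 by simp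
      also have "\<dots> = inner (reg G f (delta y)) (reg G f (delta y))"
        using reg_invol[OF B(2)] by (simp add: ii)
      finally show "Re (ell2_fun (?P (delta y)) y) = Re (of_real ((norm (reg G f (delta y)))\<^sup>2))"
        by (simp add: power2_norm_eq_inner)
      \<comment> \<open>The imaginary part is read off by pairing with the
        \<open>\<i>\<close>-multiple of \<open>delta y\<close>; moving one factor across leaves a
        vector paired with its own \<open>\<i>\<close>-multiple.\<close>
      have "Im (ell2_fun (?P (delta y)) y) = inner (?P (delta y)) (ell2_scaleC \<i> (delta y))"
        using inner_delta[of "?P (delta y)" \<i> y] by simp
      also have "\<dots> = inner (reg G f (delta y)) (ell2_scaleC \<i> (reg G f (delta y)))"
        using reg_invol[OF B(2)] Cstar_complex_linear[OF reg_Cstar[OF f]] by (simp add: ii)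
      finally show "Im (ell2_fun (?P (delta y)) y) = Im (of_real ((norm (reg G f (delta y)))\<^sup>2))"
        by (simp add: inner_ell2_scaleC_i)
    qed
    then have "sq_norms (reg G f) = diag ?P"
      by (simp add: sq_norms_def diag_def fun_eq_iff)
    then show ?thesis
      using f by (simp add: diag_DF Cstar_compose reg_Cstar alg_star.invol)
  qed
  obtain f where f: "\<And>n. f n \<in> alg_star G" "(\<lambda>n. reg G (f n)) \<longlonglongrightarrow> T"
    by (rule Cstar_seq[OF T]) blast
  have lim: "(\<lambda>n. norm (T - reg G (f n)) * (norm T + norm (reg G (f n)))) \<longlonglongrightarrow> norm (T - T) * (norm T + norm T)"
    by (intro tendsto_intros f)
  show ?thesis
  proof (rule DF_limit)
    fix e :: real assume "e > 0"
    then have "\<forall>\<^sub>F n in sequentially. norm (T - reg G (f n)) * (norm T + norm (reg G (f n))) < e"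
      using order_tendstoD(2)[OF lim, of e] by simp
    then obtain n where "norm (T - reg G (f n)) * (norm T + norm (reg G (f n))) < e"
      by (auto simp: eventually_sequentially)
    then have "cmod (sq_norms T a - sq_norms (reg G (f n)) a) \<le> e" for a
      using sq_norms_diff[of T a "reg G (f n)"] by linarith
    then show "\<exists>f\<in>DF. \<forall>a. cmod (sq_norms T a - f a) \<le> e"
      using alg[OF f(1)] by blast
  qed
qed

text \<open>For functions \<open>f\<close> on the unit space, a non-zero term of the product at
  \<open>c\<close> needs \<open>ginv G a\<close> and \<open>gmul G (ginv G a) c\<close> in
  \<open>K\<close>. They have the same range, so they coincide and \<open>c\<close> is a unit. The
  rest is approximation.\<close>

lemma conj_D_alg:
  assumes n: "n \<in> alg_star G" and K: "inj_on (grng G) K" "\<And>a. a \<notin> K \<Longrightarrow> n a = 0"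
    and T: "T \<in> D_alg G"
  shows "reg G (invol G n) o\<^sub>L T o\<^sub>L reg G n \<in> D_alg G"
proof -
  have B: "n \<in> Bc G" "invol G n \<in> Bc G" using n by (auto intro: alg_star_Bc invol_Bc)
  have fin: "reg G (invol G n) o\<^sub>L reg G f o\<^sub>L reg G n \<in> D_alg G" if f: "f \<in> unit_alg" for f
  proof -
    let ?k = "conv G (conv G (invol G n) f) n"
    have fB: "f \<in> Bc G" by (rule unit_alg_Bc[OF f])
    have "?k c = 0" if c: "c \<notin> gunits G" for c
    proof -
      have "invol G n a * conv G f n (gmul G (ginv G a) c) = 0" if a: "grng G a = grng G c" for a
      proof (rule ccontr)
        assume "\<not> ?thesis"
        moreover have "conv G f n (gmul G (ginv G a) c) = f (grng G (gmul G (ginv G a) c)) * n (gmul G (ginv G a) c)"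
          using f by (intro conv_unit) (simp add: unit_alg_def)
        ultimately have "n (ginv G a) \<noteq> 0" "n (gmul G (ginv G a) c) \<noteq> 0"
          by (auto simp: invol_def)
        then have "ginv G a \<in> K" "gmul G (ginv G a) c \<in> K"
          using K(2) by blast+
        moreover have "grng G (gmul G (ginv G a) c) = grng G (ginv G a)"
          using a by (simp add: rng_mul src_inv)
        ultimately have "gmul G (ginv G a) c = ginv G a"
          using K(1) by (simp add: inj_onD)
        then have "c = grng G a"
          using mul_inv_cancel[OF a] by (simp add: mul_inv_right)
        then show False using c rng_unit by simp
      qed
      then have "conv G (invol G n) (conv G f n) c = 0"
        unfolding conv_alt[of "invol G n"] by (intro infsum_0) auto
      then show ?thesis
        by (simp add: conv_assoc B fB)
    qed
    then have "?k \<in> unit_alg"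
      using n f by (auto simp: unit_alg_def intro: alg_star.intros)
    moreover have "reg G ?k = reg G (invol G n) o\<^sub>L reg G f o\<^sub>L reg G n"
      by (simp add: reg_conv conv_Bc B fB)
    ultimately show ?thesis
      unfolding D_alg_eq using unit_alg_DF by (metis image_eqI)
  qed
  obtain h where h: "h \<in> DF" "T = reg G h" using T by (auto simp: D_alg_eq)
  have "\<exists>f\<in>unit_alg. \<forall>a. cmod (h a - f a) \<le> inverse (Suc m)" for m
    using h(1) unfolding DF_def by (auto simp del: of_nat_Suc)
  then obtain f where f: "\<And>m. f m \<in> unit_alg" "\<And>m a. cmod (h a - f m a) \<le> inverse (Suc m)"
    by metis
  have "(\<lambda>m. reg G (f m) - T) \<longlonglongrightarrow> 0"
  proof (rule Lim_null_comparison[OF _ LIMSEQ_inverse_real_of_nat])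
    have "norm (T - reg G (f m)) \<le> inverse (Suc m)" for m
      unfolding h(2) by (rule norm_reg_DF_diff[OF h(1) unit_alg_DF[OF f(1)] f(2)])
    then show "\<forall>\<^sub>F m in sequentially. norm (reg G (f m) - T) \<le> inverse (real (Suc m))"
      by (simp add: norm_minus_commute del: of_nat_Suc)
  qed
  then have "(\<lambda>m. reg G (f m)) \<longlonglongrightarrow> T"
    by (simp add: LIM_zero_iff)
  then have "(\<lambda>m. reg G (invol G n) o\<^sub>L reg G (f m) o\<^sub>L reg G n) \<longlonglongrightarrow> (reg G (invol G n) o\<^sub>L T o\<^sub>L reg G n)"
    by (intro bounded_bilinear.tendsto[OF bounded_bilinear_blinfun_compose] tendsto_const)
  then show ?thesis
    by (rule closed_sequentially[OF closed_D_alg, rotated]) (rule fin[OF f(1)])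
qed

text \<open>The operator of \<open>n\<close> sends the point mass at \<open>gsrc G g\<close> to
  \<open>n g\<close> times that at \<open>g\<close>, then \<open>h\<close> contributes its value at
  \<open>grng G g\<close>, and the involution of \<open>n\<close> leads back with the conjugate
  factor.\<close>

lemma diag_conj:
  assumes n: "n \<in> Bc G" and K: "inj_on (gsrc G) K" "\<And>a. a \<notin> K \<Longrightarrow> n a = 0"
    and h: "h \<in> DF"
  shows "g \<in> K \<Longrightarrow> diag (reg G (invol G n) o\<^sub>L reg G h o\<^sub>L reg G n) (gsrc G g)
      = of_real ((cmod (n g))\<^sup>2) * h (grng G g)"
    and "y \<notin> gsrc G ` K \<Longrightarrow> diag (reg G (invol G n) o\<^sub>L reg G h o\<^sub>L reg G n) y = 0"
proof -
  note inv = invol_Bc[OF n]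
  assume g: "g \<in> K"
  have "reg G h (ell2_scaleC (n g) (delta g)) = ell2_scaleC (n g * h (grng G g)) (delta g)"
    by (rule ell2_eqI) (simp add: reg_DF_apply h ell2_scaleC.rep_eq delta_apply)
  moreover have "ell2_fun (reg G (invol G n) (ell2_scaleC c (delta g))) (gsrc G g) = c * cnj (n g)" for c
  proof -
    have "ell2_fun (reg G (invol G n) (ell2_scaleC c (delta g))) (gsrc G g)
        = c * ell2_fun (reg G (invol G n) (delta g)) (gsrc G g)"
      by (simp add: reg_apply_Bc[OF inv] ell2_scaleC.rep_eq conv_scale_right[OF fin_fibres_Bc[OF inv]])
    also have "\<dots> = c * cnj (n g)"
      using rng_mul_left[of "ginv G g"] by (simp add: reg_delta[OF inv] unit_src src_unit invol_def rng_inv)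
    finally show ?thesis .
  qed
  ultimately show "diag (reg G (invol G n) o\<^sub>L reg G h o\<^sub>L reg G n) (gsrc G g)
      = of_real ((cmod (n g))\<^sup>2) * h (grng G g)"
    using complex_norm_square[of "n g"]
    by (simp add: diag_def src_unit delta_bisection[OF n K g] mult.assoc mult.left_commute)
next
  assume "y \<notin> gsrc G ` K"
  then show "diag (reg G (invol G n) o\<^sub>L reg G h o\<^sub>L reg G n) y = 0"
    using delta_bisection_none[OF n K(2), of K y] by (simp add: diag_def)
qed

end

section \<open>Ideals of the diagonal algebra\<close>

text \<open>Approximation by Bernstein polynomials; those of a function vanishing at \<open>0\<close> have no
  constant term, so that no unit is needed in \<open>S\<close>.\<close>

lemma continuous_functional_calculus:
  fixes S :: "('a \<Rightarrow> complex) set" and g :: "'a \<Rightarrow> real" and \<Phi> :: "real \<Rightarrow> real"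
  assumes add: "\<And>h k. h \<in> S \<Longrightarrow> k \<in> S \<Longrightarrow> (\<lambda>a. h a + k a) \<in> S"
    and scale: "\<And>h c. h \<in> S \<Longrightarrow> (\<lambda>a. c * h a) \<in> S"
    and mult: "\<And>h k. h \<in> S \<Longrightarrow> k \<in> S \<Longrightarrow> (\<lambda>a. h a * k a) \<in> S"
    and limit: "\<And>h. (\<And>e. e > 0 \<Longrightarrow> \<exists>f\<in>S. \<forall>a. cmod (h a - f a) \<le> e) \<Longrightarrow> h \<in> S"
    and g: "(\<lambda>a. complex_of_real (g a)) \<in> S" "\<And>a. 0 \<le> g a" "\<And>a. g a \<le> M"
    and \<Phi>: "continuous_on {0..} \<Phi>" "\<Phi> 0 = 0"
  shows "(\<lambda>a. complex_of_real (\<Phi> (g a))) \<in> S"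
proof (rule limit)
  fix e :: real assume "e > 0"
  \<comment> \<open>The summand 1 makes the scaling factor positive whatever \<open>M\<close> is;
    dividing by it moves the values of \<open>g\<close> into the unit interval.\<close>
  define L where "L = \<bar>M\<bar> + 1"
  define t where "t a = g a / L" for a
  have L: "L > 0" by (simp add: L_def)
  have t01: "t a \<in> {0..1}" for a
    using g(2,3)[of a] L by (auto simp: t_def L_def divide_simps)
  have gt: "g a = L * t a" for a using L by (simp add: t_def)
  have tS: "(\<lambda>a. complex_of_real (t a)) \<in> S"
    using scale[OF g(1), of "of_real (inverse L)"] by (simp add: t_def divide_inverse mult.commute)
  have zero: "(\<lambda>a. 0) \<in> S"
    using scale[OF tS, of 0] by simp
  have pow: "(\<lambda>a. complex_of_real (t a ^ Suc k)) \<in> S" for k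
  proof (induction k)
    case 0
    then show ?case using tS by simp
  next
    case (Suc k)
    then show ?case using mult[OF tS Suc] by simp
  qed
  have pow2: "(\<lambda>a. complex_of_real (t a ^ Suc k * (1 - t a) ^ m)) \<in> S" for k m
  proof (induction m)
    case 0
    then show ?case using pow by simp
  next
    case (Suc m)
    \<comment> \<open>The constant 1 need not be in \<open>S\<close>, so multiplication by
      \<open>1 - t\<close> is carried out as the subtraction of a product with
      \<open>t\<close>.\<close>
    have "(\<lambda>a. complex_of_real (t a ^ Suc k * (1 - t a) ^ m)
        + (- 1) * (complex_of_real (t a) * complex_of_real (t a ^ Suc k * (1 - t a) ^ m))) \<in> S"
      by (intro add Suc scale mult tS)
    then show ?case by (simp add: algebra_simps)
  qed
  have sums: "(\<lambda>a. complex_of_real (\<Sum>k\<in>A. c k * Bernstein n k (t a))) \<in> S"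
    if "finite A" "0 \<notin> A" for A c n
    using that
  proof (induction A rule: finite_induct)
    case empty
    then show ?case using zero by simp
  next
    case (insert k A)
    then obtain l where l: "k = Suc l" by (metis insertCI not0_implies_Suc)
    have "(\<lambda>a. complex_of_real (c k * (n choose k)) * complex_of_real (t a ^ Suc l * (1 - t a) ^ (n - k))
        + complex_of_real (\<Sum>k\<in>A. c k * Bernstein n k (t a))) \<in> S"
      using insert by (intro add scale pow2) auto
    then show ?case
      using insert.hyps by (simp add: Bernstein_def l algebra_simps)
  qed
  have "continuous_on {0..1} (\<lambda>x. \<Phi> (L * x))"
    using L by (intro continuous_on_compose2[OF \<Phi>(1)] continuous_intros) auto
  then obtain n where n: "\<And>x. x \<in> {0..1} \<Longrightarrow>
      \<bar>\<Phi> (L * x) - (\<Sum>k\<le>n. \<Phi> (L * (k / n)) * Bernstein n k x)\<bar> < e"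
    using Bernstein_Weierstrass[OF _ \<open>e > 0\<close>] by blast
  let ?p = "\<lambda>a. \<Sum>k\<in>{1..n}. \<Phi> (L * (k / n)) * Bernstein n k (t a)"
  have p: "(\<Sum>k\<le>n. \<Phi> (L * (k / n)) * Bernstein n k (t a)) = ?p a" for a
  proof (rule sum.mono_neutral_right)
    show "\<forall>k\<in>{..n} - {1..n}. \<Phi> (L * (real k / real n)) * Bernstein n k (t a) = 0"
      by (auto simp: \<Phi>(2) not_le)
  qed auto
  have "cmod (complex_of_real (\<Phi> (g a)) - complex_of_real (?p a)) \<le> e" for a
    using n[OF t01[of a]] unfolding p gt of_real_diff[symmetric] norm_of_real by simp
  moreover have "(\<lambda>a. complex_of_real (?p a)) \<in> S"
    by (rule sums) auto
  ultimately show "\<exists>f\<in>S. \<forall>a. cmod (complex_of_real (\<Phi> (g a)) - f a) \<le> e"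
    by (intro bexI[of _ "\<lambda>a. complex_of_real (?p a)"]) auto
qed

lemma closed_idealD:
  assumes "closed_ideal A J"
  shows "J \<subseteq> A" "closed J" "0 \<in> J" "\<And>S T. S \<in> J \<Longrightarrow> T \<in> J \<Longrightarrow> S + T \<in> J"
    "\<And>c T. T \<in> J \<Longrightarrow> op_scaleC c T \<in> J"
    "\<And>S T. S \<in> A \<Longrightarrow> T \<in> J \<Longrightarrow> S o\<^sub>L T \<in> J" "\<And>S T. S \<in> A \<Longrightarrow> T \<in> J \<Longrightarrow> T o\<^sub>L S \<in> J"
  using assms unfolding closed_ideal_def by blast+

lemma closed_ideal_minus:
  assumes "closed_ideal A J" "S \<in> J" "T \<in> J"
  shows "S - T \<in> J"
proof -
  have "op_scaleC (- 1) T = - T"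
    by (intro blinfun_eqI ell2_eqI) (simp add: op_scaleC_apply ell2_scaleC.rep_eq blinfun.minus_left)
  then have "- T \<in> J"
    using closed_idealD(5)[OF assms(1,3), of "- 1"] by simp
  then show ?thesis
    using closed_idealD(4)[OF assms(1,2)] by force
qed

context semi_etale_groupoid
begin

lemma DF_functional_calculus:
  assumes "(\<lambda>a. complex_of_real (g a)) \<in> DF" "\<And>a. 0 \<le> g a" "continuous_on {0..} \<Phi>" "\<Phi> 0 = (0::real)"
  shows "(\<lambda>a. complex_of_real (\<Phi> (g a))) \<in> DF"
proof -
  obtain M where M: "\<And>a. cmod (complex_of_real (g a)) \<le> M"
    using assms(1) by (rule DF_bound) blast
  have "g a \<le> M" for a using M[of a] by simp
  then show ?thesis
    using assms DF_add DF_scale DF_mult DF_limit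
    by (intro continuous_functional_calculus[of DF g M \<Phi>]) auto
qed

definition ideal_fun :: "'g ell2_op set \<Rightarrow> ('g \<Rightarrow> complex) set" where
  "ideal_fun J = {h \<in> DF. reg G h \<in> J}"

lemma ideal_fun_limit:
  assumes J: "closed J" and h: "\<And>e. e > 0 \<Longrightarrow> \<exists>f\<in>ideal_fun J. \<forall>a. cmod (h a - f a) \<le> e"
  shows "h \<in> ideal_fun J"
proof -
  have hD: "h \<in> DF"
    by (rule DF_limit) (use h in \<open>force simp: ideal_fun_def\<close>)
  have "reg G h \<in> closure J"
    unfolding closure_approachable
  proof (intro allI impI)
    fix e :: real assume "e > 0"
    then obtain f where f: "f \<in> DF" "reg G f \<in> J" "\<And>a. cmod (h a - f a) \<le> e / 2"
      using h[of "e / 2"] by (auto simp: ideal_fun_def)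
    then have "norm (reg G h - reg G f) \<le> e / 2"
      by (intro norm_reg_DF_diff hD)
    then show "\<exists>T\<in>J. dist T (reg G h) < e"
      using f(2) \<open>e > 0\<close> by (intro bexI[of _ "reg G f"]) (auto simp: dist_norm norm_minus_commute)
  qed
  then show ?thesis
    using hD J by (simp add: ideal_fun_def)
qed

lemma reg_DF_D_alg: "h \<in> DF \<Longrightarrow> reg G h \<in> D_alg G"
  by (simp add: D_alg_eq)

lemma ideal_fun_mult:
  assumes "closed_ideal (D_alg G) J" "h \<in> DF" "k \<in> ideal_fun J"
  shows "(\<lambda>a. h a * k a) \<in> ideal_fun J"
  using assms closed_idealD(6)[OF assms(1)]
  by (simp add: ideal_fun_def DF_mult reg_DF_mult reg_DF_D_alg)

text \<open>If \<open>\<bar>h\<bar>\<^sup>2 \<le> r\<close>, then \<open>h\<close> is the uniform limit of \<open>h r / (r + \<epsilon>)\<close> as \<open>\<epsilon> \<rightarrow> 0\<close>.\<close>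

lemma ideal_fun_hereditary:
  assumes J: "closed_ideal (D_alg G) J" and r: "(\<lambda>a. complex_of_real (r a)) \<in> ideal_fun J" "\<And>a. 0 \<le> r a"
    and h: "h \<in> DF" "\<And>a. (cmod (h a))\<^sup>2 \<le> r a"
  shows "h \<in> ideal_fun J"
proof (rule ideal_fun_limit)
  note Jd = closed_idealD[OF J]
  show "closed J" by (rule Jd(2))
  obtain M where M: "\<And>a. cmod (complex_of_real (r a)) \<le> M"
    using r(1) DF_bound[of "\<lambda>a. complex_of_real (r a)"] by (auto simp: ideal_fun_def)
  have rM: "r a \<le> M" for a using M[of a] by simp
  fix e :: real assume e: "e > 0"
  \<comment> \<open>Regularising with the square of \<open>e\<close> makes the final error at most
    \<open>e\<close>.\<close>
  let ?\<Phi> = "\<lambda>s. s / (s + e\<^sup>2)"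
  have pos: "s + e\<^sup>2 > 0" if "s \<ge> 0" for s using that e by (simp add: add_nonneg_pos)
  have "(\<lambda>a. complex_of_real (?\<Phi> (r a))) \<in> ideal_fun J"
  proof (rule continuous_functional_calculus[where M = M and \<Phi> = "?\<Phi>"])
    show "continuous_on {0..} ?\<Phi>"
      by (intro continuous_intros ballI) (use pos in fastforce)
    show "\<And>h. (\<And>e. 0 < e \<Longrightarrow> \<exists>f\<in>ideal_fun J. \<forall>a. cmod (h a - f a) \<le> e) \<Longrightarrow> h \<in> ideal_fun J"
      by (rule ideal_fun_limit[OF Jd(2)])
  qed (use r rM Jd in \<open>auto simp: ideal_fun_def DF_add reg_DF_add DF_scale reg_DF_scale DF_mult reg_DF_mult reg_DF_D_alg\<close>)
  then have "(\<lambda>a. h a * complex_of_real (?\<Phi> (r a))) \<in> ideal_fun J"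
    by (rule ideal_fun_mult[OF J h(1)])
  moreover have "cmod (h a - h a * complex_of_real (?\<Phi> (r a))) \<le> e" for a
  proof -
    have "1 - ?\<Phi> (r a) = e\<^sup>2 / (r a + e\<^sup>2)"
      using pos[OF r(2), of a] by (simp add: diff_divide_distrib[symmetric] eq_divide_eq left_diff_distrib)
    moreover have "h a - h a * complex_of_real (?\<Phi> (r a)) = h a * complex_of_real (1 - ?\<Phi> (r a))"
      by (simp only: of_real_diff of_real_1 right_diff_distrib mult_1_right)
    ultimately have "h a - h a * complex_of_real (?\<Phi> (r a)) = h a * complex_of_real (e\<^sup>2 / (r a + e\<^sup>2))"
      by simp
    then have "cmod (h a - h a * complex_of_real (?\<Phi> (r a))) = cmod (h a) * (e\<^sup>2 / (r a + e\<^sup>2))"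
      using pos[OF r(2), of a] by (simp add: norm_mult del: of_real_divide)
    also have "\<dots> \<le> e"
    proof -
      \<comment> \<open>The inequality between geometric and arithmetic mean for
        \<open>cmod (h a)\<close> and \<open>e\<close>, with \<open>r\<close> dominating the square
        of the former.\<close>
      have "cmod (h a) * e \<le> r a + e\<^sup>2"
        using sum_squares_bound[of "cmod (h a)" e] h(2)[of a]
          mult_nonneg_nonneg[OF norm_ge_zero[of "h a"] less_imp_le[OF e]] by linarith
      then have "cmod (h a) * e * e \<le> (r a + e\<^sup>2) * e"
        using e by (intro mult_right_mono) auto
      then show ?thesis
        using pos[OF r(2), of a] by (simp add: pos_divide_le_eq power2_eq_square algebra_simps)
    qed
    finally show ?thesis .
  qed
  ultimately show "\<exists>f\<in>ideal_fun J. \<forall>a. cmod (h a - f a) \<le> e"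
    by (intro bexI[of _ "\<lambda>a. h a * complex_of_real (?\<Phi> (r a))"]) auto
qed

text \<open>The square of \<open>r\<close> is in the ideal as well and dominates the square of the
  modulus of \<open>h\<close>.\<close>

lemma ideal_fun_hereditary':
  assumes J: "closed_ideal (D_alg G) J" and r: "(\<lambda>a. complex_of_real (r a)) \<in> ideal_fun J"
    and h: "h \<in> DF" "\<And>a. cmod (h a) \<le> r a"
  shows "h \<in> ideal_fun J"
proof (rule ideal_fun_hereditary[OF J _ _ h(1)])
  have "(\<lambda>a. complex_of_real (r a) * complex_of_real (r a)) \<in> ideal_fun J"
    using r by (intro ideal_fun_mult[OF J]) (auto simp: ideal_fun_def)
  then show "(\<lambda>a. complex_of_real ((r a)\<^sup>2)) \<in> ideal_fun J"
    by (simp add: power2_eq_square)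
qed (simp_all add: h power_mono)

end

section \<open>The ideal induced by an invariant ideal\<close>

context semi_etale_groupoid
begin

text \<open>Invariance is given for functions supported in an open bisection, which a word need not
  be. It is applied to the factors of a word one after the other.\<close>

lemma G_invariant_words:
  assumes "G_invariant G J" "n \<in> words" "T \<in> J"
  shows "reg G (invol G n) o\<^sub>L T o\<^sub>L reg G n \<in> J"
  using assms(2,3)
proof (induction arbitrary: T rule: words.induct)
  case (base n U)
  then have "n \<in> N0 G"
    by (auto simp: N0_def intro: alg_star.base)
  then show ?case
    using assms(1) base(4) by (simp add: G_invariant_def)
next
  case (mult m n)
  have "reg G (invol G n) o\<^sub>L (reg G (invol G m) o\<^sub>L T o\<^sub>L reg G m) o\<^sub>L reg G n \<in> J"
    by (intro mult.IH mult.prems)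
  moreover have "reg G (invol G (conv G m n)) o\<^sub>L T o\<^sub>L reg G (conv G m n)
      = reg G (invol G n) o\<^sub>L (reg G (invol G m) o\<^sub>L T o\<^sub>L reg G m) o\<^sub>L reg G n"
    using mult.hyps by (intro blinfun_eqI) (simp add: invol_conv reg_conv words_Bc invol_Bc)
  ultimately show ?case by simp
qed

text \<open>Since \<open>sq_norms T = diag (T\<^sup>* T)\<close>, this is a left ideal as in the Gelfand-Naimark-Segal construction;
  invariance of \<open>J\<close> makes it a right ideal.\<close>

definition induced_ideal :: "'g ell2_op set \<Rightarrow> 'g ell2_op set" where
  "induced_ideal J = {T \<in> Cstar_red G. reg G (sq_norms T) \<in> J}"

text \<open>The membership test for the sums and multiples below: \<open>sq_norms T\<close> always
  lies in \<open>DF\<close>, so by hereditarity of \<open>J\<close> it is enough to dominate it by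
  an element of \<open>J\<close>.\<close>

lemma induced_ideal_dominated:
  assumes J: "closed_ideal (D_alg G) J" and T: "T \<in> Cstar_red G" and k: "k \<in> ideal_fun J"
    and le: "\<And>a. a \<in> gunits G \<Longrightarrow> \<exists>s. k a = of_real s \<and> (norm (T (delta a)))\<^sup>2 \<le> s"
  shows "T \<in> induced_ideal J"
proof -
  \<comment> \<open>Hereditarity is stated for real dominating functions; \<open>k\<close> is real
    on the units and zero elsewhere.\<close>
  have kr: "(\<lambda>a. complex_of_real (Re (k a))) = k"
  proof
    fix a
    show "complex_of_real (Re (k a)) = k a"
      using le[of a] k by (cases "a \<in> gunits G") (auto simp: ideal_fun_def DF_outside)
  qed
  have "sq_norms T \<in> ideal_fun J"
  proof (rule ideal_fun_hereditary'[OF J _ sq_norms_DF[OF T]])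
    show "(\<lambda>a. complex_of_real (Re (k a))) \<in> ideal_fun J" using k kr by simp
    show "cmod (sq_norms T a) \<le> Re (k a)" for a
      using le[of a] k by (cases "a \<in> gunits G") (auto simp: sq_norms_def ideal_fun_def DF_outside norm_power)
  qed
  then show ?thesis
    using T by (simp add: induced_ideal_def ideal_fun_def)
qed

lemma induced_ideal_fun: "T \<in> induced_ideal J \<Longrightarrow> sq_norms T \<in> ideal_fun J"
  by (simp add: induced_ideal_def ideal_fun_def sq_norms_DF)

lemma induced_ideal_closed:
  assumes J: "closed_ideal (D_alg G) J"
  shows "closed (induced_ideal J)"
  unfolding closed_sequential_limits
proof (intro allI impI, elim conjE)
  fix X T assume X: "\<forall>n. X n \<in> induced_ideal J" and lim: "X \<longlonglongrightarrow> T"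
  have XA: "X n \<in> Cstar_red G" for n using X by (simp add: induced_ideal_def)
  then have T: "T \<in> Cstar_red G" using lim by (rule Cstar_lim)
  have "(\<lambda>n. reg G (sq_norms (X n)) - reg G (sq_norms T)) \<longlonglongrightarrow> 0"
  proof (rule Lim_null_comparison)
    show "\<forall>\<^sub>F n in sequentially. norm (reg G (sq_norms (X n)) - reg G (sq_norms T))
        \<le> norm (X n - T) * (norm (X n) + norm T)"
      by (intro always_eventually allI norm_reg_DF_diff sq_norms_DF XA T sq_norms_diff)
    have "(\<lambda>n. norm (X n - T) * (norm (X n) + norm T)) \<longlonglongrightarrow> norm (T - T) * (norm T + norm T)"
      by (intro tendsto_intros lim)
    then show "(\<lambda>n. norm (X n - T) * (norm (X n) + norm T)) \<longlonglongrightarrow> 0" by simp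
  qed
  then have "(\<lambda>n. reg G (sq_norms (X n))) \<longlonglongrightarrow> reg G (sq_norms T)"
    by (simp add: LIM_zero_iff)
  then have "reg G (sq_norms T) \<in> J"
    by (rule closed_sequentially[OF closed_idealD(2)[OF J], rotated]) (use X in \<open>simp add: induced_ideal_def\<close>)
  then show "T \<in> induced_ideal J"
    using T by (simp add: induced_ideal_def)
qed

lemma induced_ideal_add:
  assumes J: "closed_ideal (D_alg G) J" and S: "S \<in> induced_ideal J" and T: "T \<in> induced_ideal J"
  shows "S + T \<in> induced_ideal J"
proof (rule induced_ideal_dominated[OF J])
  show "S + T \<in> Cstar_red G" using S T by (simp add: induced_ideal_def Cstar_add)
  show "(\<lambda>a. 2 * sq_norms S a + 2 * sq_norms T a) \<in> ideal_fun J"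
    using induced_ideal_fun[OF S] induced_ideal_fun[OF T] closed_idealD(4,5)[OF J]
    by (simp add: ideal_fun_def DF_add DF_scale reg_DF_add reg_DF_scale)
  fix a assume a: "a \<in> gunits G"
  \<comment> \<open>The parallelogram law; dropping the second square leaves the bound for the
    sum.\<close>
  have "(norm (S (delta a) + T (delta a)))\<^sup>2 + (norm (S (delta a) - T (delta a)))\<^sup>2
      = 2 * (norm (S (delta a)))\<^sup>2 + 2 * (norm (T (delta a)))\<^sup>2"
    by (simp add: power2_norm_eq_inner inner_add_left inner_add_right inner_diff_left inner_diff_right)
  then have "(norm ((S + T) (delta a)))\<^sup>2 \<le> 2 * (norm (S (delta a)))\<^sup>2 + 2 * (norm (T (delta a)))\<^sup>2"
    using zero_le_power2[of "norm (S (delta a) - T (delta a))"] unfolding blinfun.add_left by linarith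
  then show "\<exists>s. 2 * sq_norms S a + 2 * sq_norms T a = complex_of_real s \<and> (norm ((S + T) (delta a)))\<^sup>2 \<le> s"
    using a by (intro exI[of _ "2 * (norm (S (delta a)))\<^sup>2 + 2 * (norm (T (delta a)))\<^sup>2"]) (simp add: sq_norms_def)
qed

lemma induced_ideal_zero:
  assumes J: "closed_ideal (D_alg G) J"
  shows "0 \<in> induced_ideal J"
proof -
  have z: "reg G (\<lambda>_. 0) = 0"
    using norm_reg_le[OF conv_bounded_zero] by simp
  then have "0 \<in> Cstar_red G"
    using reg_Cstar[OF alg_star_zero] by simp
  moreover have "sq_norms 0 = (\<lambda>_. 0)" by (simp add: sq_norms_def fun_eq_iff)
  ultimately show ?thesis
    using z closed_idealD(3)[OF J] by (simp add: induced_ideal_def)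
qed

lemma induced_ideal_left:
  assumes J: "closed_ideal (D_alg G) J" and S: "S \<in> Cstar_red G" and T: "T \<in> induced_ideal J"
  shows "S o\<^sub>L T \<in> induced_ideal J"
proof (rule induced_ideal_dominated[OF J])
  show "S o\<^sub>L T \<in> Cstar_red G" using S T by (simp add: induced_ideal_def Cstar_compose)
  show "(\<lambda>a. of_real ((norm S)\<^sup>2) * sq_norms T a) \<in> ideal_fun J"
    using induced_ideal_fun[OF T] closed_idealD(5)[OF J]
    by (simp add: ideal_fun_def DF_scale reg_DF_scale)
  fix a assume a: "a \<in> gunits G"
  have "(norm ((S o\<^sub>L T) (delta a)))\<^sup>2 \<le> (norm S)\<^sup>2 * (norm (T (delta a)))\<^sup>2"
    using power_mono[OF norm_blinfun[of S "T (delta a)"], of 2] by (simp add: power_mult_distrib)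
  then show "\<exists>s. of_real ((norm S)\<^sup>2) * sq_norms T a = complex_of_real s \<and> (norm ((S o\<^sub>L T) (delta a)))\<^sup>2 \<le> s"
    using a by (intro exI[of _ "(norm S)\<^sup>2 * (norm (T (delta a)))\<^sup>2"]) (simp add: sq_norms_def)
qed

lemma induced_ideal_scale:
  assumes J: "closed_ideal (D_alg G) J" and T: "T \<in> induced_ideal J"
  shows "op_scaleC c T \<in> induced_ideal J"
proof (rule induced_ideal_dominated[OF J])
  show "op_scaleC c T \<in> Cstar_red G" using T by (simp add: induced_ideal_def Cstar_scaleC)
  show "(\<lambda>a. of_real ((cmod c)\<^sup>2) * sq_norms T a) \<in> ideal_fun J"
    using induced_ideal_fun[OF T] closed_idealD(5)[OF J]
    by (simp add: ideal_fun_def DF_scale reg_DF_scale)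
  fix a assume a: "a \<in> gunits G"
  show "\<exists>s. of_real ((cmod c)\<^sup>2) * sq_norms T a = complex_of_real s \<and> (norm (op_scaleC c T (delta a)))\<^sup>2 \<le> s"
    using a by (intro exI[of _ "(cmod c)\<^sup>2 * (norm (T (delta a)))\<^sup>2"])
      (simp add: sq_norms_def op_scaleC_apply norm_ell2_scaleC power_mult_distrib)
qed

text \<open>This is where invariance enters. At \<open>gsrc G g\<close> with \<open>g\<close> in
  \<open>K\<close>, both \<open>sq_norms\<close> of the product and the diagonal of the conjugate of
  \<open>sq_norms T\<close> by \<open>n\<close> are the squared modulus of \<open>n g\<close> times
  the squared norm of \<open>T\<close> at the unit \<open>grng G g\<close>; elsewhere both
  vanish.\<close>

lemma induced_ideal_words:
  assumes J: "closed_ideal (D_alg G) J" "G_invariant G J" and T: "T \<in> induced_ideal J" and n: "n \<in> words"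
  shows "T o\<^sub>L reg G n \<in> induced_ideal J"
proof -
  obtain K where K: "inj_on (grng G) K" "inj_on (gsrc G) K" "\<And>a. a \<notin> K \<Longrightarrow> n a = 0"
    using words_support[OF n] by blast
  have TA: "T \<in> Cstar_red G" using T by (simp add: induced_ideal_def)
  have A: "T o\<^sub>L reg G n \<in> Cstar_red G"
    using TA n by (simp add: Cstar_compose reg_Cstar words_alg_star)
  let ?P = "reg G (invol G n) o\<^sub>L reg G (sq_norms T) o\<^sub>L reg G n"
  have P: "?P \<in> J"
    using T by (intro G_invariant_words[OF J(2) n]) (simp add: induced_ideal_def)
  then obtain h where h: "h \<in> DF" "?P = reg G h"
    using closed_idealD(1)[OF J(1)] by (auto simp: D_alg_eq)
  have "sq_norms (T o\<^sub>L reg G n) y = diag ?P y" for y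
  proof (cases "y \<in> gsrc G ` K")
    case True
    then obtain g where g: "g \<in> K" "y = gsrc G g" by blast
    have "norm (T (reg G n (delta (gsrc G g)))) = cmod (n g) * norm (T (delta (grng G g)))"
      by (simp add: delta_bisection[OF words_Bc[OF n] K(2,3) g(1)] Cstar_complex_linear[OF TA]
          norm_ell2_scaleC norm_delta_rng[OF TA, of g])
    then show ?thesis
      using diag_conj(1)[OF words_Bc[OF n] K(2,3) sq_norms_DF[OF TA] g(1)]
      by (simp add: g(2) sq_norms_def src_unit rng_unit power_mult_distrib)
  next
    case False
    then have "diag ?P y = 0"
      using diag_conj(2)[OF words_Bc[OF n] K(2), of "sq_norms T" y] K(3) sq_norms_DF[OF TA] by simp
    then show ?thesis
      using delta_bisection_none[OF words_Bc[OF n] K(3) _ False] by (simp add: sq_norms_def)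
  qed
  \<comment> \<open>As an element of \<open>D_alg G\<close>, the conjugate \<open>?P\<close> is the
    operator of its own diagonal.\<close>
  then have "sq_norms (T o\<^sub>L reg G n) = h"
    using diag_reg_DF[OF h(1)] h(2) by (simp add: fun_eq_iff)
  then show ?thesis
    using A P h(2) by (simp add: induced_ideal_def)
qed

text \<open>By additivity, words suffice for operators of functions in alg*G, which are dense; the
  induced ideal is closed.\<close>

lemma induced_ideal_right:
  assumes J: "closed_ideal (D_alg G) J" "G_invariant G J" and T: "T \<in> induced_ideal J" and S: "S \<in> Cstar_red G"
  shows "T o\<^sub>L S \<in> induced_ideal J"
proof -
  have alg: "T o\<^sub>L reg G f \<in> induced_ideal J" if "f \<in> word_sums" for f
    using that
  proof (induction rule: word_sums.induct)
    case zero
    have "reg G (\<lambda>_. 0) = 0"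
      using norm_reg_le[OF conv_bounded_zero] by simp
    then show ?case by (simp add: induced_ideal_zero[OF J(1)])
  next
    case (add n f)
    have "T o\<^sub>L reg G (\<lambda>a. n a + f a) = (T o\<^sub>L reg G n) + (T o\<^sub>L reg G f)"
      using add by (simp add: reg_add_Bc words_Bc word_sums_Bc
          bounded_bilinear.add_right[OF bounded_bilinear_blinfun_compose])
    then show ?case
      using add by (simp add: induced_ideal_add[OF J(1)] induced_ideal_words[OF J T])
  qed
  obtain f where f: "\<And>n. f n \<in> alg_star G" "(\<lambda>n. reg G (f n)) \<longlonglongrightarrow> S"
    by (rule Cstar_seq[OF S]) blast
  show ?thesis
  proof (rule closed_sequentially[OF induced_ideal_closed[OF J(1)]])
    show "T o\<^sub>L reg G (f n) \<in> induced_ideal J" for n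
      by (rule alg[OF alg_star_word_sums[OF f(1)]])
    show "(\<lambda>n. T o\<^sub>L reg G (f n)) \<longlonglongrightarrow> (T o\<^sub>L S)"
      by (intro bounded_bilinear.tendsto[OF bounded_bilinear_blinfun_compose] tendsto_const f(2))
  qed
qed

lemma sq_norms_reg_DF:
  assumes "h \<in> DF"
  shows "sq_norms (reg G h) = (\<lambda>a. cnj (h a) * h a)"
proof
  fix a
  show "sq_norms (reg G h) a = cnj (h a) * h a"
    using assms complex_norm_square[of "h a"]
    by (cases "a \<in> gunits G")
      (simp_all add: sq_norms_def reg_DF_delta unit_rng norm_ell2_scaleC norm_delta DF_outside mult.commute)
qed

text \<open>The induced ideal contains \<open>J\<close>. If it were everything, \<open>J\<close>
  would contain the squared modulus of each \<open>h\<close> in \<open>DF\<close>, and by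
  hereditarity \<open>h\<close> itself.\<close>

theorem induced_ideal_nontrivial:
  assumes J: "nontrivial_ideal (D_alg G) J" "G_invariant G J"
  shows "nontrivial_ideal (Cstar_red G) (induced_ideal J)"
proof -
  have I: "closed_ideal (D_alg G) J" and J0: "J \<noteq> {0}" and JD: "J \<noteq> D_alg G"
    using J(1) by (auto simp: nontrivial_ideal_def)
  note Id = closed_idealD[OF I]
  have "closed_ideal (Cstar_red G) (induced_ideal J)"
    unfolding closed_ideal_def
    using induced_ideal_closed[OF I] induced_ideal_zero[OF I] induced_ideal_add[OF I]
      induced_ideal_scale[OF I] induced_ideal_left[OF I] induced_ideal_right[OF I J(2)]
    by (auto simp: induced_ideal_def)
  moreover have "induced_ideal J \<noteq> {0}"
  proof -
    obtain T where T: "T \<in> J" "T \<noteq> 0" using J0 Id(3) by blast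
    then obtain h where h: "h \<in> DF" "T = reg G h" using Id(1) by (auto simp: D_alg_eq)
    have "(\<lambda>a. cnj (h a) * h a) \<in> ideal_fun J"
      using h T by (intro ideal_fun_mult[OF I DF_cnj]) (auto simp: ideal_fun_def)
    then have "T \<in> induced_ideal J"
      using h by (simp add: induced_ideal_def ideal_fun_def reg_DF_Cstar sq_norms_reg_DF)
    then show ?thesis using T(2) by blast
  qed
  moreover have "induced_ideal J \<noteq> Cstar_red G"
  proof
    assume eq: "induced_ideal J = Cstar_red G"
    have "reg G h \<in> J" if h: "h \<in> DF" for h
    proof -
      have "sq_norms (reg G h) \<in> ideal_fun J"
        using reg_DF_Cstar[OF h] by (intro induced_ideal_fun) (simp add: eq)
      moreover have "sq_norms (reg G h) = (\<lambda>a. complex_of_real ((cmod (h a))\<^sup>2))"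
        using complex_norm_square by (simp add: sq_norms_reg_DF[OF h] fun_eq_iff mult.commute)
      ultimately have "h \<in> ideal_fun J"
        by (intro ideal_fun_hereditary[OF I _ _ h, of "\<lambda>a. (cmod (h a))\<^sup>2"]) auto
      then show ?thesis by (simp add: ideal_fun_def)
    qed
    then show False
      using JD Id(1) by (auto simp: D_alg_eq)
  qed
  ultimately show ?thesis by (simp add: nontrivial_ideal_def)
qed

end

section \<open>Ideals meeting the diagonal algebra trivially\<close>

context semi_etale_groupoid
begin

lemma unit_bump:
  assumes "compact K" "open U" "K \<subseteq> U" "U \<subseteq> gunits G"
  obtains h where "h \<in> unit_alg" "\<And>a. cmod (h a) \<le> 1" "\<And>a. a \<in> K \<Longrightarrow> h a = 1" "\<And>a. a \<notin> U \<Longrightarrow> h a = 0"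
proof -
  obtain h V where h: "h \<in> Cc G" "\<And>a. cmod (h a) \<le> 1" "K \<subseteq> V" "\<And>a. a \<in> V \<Longrightarrow> h a = 1" "supp h \<subseteq> U"
    by (rule bump[OF assms(1-3)]) blast
  have h0: "h a = 0" if "a \<notin> U" for a
    using that h(5) by (intro supp_zero[of a h]) auto
  then have "h \<in> unit_alg"
    using h(1) assms(4) by (auto simp: unit_alg_def intro: alg_star.base)
  then show thesis
    using h h0 by (intro that[of h]) auto
qed

lemma D_alg_Cstar: "T \<in> D_alg G \<Longrightarrow> T \<in> Cstar_red G"
  by (simp add: D_alg_def)

text \<open>The distance of \<^term>\<open>reg G h\<close> to an ideal meeting \<^term>\<open>D_alg G\<close> trivially is its norm. Otherwise
  \<open>k = w\<^sub>n h\<^sup>n\<close>, where \<open>k = max (\<bar>h\<bar>\<^sup>2 - c\<^sup>2) 0 \<noteq> 0\<close>, is congruent to \<open>w\<^sub>n (h - b)\<^sup>n\<close>, which tends to \<open>0\<close>.\<close>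

lemma le_norm_diff_ideal:
  assumes J: "closed_ideal (Cstar_red G) J" and triv: "\<And>k. k \<in> DF \<Longrightarrow> reg G k \<in> J \<Longrightarrow> k = (\<lambda>_. 0)"
    and h: "h \<in> DF" and b: "b \<in> J"
  shows "cmod (h y) \<le> norm (reg G h - b)"
proof (rule ccontr)
  note Jd = closed_idealD[OF J]
  let ?D = "reg G h - b"
  assume "\<not> ?thesis"
  \<comment> \<open>The lower bound makes the powers of \<open>?D\<close> decay faster than those of
    \<open>c\<close>; the upper bound makes the function \<open>k\<close> below non-zero at
    \<open>y\<close>.\<close>
  then obtain c where c: "norm ?D < c" "c < cmod (h y)"
    using dense[of "norm ?D" "cmod (h y)"] by auto
  have c0: "c > 0" using c(1) norm_ge_zero[of ?D] by linarith
  obtain M where M: "\<And>a. cmod (h a) \<le> M" using h by (rule DF_bound) blast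
  have M0: "0 \<le> M" using norm_ge_zero M by (rule order_trans)
  define s where "s a = (cmod (h a))\<^sup>2" for a
  have sDF: "(\<lambda>a. complex_of_real (s a)) \<in> DF"
    using DF_mult[OF DF_cnj[OF h] h] complex_norm_square by (simp add: s_def mult.commute)
  \<comment> \<open>The numerator vanishes up to the square of \<open>c\<close>, and beyond it the
    maximum in the denominator is \<open>r\<close>. So the quotient is continuous, and its product
    with the \<open>n\<close>-th power of \<open>r\<close> is independent of \<open>n\<close> for
    \<open>r \<ge> 0\<close>.\<close>
  define \<Phi> where "\<Phi> n r = max (r - c\<^sup>2) 0 / (max r (c\<^sup>2)) ^ n" for n and r :: real
  have mp: "max r (c\<^sup>2) > 0" for r using c0 by (simp add: less_max_iff_disj)
  have \<Phi>DF: "(\<lambda>a. complex_of_real (\<Phi> n (s a))) \<in> DF" for n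
  proof (rule DF_functional_calculus[OF sDF])
    show "continuous_on {0..} (\<Phi> n)"
      unfolding \<Phi>_def using mp by (intro continuous_intros ballI) (metis less_irrefl power_not_zero)
  qed (auto simp: s_def \<Phi>_def)
  define w where "w n a = cnj (h a) ^ n * complex_of_real (\<Phi> n (s a))" for n a
  have wDF: "w n \<in> DF" for n
  proof -
    have "(\<lambda>a. cnj (h a) ^ m * complex_of_real (\<Phi> n (s a))) \<in> DF" for m
    proof (induction m)
      case (Suc m)
      then show ?case using DF_mult[OF DF_cnj[OF h] Suc] by (simp add: mult.assoc)
    qed (use \<Phi>DF in simp)
    then show ?thesis by (simp add: w_def[abs_def])
  qed
  define k where "k a = complex_of_real (\<Phi> 0 (s a))" for a
  have kDF: "k \<in> DF" unfolding k_def[abs_def] by (rule \<Phi>DF)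
  have wk: "w n a * h a ^ n = k a" for n a
  proof -
    have "w n a * h a ^ n = complex_of_real (s a ^ n * \<Phi> n (s a))"
      using complex_norm_square[of "h a"] by (simp add: w_def s_def power_mult_distrib[symmetric] mult_ac)
    also have "s a ^ n * \<Phi> n (s a) = \<Phi> 0 (s a)"
      using mp[of "s a"] by (cases "s a \<le> c\<^sup>2") (auto simp: \<Phi>_def max_def)
    finally show ?thesis by (simp add: k_def)
  qed
  \<comment> \<open>Where \<open>w n a\<close> is non-zero, the modulus of \<open>h a\<close>
    exceeds \<open>c\<close>, and division by its \<open>n\<close>-th power costs at most the factor
    \<open>1 / c ^ n\<close>.\<close>
  have wle: "cmod (w n a) \<le> M\<^sup>2 / c ^ n" for n a
  proof (cases "s a \<le> c\<^sup>2")
    case True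
    then show ?thesis using c0 by (simp add: w_def \<Phi>_def)
  next
    case False
    then have ch: "c \<le> cmod (h a)"
      using c0 by (metis s_def norm_ge_zero not_le_imp_less less_imp_le power_mono)
    have "cmod (w n a) = (cmod (h a)) ^ n * ((s a - c\<^sup>2) / s a ^ n)"
    proof -
      have \<Phi>: "\<Phi> n (s a) = (s a - c\<^sup>2) / s a ^ n" "0 \<le> \<Phi> n (s a)"
        using False mp[of "s a"] by (simp_all add: \<Phi>_def max_def)
      have "cmod (w n a) = cmod (h a) ^ n * \<bar>\<Phi> n (s a)\<bar>"
        by (simp only: w_def norm_mult norm_power complex_mod_cnj norm_of_real)
      then show ?thesis unfolding abs_of_nonneg[OF \<Phi>(2)] unfolding \<Phi>(1) .
    qed
    also have "\<dots> = (s a - c\<^sup>2) / cmod (h a) ^ n"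
      using ch c0 by (simp add: s_def power2_eq_square power_mult_distrib)
    also have "\<dots> \<le> M\<^sup>2 / c ^ n"
    proof (rule frac_le)
      have "s a \<le> M\<^sup>2" unfolding s_def by (intro power_mono M) auto
      then show "s a - c\<^sup>2 \<le> M\<^sup>2" using zero_le_power2[of c] by linarith
      show "c ^ n \<le> cmod (h a) ^ n" using ch c0 by (intro power_mono) auto
    qed (use c0 in auto)
    finally show ?thesis .
  qed
  define P where "P n = ((\<lambda>X. ?D o\<^sub>L X) ^^ n) id_blinfun" for n
  have PSuc: "P (Suc n) = ?D o\<^sub>L P n" for n by (simp add: P_def)
  have P0: "P 0 = id_blinfun" by (simp add: P_def)
  \<comment> \<open>\<open>P n\<close> need not lie in C*_r(G), as \<open>P 0\<close> is the
    identity. Hence its factors \<open>?D\<close> are split into \<open>reg G h\<close> and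
    \<open>b\<close> and absorbed by \<open>T\<close> one at a time.\<close>
  have PJ: "T \<in> J \<Longrightarrow> T o\<^sub>L P n \<in> J" for n T
  proof (induction n arbitrary: T)
    case 0
    have "T o\<^sub>L P 0 = T" by (intro blinfun_eqI) (simp add: P0)
    then show ?case using 0 by simp
  next
    case (Suc n)
    have "T o\<^sub>L P (Suc n) = ((T o\<^sub>L reg G h) - (T o\<^sub>L b)) o\<^sub>L P n"
      by (intro blinfun_eqI) (simp add: PSuc blinfun.diff_left blinfun.diff_right)
    moreover have "(T o\<^sub>L reg G h) - (T o\<^sub>L b) \<in> J"
      by (intro closed_ideal_minus[OF J] Jd(7)[OF reg_DF_Cstar[OF h] Suc.prems]
          Jd(6)[OF subsetD[OF Jd(1) Suc.prems] b])
    ultimately show ?case using Suc.IH by simp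
  qed
  \<comment> \<open>Modulo the ideal, \<open>reg G h\<close> and \<open>?D\<close> agree; a factor
    \<open>h\<close> is moved into \<open>v\<close> and then exchanged for \<open>?D\<close>,
    leaving an error that contains \<open>b\<close>.\<close>
  have diff: "v \<in> DF \<Longrightarrow> reg G (\<lambda>a. v a * h a ^ n) - (reg G v o\<^sub>L P n) \<in> J" for n v
  proof (induction n arbitrary: v)
    case 0
    have "reg G v o\<^sub>L P 0 = reg G v" by (intro blinfun_eqI) (simp add: P0)
    then show ?case using Jd(3) by simp
  next
    case (Suc n)
    have "reg G (\<lambda>a. (v a * h a) * h a ^ n) - (reg G (\<lambda>a. v a * h a) o\<^sub>L P n) \<in> J"
      by (rule Suc.IH[OF DF_mult[OF Suc.prems h]])
    moreover have "(reg G v o\<^sub>L b) o\<^sub>L P n \<in> J"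
      by (intro PJ Jd(6) reg_DF_Cstar Suc.prems b)
    moreover have "reg G (\<lambda>a. v a * h a ^ Suc n) - (reg G v o\<^sub>L P (Suc n))
        = (reg G (\<lambda>a. (v a * h a) * h a ^ n) - (reg G (\<lambda>a. v a * h a) o\<^sub>L P n)) + ((reg G v o\<^sub>L b) o\<^sub>L P n)"
      by (intro blinfun_eqI)
         (simp add: PSuc blinfun.diff_left blinfun.diff_right blinfun.add_left reg_DF_mult Suc.prems h mult.assoc)
    ultimately show ?case using Jd(4) by simp
  qed
  have "(\<lambda>n. reg G (w n) o\<^sub>L P n) \<longlonglongrightarrow> 0"
  proof (rule Lim_null_comparison)
    have nP: "norm (P n) \<le> norm ?D ^ n" for n
    proof (induction n)
      case 0
      show ?case unfolding P0 by (rule norm_blinfun_bound) auto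
    next
      case (Suc n)
      have "norm (P (Suc n)) \<le> norm ?D * norm (P n)"
        unfolding PSuc by (rule norm_blinfun_compose)
      also have "\<dots> \<le> norm ?D * norm ?D ^ n"
        by (intro mult_left_mono Suc) auto
      finally show ?case by simp
    qed
    have "norm (reg G (w n) o\<^sub>L P n) \<le> M\<^sup>2 * (norm ?D / c) ^ n" for n
    proof -
      have "norm (reg G (w n) o\<^sub>L P n) \<le> norm (reg G (w n)) * norm (P n)"
        by (rule norm_blinfun_compose)
      also have "\<dots> \<le> (M\<^sup>2 / c ^ n) * norm ?D ^ n"
        using c0 DF_outside[OF wDF] wle
        by (intro mult_mono nP norm_reg_le conv_bounded_unit) auto
      finally show ?thesis by (simp add: power_divide)
    qed
    then show "\<forall>\<^sub>F n in sequentially. norm (reg G (w n) o\<^sub>L P n) \<le> M\<^sup>2 * (norm ?D / c) ^ n"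
      by simp
    have "(\<lambda>n. M\<^sup>2 * (norm ?D / c) ^ n) \<longlonglongrightarrow> M\<^sup>2 * 0"
      using c c0 by (intro tendsto_mult tendsto_const LIMSEQ_realpow_zero) auto
    then show "(\<lambda>n. M\<^sup>2 * (norm ?D / c) ^ n) \<longlonglongrightarrow> 0" by simp
  qed
  from tendsto_diff[OF tendsto_const[of "reg G k"] this]
  have lim: "(\<lambda>n. reg G k - (reg G (w n) o\<^sub>L P n)) \<longlonglongrightarrow> reg G k" by simp
  have "reg G k - (reg G (w n) o\<^sub>L P n) \<in> J" for n
    using diff[OF wDF, of n n] by (simp add: wk)
  from closed_sequentially[OF Jd(2) this lim] have "k = (\<lambda>_. 0)"
    by (rule triv[OF kDF])
  then have "\<Phi> 0 (s y) = 0" using k_def[of y] by (metis of_real_eq_0_iff)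
  moreover have "c\<^sup>2 < s y"
    unfolding s_def using c(2) c0 by (intro power_strict_mono) auto
  ultimately show False
    by (simp add: \<Phi>_def)
qed

text \<open>The non-units in the support form a compact set, whose image under range and source is
  closed and misses \<open>(x, x)\<close> by trivial isotropy. A product neighbourhood of
  \<open>(x, x)\<close> avoids it.\<close>

lemma trivial_isotropy_nbhd:
  assumes x: "x \<in> gunits G" "isotropy G x = {x}" and f: "f \<in> Bc G"
  shows "\<exists>V. open V \<and> x \<in> V \<and> (\<forall>a. f a \<noteq> 0 \<and> grng G a \<in> V \<and> gsrc G a \<in> V \<longrightarrow> a \<in> gunits G)"
proof -
  let ?K = "supp f - gunits G" and ?p = "\<lambda>a. (grng G a, gsrc G a)"
  have "compact (?p ` ?K)"
    by (intro compact_continuous_image compact_diff Bc_compact f open_units continuous_on_Pair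
        continuous_on_subset[OF continuous_rng] continuous_on_subset[OF continuous_src]) auto
  then have op: "open (- (?p ` ?K))"
    by (intro open_Compl compact_imp_closed)
  have "(x, x) \<notin> ?p ` ?K"
  proof
    assume "(x, x) \<in> ?p ` ?K"
    then obtain a where "a \<in> ?K" "a \<in> isotropy G x" by (auto simp: isotropy_def)
    then show False using x by auto
  qed
  then have "(x, x) \<in> - (?p ` ?K)" by (simp only: Compl_iff not_False_eq_True)
  then obtain A B where AB: "open A" "open B" "(x, x) \<in> A \<times> B" "A \<times> B \<subseteq> - (?p ` ?K)"
    by (rule open_prod_elim[OF op])
  show ?thesis
  proof (intro exI[of _ "A \<inter> B"] conjI allI impI)
    fix a assume a: "f a \<noteq> 0 \<and> grng G a \<in> A \<inter> B \<and> gsrc G a \<in> A \<inter> B"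
    then have "a \<in> supp f" using supp_zero[of a f] by blast
    moreover have "?p a \<notin> ?p ` ?K" using a AB(4) by blast
    ultimately show "a \<in> gunits G" by blast
  qed (use AB in auto)
qed

lemma diag_ideal_eq_0:
  assumes J: "closed_ideal (Cstar_red G) J" and triv: "\<And>k. k \<in> DF \<Longrightarrow> reg G k \<in> J \<Longrightarrow> k = (\<lambda>_. 0)"
    and x: "x \<in> gunits G" "isotropy G x = {x}" and T: "T \<in> J"
  shows "diag T x = 0"
proof -
  note Jd = closed_idealD[OF J]
  have "cmod (diag T x) \<le> 0 + e" if "e > 0" for e
  proof -
    have "T \<in> closure (reg G ` alg_star G)"
      using T Jd(1) by (auto simp: Cstar_red_def)
    moreover have "e / 2 > 0" using that by simp
    ultimately obtain f where f: "f \<in> alg_star G" "dist (reg G f) T < e / 2"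
      unfolding closure_approachable by blast
    have fB: "f \<in> Bc G" by (rule alg_star_Bc[OF f(1)])
    obtain V where V: "open V" "x \<in> V" "\<And>a. f a \<noteq> 0 \<Longrightarrow> grng G a \<in> V \<Longrightarrow> gsrc G a \<in> V \<Longrightarrow> a \<in> gunits G"
      using trivial_isotropy_nbhd[OF x fB] by blast
    obtain h where h: "h \<in> unit_alg" "\<And>a. cmod (h a) \<le> 1" "\<And>a. a \<in> {x} \<Longrightarrow> h a = 1"
      "\<And>a. a \<notin> V \<inter> gunits G \<Longrightarrow> h a = 0"
      by (rule unit_bump[of "{x}" "V \<inter> gunits G"]) (use V x open_units in auto)
    have hB: "h \<in> Bc G" by (rule unit_alg_Bc[OF h(1)])
    let ?q = "conv G (conv G h f) h"
    have q: "?q c = h (grng G c) * f c * h (gsrc G c)" for c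
    proof -
      have "?q c = conv G h f c * h (gsrc G c)"
        by (rule conv_unit_right) (simp add: h(4))
      moreover have "conv G h f c = h (grng G c) * f c"
        by (rule conv_unit) (simp add: h(4))
      ultimately show ?thesis by simp
    qed
    \<comment> \<open>A non-zero value requires both ends of \<open>c\<close> to lie in
      \<open>V\<close>, and the choice of \<open>V\<close> then forces \<open>c\<close> to be a
      unit.\<close>
    have "?q c = 0" if "c \<notin> gunits G" for c
      using that V(3)[of c] h(4)[of "grng G c"] h(4)[of "gsrc G c"] unfolding q by auto
    then have qu: "?q \<in> unit_alg"
      using f(1) h(1) by (auto simp: unit_alg_def intro: alg_star.intros)
    have hA: "reg G h \<in> Cstar_red G"
      by (intro reg_DF_Cstar unit_alg_DF h)
    have "reg G h o\<^sub>L T o\<^sub>L reg G h \<in> J"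
      by (intro Jd(7)[OF hA] Jd(6)[OF hA] T)
    \<comment> \<open>Since \<open>h x = 1\<close>, the left side is the modulus of
      \<open>f x\<close>; the right side is the norm of \<open>f - T\<close> compressed by the
      contraction \<open>h\<close>.\<close>
    from le_norm_diff_ideal[OF J triv unit_alg_DF[OF qu] this, of x]
    have "cmod (?q x) \<le> norm (reg G ?q - (reg G h o\<^sub>L T o\<^sub>L reg G h))" by simp
    also have "reg G ?q - (reg G h o\<^sub>L T o\<^sub>L reg G h) = reg G h o\<^sub>L (reg G f - T) o\<^sub>L reg G h"
      by (intro blinfun_eqI) (simp add: reg_conv conv_Bc hB fB blinfun.diff_left blinfun.diff_right)
    also have "norm \<dots> \<le> norm (reg G h) * norm (reg G f - T) * norm (reg G h)"
      by (intro order_trans[OF norm_blinfun_compose] mult_right_mono norm_blinfun_compose) auto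
    also have "\<dots> \<le> 1 * norm (reg G f - T) * 1"
    proof -
      have "norm (reg G h) \<le> 1"
        by (intro norm_reg_le conv_bounded_unit h(2)) (simp add: h(4))
      then show ?thesis by (intro mult_mono) auto
    qed
    finally have "cmod (f x) \<le> e / 2"
      using f(2) x h(3)[of x] by (simp add: q dist_norm unit_rng unit_src)
    moreover have "cmod (diag T x - f x) \<le> norm (T - reg G f)"
      using diag_diff[of T x "reg G f"] x(1) by (simp add: diag_reg_Bc[OF fB] unit_part_def)
    ultimately show ?thesis
      using norm_triangle_ineq[of "diag T x - f x" "f x"] f(2) by (simp add: dist_norm norm_minus_commute)
  qed
  then have "cmod (diag T x) \<le> 0" by (rule field_le_epsilon)
  then show ?thesis by simp
qed

text \<open>Let functions \<open>f n\<close> in alg*G approximate \<open>T\<close>. The products of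
  the involutions of the \<open>f n\<close> with \<open>T\<close> lie in \<open>J\<close>, so their
  diagonals vanish at \<open>x\<close>; in the limit these diagonals give the squared norm of
  \<open>T (delta x)\<close>.\<close>

lemma ideal_delta_eq_0:
  assumes J: "closed_ideal (Cstar_red G) J" and triv: "\<And>k. k \<in> DF \<Longrightarrow> reg G k \<in> J \<Longrightarrow> k = (\<lambda>_. 0)"
    and x: "x \<in> gunits G" "isotropy G x = {x}" and T: "T \<in> J"
  shows "T (delta x) = 0"
proof -
  have TA: "T \<in> Cstar_red G" using T closed_idealD(1)[OF J] by blast
  obtain f where f: "\<And>n. f n \<in> alg_star G" "(\<lambda>n. reg G (f n)) \<longlonglongrightarrow> T"
    by (rule Cstar_seq[OF TA]) blast
  have "inner (T (delta x)) (reg G (f n) (delta x)) = 0" for n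
  proof -
    let ?S = "reg G (invol G (f n)) o\<^sub>L T"
    have inv: "invol G (f n) \<in> Bc G" "invol G (invol G (f n)) = f n"
      using f(1) by (auto simp: invol_def fun_eq_iff intro: invol_Bc alg_star_Bc)
    have "?S \<in> J"
      using f(1) by (intro closed_idealD(6)[OF J] T reg_Cstar alg_star.invol)
    then have "ell2_fun (?S (delta x)) x = 0"
      using diag_ideal_eq_0[OF J triv x] x(1) unfolding diag_def by metis
    then have "inner (?S (delta x)) (ell2_scaleC 1 (delta x)) = 0"
      unfolding inner_delta by simp
    moreover have "ell2_scaleC 1 (delta x) = delta x"
      by (rule ell2_eqI) (simp add: ell2_scaleC.rep_eq)
    ultimately show ?thesis
      using reg_invol[OF inv(1), of "T (delta x)" "delta x"] by (simp add: inv(2))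
  qed
  moreover have "(\<lambda>n. inner (T (delta x)) (reg G (f n) (delta x))) \<longlonglongrightarrow> inner (T (delta x)) (T (delta x))"
    by (intro tendsto_inner blinfun.tendsto f tendsto_const)
  ultimately show ?thesis
    by (simp add: LIMSEQ_const_iff)
qed

text \<open>Conjugation by \<open>g\<close> carries an isotropy element at the range to one at the
  source. Trivial isotropy thus spreads along the orbit.\<close>

lemma isotropy_conj:
  assumes "isotropy G (gsrc G g) = {gsrc G g}"
  shows "isotropy G (grng G g) = {grng G g}"
proof -
  have "b = grng G g" if b: "grng G b = grng G g" "gsrc G b = grng G g" for b
  proof -
    have "gmul G (ginv G g) (gmul G b g) \<in> isotropy G (gsrc G g)"
      using b by (simp add: isotropy_def rng_mul src_mul src_inv rng_inv)
    then have "gmul G (ginv G g) (gmul G b g) = gsrc G g"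
      using assms by simp
    then have "gmul G b g = g"
      using mul_inv_cancel[of g "gmul G b g"] b by (simp add: rng_mul mul_src_right)
    then have "gmul G (gmul G b g) (ginv G g) = grng G g"
      by (simp add: mul_inv_right)
    then show ?thesis
      using b mul_src_right[of b] by (simp add: mul_assoc rng_inv mul_inv_right)
  qed
  then show ?thesis
    by (auto simp: isotropy_def unit_rng unit_src rng_unit)
qed

text \<open>As \<open>g\<close> runs through the arrows with source \<open>x\<close>, its range runs
  through the orbit of \<open>x\<close>.\<close>

definition orbit_ideal :: "'g \<Rightarrow> 'g ell2_op set" where
  "orbit_ideal x = {T \<in> D_alg G. \<forall>g. gsrc G g = x \<longrightarrow> diag T (grng G g) = 0}"

lemma reg_orbit_ideal:
  "h \<in> DF \<Longrightarrow> reg G h \<in> orbit_ideal x \<longleftrightarrow> (\<forall>g. gsrc G g = x \<longrightarrow> h (grng G g) = 0)"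
  by (simp add: orbit_ideal_def diag_reg_DF reg_DF_D_alg)

lemma DF_zero: "(\<lambda>_. 0) \<in> DF"
  by (intro unit_alg_DF) (simp add: unit_alg_def alg_star_zero)

lemma reg_zero: "reg G (\<lambda>_. 0) = 0"
  using norm_reg_le[OF conv_bounded_zero] by simp

lemma orbit_ideal_closed_ideal: "closed_ideal (D_alg G) (orbit_ideal x)"
  unfolding closed_ideal_def
proof (intro conjI ballI allI)
  have rep: "\<exists>h\<in>DF. T = reg G h" if "T \<in> D_alg G" for T
    using that by (auto simp: D_alg_eq)
  have sub: "T \<in> D_alg G" if "T \<in> orbit_ideal x" for T
    using that by (simp add: orbit_ideal_def)
  then show "orbit_ideal x \<subseteq> D_alg G" by blast
  show "closed (orbit_ideal x)"
    unfolding closed_sequential_limits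
  proof (intro allI impI, elim conjE)
    fix X T assume X: "\<forall>n. X n \<in> orbit_ideal x" and lim: "X \<longlonglongrightarrow> T"
    have "T \<in> D_alg G"
      by (rule closed_sequentially[OF closed_D_alg _ lim]) (use X in \<open>simp add: orbit_ideal_def\<close>)
    moreover have "diag T (grng G g) = 0" if "gsrc G g = x" for g
    proof -
      have "(\<lambda>n. X n - T) \<longlonglongrightarrow> 0" using lim by (simp add: LIM_zero)
      then have nlim: "(\<lambda>n. norm (X n - T)) \<longlonglongrightarrow> 0" by (rule tendsto_norm_zero)
      have "cmod (diag T (grng G g)) \<le> norm (X n - T)" for n
        using diag_diff[of "X n" "grng G g" T] X that by (simp add: orbit_ideal_def)
      then have "cmod (diag T (grng G g)) \<le> 0"
        by (rule_tac LIMSEQ_le_const[OF nlim]) simp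
      then show ?thesis by simp
    qed
    ultimately show "T \<in> orbit_ideal x" by (simp add: orbit_ideal_def)
  qed
  show "0 \<in> orbit_ideal x"
    using reg_orbit_ideal[OF DF_zero] by (simp add: reg_zero)
  show "S + T \<in> orbit_ideal x" if S: "S \<in> orbit_ideal x" and T: "T \<in> orbit_ideal x" for S T
  proof -
    obtain h k where "h \<in> DF" "S = reg G h" "k \<in> DF" "T = reg G k"
      using rep[OF sub[OF S]] rep[OF sub[OF T]] by blast
    then show ?thesis
      using S T by (simp add: reg_orbit_ideal DF_add flip: reg_DF_add)
  qed
  show "op_scaleC c T \<in> orbit_ideal x" if T: "T \<in> orbit_ideal x" for c T
  proof -
    obtain h where "h \<in> DF" "T = reg G h"
      using rep[OF sub[OF T]] by blast
    then show ?thesis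
      using T by (simp add: reg_orbit_ideal DF_scale flip: reg_DF_scale)
  qed
  fix S T assume ST: "S \<in> D_alg G" "T \<in> orbit_ideal x"
  obtain h k where "h \<in> DF" "S = reg G h" "k \<in> DF" "T = reg G k"
    using rep[OF ST(1)] rep[OF sub[OF ST(2)]] by blast
  then show "S o\<^sub>L T \<in> orbit_ideal x" "T o\<^sub>L S \<in> orbit_ideal x"
    using ST by (simp_all add: reg_orbit_ideal DF_mult flip: reg_DF_mult)
qed

lemma orbit_ideal_invariant: "G_invariant G (orbit_ideal x)"
  unfolding G_invariant_def
proof (intro ballI)
  fix n T assume n: "n \<in> N0 G" and T: "T \<in> orbit_ideal x"
  obtain U where U: "bisection G U" "supp n \<subseteq> U" and na: "n \<in> alg_star G"
    using n by (auto simp: N0_def)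
  have U0: "n a = 0" if "a \<notin> U" for a
    using U(2) that by (intro supp_zero[of a n]) auto
  have inj: "inj_on (grng G) U" "inj_on (gsrc G) U" using U(1) by (auto simp: bisection_def)
  have TD: "T \<in> D_alg G" using T by (simp add: orbit_ideal_def)
  then obtain h where h: "h \<in> DF" "T = reg G h" by (auto simp: D_alg_eq)
  let ?P = "reg G (invol G n) o\<^sub>L T o\<^sub>L reg G n"
  have "diag ?P (grng G g) = 0" if g: "gsrc G g = x" for g
  proof (cases "grng G g \<in> gsrc G ` U")
    case True
    then obtain d where d: "d \<in> U" "gsrc G d = grng G g" by auto
    \<comment> \<open>The arrow \<open>gmul G d g\<close> starts at \<open>x\<close>, so the range
      of \<open>d\<close> is again in the orbit.\<close>
    have "h (grng G (gmul G d g)) = 0"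
      using T g d(2) h by (simp add: reg_orbit_ideal src_mul)
    then show ?thesis
      using diag_conj(1)[OF alg_star_Bc[OF na] inj(2) U0 h(1) d(1)] d(2) by (simp add: h(2) rng_mul)
  next
    case False
    then show ?thesis
      using diag_conj(2)[OF alg_star_Bc[OF na] inj(2) U0 h(1)] by (simp add: h(2))
  qed
  then show "?P \<in> orbit_ideal x"
    using conj_D_alg[OF na inj(1) U0 TD] by (simp add: orbit_ideal_def)
qed

lemma orbit_ideal_proper:
  assumes "x \<in> gunits G"
  shows "orbit_ideal x \<noteq> D_alg G"
proof
  assume eq: "orbit_ideal x = D_alg G"
  obtain h where h: "h \<in> unit_alg" "\<And>a. a \<in> {x} \<Longrightarrow> h a = 1"
    by (rule unit_bump[of "{x}" "gunits G"]) (use assms open_units in auto)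
  have "reg G h \<in> orbit_ideal x"
    unfolding eq by (intro reg_DF_D_alg unit_alg_DF h)
  then have "h (grng G x) = 0"
    using assms by (simp add: reg_orbit_ideal unit_alg_DF h(1) unit_src)
  then show False
    using h(2) assms by (simp add: unit_rng)
qed

lemma ideal_eq_0:
  assumes J: "closed_ideal (Cstar_red G) J" and triv: "\<And>k. k \<in> DF \<Longrightarrow> reg G k \<in> J \<Longrightarrow> k = (\<lambda>_. 0)"
    and x: "x \<in> gunits G" "isotropy G x = {x}"
    and no: "\<nexists>I. nontrivial_ideal (D_alg G) I \<and> G_invariant G I"
  shows "J = {0}"
proof -
  have "\<not> nontrivial_ideal (D_alg G) (orbit_ideal x)"
    using no orbit_ideal_invariant by blast
  then have orb: "orbit_ideal x = {0}"
    using orbit_ideal_closed_ideal orbit_ideal_proper[OF x(1)] by (auto simp: nontrivial_ideal_def)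
  have "T = 0" if T: "T \<in> J" for T
  proof -
    have TA: "T \<in> Cstar_red G" using T closed_idealD(1)[OF J] by blast
    have "T (delta (grng G g)) = 0" if "gsrc G g = x" for g
      using that x(2) by (intro ideal_delta_eq_0[OF J triv _ _ T] rng_unit isotropy_conj) auto
    then have "reg G (sq_norms T) \<in> orbit_ideal x"
      by (simp add: reg_orbit_ideal sq_norms_DF TA sq_norms_def)
    then have "reg G (sq_norms T) = 0" by (simp add: orb)
    then have "sq_norms T = diag 0"
      using diag_reg_DF[OF sq_norms_DF[OF TA]] by simp
    then have "norm (T (delta y)) = 0" if "y \<in> gunits G" for y
      using that by (auto simp: sq_norms_def diag_def dest: fun_cong[of _ _ y])
    \<comment> \<open>So far \<open>T\<close> is known to vanish at units only; translation
      invariance covers the other point masses.\<close>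
    then have "norm (T (delta g)) = 0" for g
      using norm_delta_rng[OF TA, of g] rng_unit by simp
    then show ?thesis
      by (intro Cstar_eq_0I TA) simp
  qed
  then show ?thesis
    using closed_idealD(3)[OF J] by blast
qed

text \<open>Each \<open>f\<close> in alg*G is reproduced by a function in the diagonal algebra that
  is 1 on the compact range of its support.\<close>

lemma ideal_eq_Cstar:
  assumes J: "closed_ideal (Cstar_red G) J" and D: "D_alg G \<subseteq> J"
  shows "J = Cstar_red G"
proof -
  note Jd = closed_idealD[OF J]
  have "reg G f \<in> J" if f: "f \<in> alg_star G" for f
  proof -
    have fB: "f \<in> Bc G" by (rule alg_star_Bc[OF f])
    have "compact (grng G ` supp f)"
      by (intro compact_continuous_image continuous_on_subset[OF continuous_rng] Bc_compact fB) auto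
    then obtain h where h: "h \<in> unit_alg" "\<And>a. a \<in> grng G ` supp f \<Longrightarrow> h a = 1"
      by (rule unit_bump[of "grng G ` supp f" "gunits G"]) (use open_units rng_unit in auto)
    have "conv G h f = f"
    proof
      fix c
      show "conv G h f c = f c"
        using h(2)[of "grng G c"] supp_zero[of c f] h(1)
        by (subst conv_unit) (auto simp: unit_alg_def)
    qed
    then have "reg G h o\<^sub>L reg G f = reg G f"
      using reg_conv[OF unit_alg_Bc[OF h(1)] fB] by simp
    moreover have "reg G h \<in> J"
      using D by (intro subsetD[OF D] reg_DF_D_alg unit_alg_DF h)
    ultimately show ?thesis
      using Jd(7)[OF reg_Cstar[OF f]] by metis
  qed
  then have "Cstar_red G \<subseteq> J"
    unfolding Cstar_red_def by (intro closure_minimal Jd(2)) auto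
  then show ?thesis using Jd(1) by blast
qed

text \<open>Conjugates by functions in \<open>N0 G\<close> stay in \<open>J\<close> because it is
  two-sided, and in the diagonal algebra by \<open>conj_D_alg\<close>.\<close>

lemma Int_D_alg_ideal:
  assumes J: "closed_ideal (Cstar_red G) J"
  shows "closed_ideal (D_alg G) (J \<inter> D_alg G)" "G_invariant G (J \<inter> D_alg G)"
proof -
  note Jd = closed_idealD[OF J]
  have rep: "\<exists>h\<in>DF. T = reg G h" if "T \<in> D_alg G" for T
    using that by (auto simp: D_alg_eq)
  show "closed_ideal (D_alg G) (J \<inter> D_alg G)"
    unfolding closed_ideal_def
  proof (intro conjI ballI allI)
    show "closed (J \<inter> D_alg G)" by (intro closed_Int Jd(2) closed_D_alg)
    show "0 \<in> J \<inter> D_alg G" using Jd(3) reg_DF_D_alg[OF DF_zero] by (simp add: reg_zero)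
    show "S + T \<in> J \<inter> D_alg G" if "S \<in> J \<inter> D_alg G" "T \<in> J \<inter> D_alg G" for S T
      using that Jd(4) rep[of S] rep[of T] by (auto simp: reg_DF_D_alg DF_add simp flip: reg_DF_add)
    show "op_scaleC c T \<in> J \<inter> D_alg G" if "T \<in> J \<inter> D_alg G" for c T
      using that Jd(5) rep[of T] by (auto simp: reg_DF_D_alg DF_scale simp flip: reg_DF_scale)
    fix S T assume ST: "S \<in> D_alg G" "T \<in> J \<inter> D_alg G"
    have "S o\<^sub>L T \<in> J" "T o\<^sub>L S \<in> J"
      using ST by (auto intro: Jd(6,7) D_alg_Cstar)
    moreover have "S o\<^sub>L T \<in> D_alg G" "T o\<^sub>L S \<in> D_alg G"
      using ST rep[of S] rep[of T] by (auto simp: reg_DF_D_alg DF_mult simp flip: reg_DF_mult)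
    ultimately show "S o\<^sub>L T \<in> J \<inter> D_alg G" "T o\<^sub>L S \<in> J \<inter> D_alg G" by auto
  qed auto
  show "G_invariant G (J \<inter> D_alg G)"
    unfolding G_invariant_def
  proof (intro ballI IntI)
    fix n T assume n: "n \<in> N0 G" and T: "T \<in> J \<inter> D_alg G"
    obtain U where U: "bisection G U" "supp n \<subseteq> U" and na: "n \<in> alg_star G"
      using n by (auto simp: N0_def)
    show "reg G (invol G n) o\<^sub>L T o\<^sub>L reg G n \<in> J"
      using T by (intro Jd(7)[OF reg_Cstar[OF na]] Jd(6)[OF reg_Cstar[OF alg_star.invol[OF na]]]) auto
    have "n a = 0" if "a \<notin> U" for a
      using U(2) that by (intro supp_zero[of a n]) auto
    then show "reg G (invol G n) o\<^sub>L T o\<^sub>L reg G n \<in> D_alg G"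
      using T U(1) by (intro conj_D_alg[OF na, of U]) (auto simp: bisection_def)
  qed
qed

lemma simple_Cstar_red:
  assumes x: "x \<in> gunits G" "isotropy G x = {x}"
    and no: "\<nexists>I. nontrivial_ideal (D_alg G) I \<and> G_invariant G I"
  shows "simple_algebra (Cstar_red G)"
  unfolding simple_algebra_def
proof
  assume "\<exists>J. nontrivial_ideal (Cstar_red G) J"
  then obtain J where J: "closed_ideal (Cstar_red G) J" "J \<noteq> {0}" "J \<noteq> Cstar_red G"
    by (auto simp: nontrivial_ideal_def)
  consider "J \<inter> D_alg G = {0}" | "J \<inter> D_alg G = D_alg G"
    using no Int_D_alg_ideal[OF J(1)] unfolding nontrivial_ideal_def by blast
  then show False
  proof cases
    case 1
    have "k = (\<lambda>_. 0)" if k: "k \<in> DF" "reg G k \<in> J" for k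
    proof -
      have "reg G k = 0" using 1 k reg_DF_D_alg by blast
      then have "k = diag 0" using diag_reg_DF[OF k(1)] by simp
      then show ?thesis by (simp add: diag_def fun_eq_iff)
    qed
    then show False using ideal_eq_0[OF J(1) _ x no] J(2) by blast
  next
    case 2
    then show False using ideal_eq_Cstar[OF J(1)] J(3) by blast
  qed
qed

end

theorem theorem2p17:
  fixes G :: "('g :: t2_space) groupoid"
  assumes "semi_etale_groupoid G"
    and "\<exists>x\<in>gunits G. isotropy G x = {x}"
  shows "simple_algebra (Cstar_red G) \<longleftrightarrow>
    \<not> (\<exists>J. nontrivial_ideal (D_alg G) J \<and> G_invariant G J)"
proof -
  interpret semi_etale_groupoid G by (rule assms(1))
  show ?thesis
    using simple_Cstar_red assms(2) induced_ideal_nontrivial unfolding simple_algebra_def by blast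
qed

end
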